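(* Let $n\ge1$, let $m$ be a non-negative integer, let $\alpha>0$, let $0<p\le\infty$, and let $u:\mathbb{C}^n\to\mathbb{C}$ and $\psi:\mathbb{C}^n\to\mathbb{C}^n$ be entire. Then $uC_\psi:\mathcal{F}^p_{(m,\alpha)}\to\mathcal{F}^\infty_{(m,\alpha)}$ is (i) bounded if and only if $B^\infty_{(m,\psi)}(|u|)\in L^\infty$. Moreover, $$\|uC_\psi\|\simeq\|B^\infty_{(m,\psi)}(|u|)\|_{L^\infty}.$$ (ii) compact if and only if it is bounded and $$\lim_{|\psi(z)|\to\infty}B^\infty_{(m,\psi)}(|u|)(z)=0.$$
   Context: $dV$ is Lebesgue measure on $\mathbb{C}^n$, $\langle z,w\rangle=\sum_j z_j\overline{w_j}$, $|z|=\sqrt{\langle z,z\rangle}$, $L^\infty=L^\infty(\mathbb{C}^n,dV)$. For $0<p<\infty$ put $\|f\|_p^p=(\frac{\alpha p}{2\pi})^n\int_{\mathbb{C}^n}|f(z)|^pe^{-\frac{\alpha p}{2}|z|^2}dV(z)$, and $\|f\|_\infty=\sup_z|f(z)|e^{-\frac{\alpha}{2}|z|^2}$. The Fock--Sobolev space $\mathcal{F}^p_{(m,\alpha)}$ ($0<p\le\infty$) of order $m$ consists of the entire functions $f$ on $\mathbb{C}^n$ with $\sum_{\beta_1+\dots+\beta_n\le m}\|\partial^\beta f\|_p<\infty$. It is equipped throughout with the equivalent (quasi-)norm $\|f\|_{(p,m)}=\big(C_{(p,m,n)}\int_{\mathbb{C}^n}|z|^{mp}|f(z)|^pe^{-\frac{\alpha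 p}{2}|z|^2}dV(z)\big)^{1/p}$ for $p<\infty$, where $C_{(p,m,n)}=(\frac{\alpha p}{2})^{\frac{mp}{2}+n}\frac{\Gamma(n)}{\pi^n\Gamma(\frac{mp}{2}+n)}$, and $\|f\|_{(\infty,m)}=\sup_z|z|^m|f(z)|e^{-\frac{\alpha}{2}|z|^2}$ for $p=\infty$. The weighted composition operator is $uC_\psi f=u\cdot(f\circ\psi)$, and $$B^\infty_{(m,\psi)}(|u|)(z)=\frac{|z|^m|u(z)|}{(1+|\psi(z)|)^m}e^{\frac{\alpha}{2}(|\psi(z)|^2-|z|^2)}.$$ The limit $\lim_{|\psi(z)|\to\infty}F(z)=0$ means: for every $\epsilon>0$ there is $N>0$ with $|F(z)|<\epsilon$ whenever $|\psi(z)|>N$ (it holds trivially if $\psi$ is bounded). $U\simeq V$ means $U\le CV$ and $V\le CU$ with a constant $C$ independent of $u,\psi$. *)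

theory Defs
  imports "HOL-Probability.Essential_Supremum"
begin

text \<open>
  The space \<open>\<complex>\<^sup>n\<close> is \<^typ>\<open>complex ^ 'n\<close>, whose \<^const>\<open>norm\<close> is the Euclidean one, whose complex
  scalar multiplication is \<open>*s\<close>, and on which \<^const>\<open>lborel\<close> is the \<open>2n\<close>-dimensional Lebesgue
  measure.  Exponents \<open>0 < p \<le> \<infinity>\<close> are elements of \<^typ>\<open>ennreal\<close>, and (quasi-)norms are
  \<^typ>\<open>ennreal\<close>-valued, so that they make sense for every function.
\<close>

definition entire :: "(complex ^ 'n \<Rightarrow> complex) \<Rightarrow> bool" where
  "entire f \<longleftrightarrow>
     (\<forall>z. \<exists>D. (f has_derivative D) (at z) \<and> (\<forall>c h. D (c *s h) = c * D h))"

definition entire_map :: "(complex ^ 'n \<Rightarrow> complex ^ 'k) \<Rightarrow> bool" where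
  "entire_map \<psi> \<longleftrightarrow> (\<forall>j. entire (\<lambda>z. \<psi> z $ j))"

definition partial :: "'n \<Rightarrow> (complex ^ 'n \<Rightarrow> complex) \<Rightarrow> complex ^ 'n \<Rightarrow> complex" where
  "partial j f z = deriv (\<lambda>t. f (z + axis j t)) 0"

text \<open>
  The partial derivatives of order \<open>\<beta> j\<close> in the \<open>j\<close>-th variable are composed along some fixed
  enumeration of the coordinates, whose choice is immaterial for entire functions.
\<close>

definition coords :: "'n::finite list" where
  "coords = (SOME js. distinct js \<and> set js = UNIV)"

lemma coords: "distinct (coords :: 'n::finite list)" "set (coords :: 'n list) = UNIV"
proof -
  obtain js :: "'n list" where "distinct js \<and> set js = UNIV"
    using finite_distinct_list[OF finite] by blast
  then have "distinct (coords :: 'n list) \<and> set (coords :: 'n list) = UNIV"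
    unfolding coords_def by (rule someI)
  then show "distinct (coords :: 'n list)" "set (coords :: 'n list) = UNIV"
    by auto
qed

definition mpartial :: "('n \<Rightarrow> nat) \<Rightarrow> (complex ^ 'n::finite \<Rightarrow> complex) \<Rightarrow> complex ^ 'n \<Rightarrow> complex"
  where "mpartial \<beta> f = foldr (\<lambda>j. partial j ^^ \<beta> j) coords f"

definition ennreal_pow :: "ennreal \<Rightarrow> real \<Rightarrow> ennreal" where
  "ennreal_pow x r = (if x = \<infinity> then \<infinity> else ennreal (enn2real x powr r))"

definition fock_norm :: "ennreal \<Rightarrow> real \<Rightarrow> (complex ^ 'n \<Rightarrow> complex) \<Rightarrow> ennreal" where
  "fock_norm p \<alpha> f =
     (if p = \<infinity> then (SUP z. ennreal (norm (f z) * exp (- (\<alpha> / 2) * (norm z)\<^sup>2)))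
      else let q = enn2real p in
        ennreal_pow
          (ennreal ((\<alpha> * q / (2 * pi)) ^ CARD('n)) *
           (\<integral>\<^sup>+ z. ennreal (norm (f z) powr q * exp (- (\<alpha> * q / 2) * (norm z)\<^sup>2)) \<partial>lborel))
          (1 / q))"

definition fock_sobolev :: "ennreal \<Rightarrow> nat \<Rightarrow> real \<Rightarrow> (complex ^ 'n \<Rightarrow> complex) set" where
  "fock_sobolev p m \<alpha> =
     {f. entire f \<and>
         (\<Sum>\<beta> \<in> {\<beta> :: 'n \<Rightarrow> nat. (\<Sum>j\<in>UNIV. \<beta> j) \<le> m}. fock_norm p \<alpha> (mpartial \<beta> f)) < \<infinity>}"

lemma finite_multiindices: "finite {\<beta> :: 'n::finite \<Rightarrow> nat. (\<Sum>j\<in>UNIV. \<beta> j) \<le> m}"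
proof (rule finite_subset)
  show "{\<beta> :: 'n \<Rightarrow> nat. (\<Sum>j\<in>UNIV. \<beta> j) \<le> m} \<subseteq> PiE UNIV (\<lambda>_. {..m})"
  proof
    fix \<beta> :: "'n \<Rightarrow> nat"
    assume "\<beta> \<in> {\<beta>. (\<Sum>j\<in>UNIV. \<beta> j) \<le> m}"
    then have "\<beta> j \<le> m" for j
      using member_le_sum[of j UNIV \<beta>] by simp
    then show "\<beta> \<in> PiE UNIV (\<lambda>_. {..m})"
      by (auto simp: PiE_def)
  qed
qed (rule finite_PiE; simp)

text \<open>
  In the integral, \<open>|z|\<^sup>m\<^sup>p\<close> is written as a power of \<open>|z|\<^sup>m\<close>: this keeps the value \<open>1\<close> at \<open>z = 0\<close>
  when \<open>m = 0\<close>, whereas \<open>0 powr 0 = 0\<close>.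
\<close>

definition fs_const :: "real \<Rightarrow> nat \<Rightarrow> real \<Rightarrow> nat \<Rightarrow> real" where
  "fs_const q m \<alpha> n =
     (\<alpha> * q / 2) powr (real m * q / 2 + real n) *
     (Gamma (real n) / (pi ^ n * Gamma (real m * q / 2 + real n)))"

definition fs_norm :: "ennreal \<Rightarrow> nat \<Rightarrow> real \<Rightarrow> (complex ^ 'n \<Rightarrow> complex) \<Rightarrow> ennreal" where
  "fs_norm p m \<alpha> f =
     (if p = \<infinity> then (SUP z. ennreal (norm z ^ m * norm (f z) * exp (- (\<alpha> / 2) * (norm z)\<^sup>2)))
      else let q = enn2real p in
        ennreal_pow
          (ennreal (fs_const q m \<alpha> CARD('n)) *
           (\<integral>\<^sup>+ z. ennreal ((norm z ^ m) powr q * norm (f z) powr q *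
                      exp (- (\<alpha> * q / 2) * (norm z)\<^sup>2)) \<partial>lborel))
          (1 / q))"

definition wcomp ::
  "(complex ^ 'n \<Rightarrow> complex) \<Rightarrow> (complex ^ 'n \<Rightarrow> complex ^ 'n) \<Rightarrow>
   (complex ^ 'n \<Rightarrow> complex) \<Rightarrow> complex ^ 'n \<Rightarrow> complex" where
  "wcomp u \<psi> f = (\<lambda>z. u z * f (\<psi> z))"

text \<open>
  The following notions concern linear maps \<open>T\<close> from the Fock--Sobolev space with exponent \<open>p\<close> to
  the one with exponent \<open>\<infinity>\<close>.  Boundedness and compactness include that \<open>T\<close> maps the former space
  into the latter.  Compactness means that the image of the closed unit ball is relatively compact
  in the metric induced by the norm of the target space.
\<close>

definition bounded_op ::
  "ennreal \<Rightarrow> nat \<Rightarrow> real \<Rightarrow> ((complex ^ 'n \<Rightarrow> complex) \<Rightarrow> complex ^ 'n \<Rightarrow> complex) \<Rightarrow> bool" where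
  "bounded_op p m \<alpha> T \<longleftrightarrow>
     T ` fock_sobolev p m \<alpha> \<subseteq> fock_sobolev \<infinity> m \<alpha> \<and>
     (\<exists>C::real. \<forall>f \<in> fock_sobolev p m \<alpha>. fs_norm \<infinity> m \<alpha> (T f) \<le> ennreal C * fs_norm p m \<alpha> f)"

definition unit_ball :: "ennreal \<Rightarrow> nat \<Rightarrow> real \<Rightarrow> (complex ^ 'n \<Rightarrow> complex) set" where
  "unit_ball p m \<alpha> = {f \<in> fock_sobolev p m \<alpha>. fs_norm p m \<alpha> f \<le> 1}"

definition op_norm ::
  "ennreal \<Rightarrow> nat \<Rightarrow> real \<Rightarrow> ((complex ^ 'n \<Rightarrow> complex) \<Rightarrow> complex ^ 'n \<Rightarrow> complex) \<Rightarrow> ennreal" where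
  "op_norm p m \<alpha> T = (SUP f \<in> unit_ball p m \<alpha>. fs_norm \<infinity> m \<alpha> (T f))"

definition fs_dist ::
  "nat \<Rightarrow> real \<Rightarrow> (complex ^ 'n \<Rightarrow> complex) \<Rightarrow> (complex ^ 'n \<Rightarrow> complex) \<Rightarrow> real" where
  "fs_dist m \<alpha> f g = enn2real (fs_norm \<infinity> m \<alpha> (\<lambda>z. f z - g z))"

definition fs_topology :: "nat \<Rightarrow> real \<Rightarrow> (complex ^ 'n \<Rightarrow> complex) topology" where
  "fs_topology m \<alpha> = Metric_space.mtopology (fock_sobolev \<infinity> m \<alpha>) (fs_dist m \<alpha>)"

definition compact_op ::
  "ennreal \<Rightarrow> nat \<Rightarrow> real \<Rightarrow> ((complex ^ 'n \<Rightarrow> complex) \<Rightarrow> complex ^ 'n \<Rightarrow> complex) \<Rightarrow> bool" where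
  "compact_op p m \<alpha> T \<longleftrightarrow>
     T ` fock_sobolev p m \<alpha> \<subseteq> fock_sobolev \<infinity> m \<alpha> \<and>
     compactin (fs_topology m \<alpha>) (fs_topology m \<alpha> closure_of (T ` unit_ball p m \<alpha>))"

definition berezin ::
  "nat \<Rightarrow> real \<Rightarrow> (complex ^ 'n \<Rightarrow> complex) \<Rightarrow> (complex ^ 'n \<Rightarrow> complex ^ 'n) \<Rightarrow> complex ^ 'n \<Rightarrow> real"
  where
  "berezin m \<alpha> u \<psi> z =
     norm z ^ m * norm (u z) / (1 + norm (\<psi> z)) ^ m *
     exp (\<alpha> / 2 * ((norm (\<psi> z))\<^sup>2 - (norm z)\<^sup>2))"

definition Linf_norm :: "(complex ^ 'n \<Rightarrow> real) \<Rightarrow> ennreal" where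
  "Linf_norm F = esssup lborel (\<lambda>z. ennreal \<bar>F z\<bar>)"

definition Linf :: "(complex ^ 'n \<Rightarrow> real) set" where
  "Linf = {F. F \<in> borel_measurable lborel \<and> Linf_norm F < \<infinity>}"

end

theory Submission
  imports Defs "HOL-Complex_Analysis.Complex_Analysis" "HOL-Probability.Distributions"
begin

text \<open>
  Write \<open>w = \<psi>(z)\<close>.  Everything rests on the identity
  \<open>|z|\<^sup>m |u(z) f(w)| e\<^bsup>-\<alpha>|z|\<^sup>2/2\<^esup> = B(z) \<cdot> (1 + |w|)\<^sup>m |f(w)| e\<^bsup>-\<alpha>|w|\<^sup>2/2\<^esup>\<close>,
  where \<open>B\<close> is the function \<^const>\<open>berezin\<close> (lemma \<open>wabs_wcomp\<close>).  It reduces the operator to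
  weighted point evaluations.  These are bounded uniformly in \<open>w\<close> by the norm of \<open>f\<close>
  (\<open>point_evaluation_bound\<close>), and they are bounded below: the kernel \<open>e\<^bsup>\<alpha>\<langle>z,w\<rangle>\<^esup>\<close>, scaled
  by \<open>e\<^bsup>-\<alpha>|w|\<^sup>2/2\<^esup> / (1 + |w|)\<^sup>m\<close>, has weighted value \<open>1\<close> at \<open>w\<close> and norm at most a constant
  independent of \<open>w\<close> (\<open>scaled_kernel_in_unit_ball\<close>).  So the norm of the operator is
  comparable to \<open>sup B\<close>, and \<open>sup B\<close> is the essential supremum because \<open>B\<close> is continuous.

  The point evaluation estimate for \<open>p < \<infinity>\<close> comes from the local inequality
  \<open>|F(0)|\<^sup>q \<le> c \<integral>\<^bsub>|v|<1\<^esub> |F|\<^sup>q\<close>, valid for every \<open>q > 0\<close> (\<open>powr_local_bound_at_0\<close>).  Maximise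
  \<open>|F(z)| (1 - |z|)\<^bsup>2n/q\<^esup>\<close> over the unit ball.  Around a maximum point \<open>F\<close> is bounded by a fixed
  multiple of its value there on a ball of radius comparable to the distance to the boundary;
  by Cauchy's estimate \<open>F\<close> varies little on a smaller ball of comparable radius, and that ball
  already contributes enough to the integral.  The weight \<open>e\<^bsup>-\<alpha>|z|\<^sup>2/2\<^esup>\<close> is moved to the origin by
  the substitution \<open>f(z) \<mapsto> f(z + w) e\<^bsup>-\<alpha>\<langle>z,w\<rangle>\<^esup>\<close>.

  The spaces are defined through derivatives, whereas the norms and the estimates above use the
  weight \<open>|z|\<^sup>m\<close>.  The bridge is \<open>fock_sobolev_infinity_iff_decay\<close>.  In one direction each
  derivative costs one factor \<open>1 + |z|\<close>: apply Cauchy's estimate on the ball of radius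
  \<open>1 / (1 + |z|)\<close>, on which the Gaussian weight is essentially constant (\<open>decay_partial\<close>).
  In the other direction each derivative that is controlled gains such a factor, by integration
  along rays (\<open>decay_of_partials\<close>).

  For compactness, the target space is complete, so an operator that maps into it is compact if
  and only if the image of the unit ball is totally bounded.  If \<open>B\<close> is small where \<open>|\<psi>|\<close>
  is large, images of two functions of the unit ball are close as soon as the functions are close
  on a fixed ball, and Montel's theorem applies there (\<open>mtotally_bounded_wcomp_unit_ball\<close>).
  Conversely, if \<open>B(z\<^sub>k) \<ge> \<epsilon>\<close> with \<open>|\<psi>(z\<^sub>k)| \<rightarrow> \<infinity>\<close>, the images of the kernels at \<open>\<psi>(z\<^sub>k)\<close> tend
  to \<open>0\<close> pointwise but not in norm, so no subsequence converges
  (\<open>berezin_vanishes_if_mtotally_bounded\<close>).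
\<close>

section \<open>Derivatives along complex lines and locally uniform limits\<close>

text \<open>
  The complex derivative along the line \<open>z + \<complex> h\<close>.  Taking it from the restriction to the line
  makes it available for a locally uniform limit of entire functions before that limit is known to
  be differentiable.
\<close>

definition dirderiv :: "(complex ^ 'n \<Rightarrow> complex) \<Rightarrow> complex ^ 'n \<Rightarrow> complex ^ 'n \<Rightarrow> complex" where
  "dirderiv f z h = deriv (\<lambda>t. f (z + t *s h)) 0"

lemma norm_vector_scalar_mult: "norm (c *s (h :: complex ^ 'n)) = norm c * norm h"
  by (simp add: norm_vec_def norm_mult L2_set_right_distrib)

lemma entire_imp_differentiable: "entire f \<Longrightarrow> f differentiable (at z)"
  unfolding entire_def differentiable_def by blast

lemma entire_continuous_on: "entire f \<Longrightarrow> continuous_on S f"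
  by (intro continuous_at_imp_continuous_on ballI differentiable_imp_continuous_within
      entire_imp_differentiable)

lemma has_derivative_scalar_line:
  "((\<lambda>t. z + t *s (h :: complex ^ 'n)) has_derivative (\<lambda>t. t *s h)) (at t within S)"
proof -
  have "linear (\<lambda>t::complex. t *s h)"
    by (rule linearI) (simp_all add: vec_eq_iff algebra_simps)
  then have "bounded_linear (\<lambda>t::complex. t *s h)"
    by (rule linear_conv_bounded_linear[THEN iffD1])
  then show ?thesis
    using has_derivative_add[OF has_derivative_const[of z] bounded_linear_imp_has_derivative] by simp
qed

lemma line_has_field_derivative:
  fixes f :: "complex ^ 'n \<Rightarrow> complex"
  assumes D: "(f has_derivative D) (at (z + t *s h))" "\<And>c h. D (c *s h) = c * D h"
  shows "((\<lambda>t. f (z + t *s h)) has_field_derivative D h) (at t)"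
proof -
  have "((\<lambda>t. f (z + t *s h)) has_derivative (\<lambda>s. D (s *s h))) (at t)"
    using has_derivative_compose[OF has_derivative_scalar_line D(1)] by simp
  moreover have "(\<lambda>s. D (s *s h)) = (*) (D h)"
    by (rule ext) (metis D(2) mult.commute)
  ultimately show ?thesis unfolding has_field_derivative_def by simp
qed

lemma complex_linear_derivative_eq_dirderiv:
  assumes "(f has_derivative D) (at z)" "\<And>c h. D (c *s h) = c * D h"
  shows "dirderiv f z = D"
proof
  fix h
  show "dirderiv f z h = D h"
    unfolding dirderiv_def using line_has_field_derivative[of f D z 0 h] assms
    by (intro DERIV_imp_deriv) simp
qed

lemma entire_has_derivative_dirderiv:
  assumes "entire f"
  shows "(f has_derivative dirderiv f z) (at z)" "dirderiv f z (c *s h) = c * dirderiv f z h"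
proof -
  obtain D where D: "(f has_derivative D) (at z)" "\<And>c h. D (c *s h) = c * D h"
    using assms unfolding entire_def by blast
  with complex_linear_derivative_eq_dirderiv[OF D]
  show "(f has_derivative dirderiv f z) (at z)" "dirderiv f z (c *s h) = c * dirderiv f z h" by simp_all
qed

lemma entire_line_derivative:
  assumes "entire f"
  shows "((\<lambda>t. f (z + t *s h)) has_field_derivative dirderiv f (z + t *s h) h) (at t)"
  using line_has_field_derivative[of f "dirderiv f (z + t *s h)" z t h] entire_has_derivative_dirderiv[OF assms]
  by blast

lemma entire_holomorphic_on_line: "entire f \<Longrightarrow> (\<lambda>t. f (z + t *s h)) holomorphic_on S"
  unfolding holomorphic_on_def field_differentiable_def
  by (blast intro: has_field_derivative_at_within[OF entire_line_derivative])

lemma partial_eq_dirderiv: "partial j f z = dirderiv f z (axis j 1)"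
proof -
  have "t *s axis j (1::complex) = axis j t" for t
    by (simp add: vec_eq_iff axis_def)
  then show ?thesis by (simp add: partial_def dirderiv_def)
qed

lemma dirderiv_scale:
  assumes "(\<lambda>t. f (z + t *s h)) field_differentiable at 0"
  shows "dirderiv f z (c *s h) = c * dirderiv f z h"
proof -
  let ?g = "\<lambda>t. f (z + t *s h)"
  have "(?g has_field_derivative dirderiv f z h) (at (c * 0))"
    using assms unfolding dirderiv_def mult_zero_right
    by (simp only: DERIV_deriv_iff_field_differentiable)
  then have "((\<lambda>t. ?g (c * t)) has_field_derivative dirderiv f z h * c) (at 0)"
    by (rule DERIV_chain2[of ?g _ "\<lambda>t. c * t" 0 c UNIV, OF _ DERIV_cmult_Id])
  moreover have "(\<lambda>t. ?g (c * t)) = (\<lambda>t. f (z + t *s (c *s h)))"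
    by (rule ext) (simp only: vector_smult_assoc mult.commute[of c])
  ultimately have "((\<lambda>t. f (z + t *s (c *s h))) has_field_derivative dirderiv f z h * c) (at 0)"
    by (rule back_subst)
  then have "deriv (\<lambda>t. f (z + t *s (c *s h))) 0 = dirderiv f z h * c"
    by (rule DERIV_imp_deriv)
  then show ?thesis by (metis dirderiv_def mult.commute)
qed

text \<open>
  Cauchy's inequality on the complex line through \<open>z\<close>.  Holomorphy is required on that line only,
  because the lemma is applied to differences \<open>F\<^sub>k - f\<close> whose second term is not yet known to be
  entire.
\<close>

lemma dirderiv_bound:
  assumes hol: "\<And>S. (\<lambda>t. f (z + t *s h)) holomorphic_on S" and "r > 0"
    and M: "\<And>w. dist z w \<le> r \<Longrightarrow> norm (f w) \<le> M"
  shows "norm (dirderiv f z h) \<le> M / r * norm h"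
proof (cases "h = 0")
  case True
  then show ?thesis by (simp add: dirderiv_def)
next
  case False
  let ?g = "\<lambda>t. f (z + t *s h)"
  have "norm ((deriv ^^ 1) ?g 0) \<le> fact 1 * M / (r / norm h) ^ 1"
  proof (rule Cauchy_inequality)
    show "norm (?g t) \<le> M" if "norm (0 - t) = r / norm h" for t
      using that False by (intro M) (simp add: dist_norm norm_vector_scalar_mult)
  qed (use False \<open>r > 0\<close> hol in \<open>auto intro: holomorphic_on_imp_continuous_on\<close>)
  then show ?thesis by (simp add: dirderiv_def divide_simps split: if_splits)
qed

text \<open>
  Cauchy's inequality on unit balls bounds the derivative by the supremum on a slightly larger
  ball; this is the equicontinuity behind Montel's theorem.
\<close>

lemma entire_Lipschitz:
  assumes "entire f" and M: "\<And>w. norm w \<le> R + 1 \<Longrightarrow> norm (f w) \<le> M"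
    and "norm x \<le> R" "norm y \<le> R"
  shows "norm (f x - f y) \<le> M * norm (x - y)"
proof (rule differentiable_bound[where S = "cball 0 R" and f' = "dirderiv f"])
  show "(f has_derivative dirderiv f z) (at z within cball 0 R)" for z
    by (rule has_derivative_at_withinI[OF entire_has_derivative_dirderiv(1)[OF assms(1)]])
  show "onorm (dirderiv f z) \<le> M" if "z \<in> cball 0 R" for z
  proof (rule onorm_le)
    fix h
    have "norm (dirderiv f z h) \<le> M / 1 * norm h"
    proof (rule dirderiv_bound)
      fix w assume "dist z w \<le> 1"
      then show "norm (f w) \<le> M"
        using that norm_triangle_sub[of w z] by (intro M) (auto simp: dist_norm norm_minus_commute)
    qed (auto intro: entire_holomorphic_on_line assms)
    then show "norm (dirderiv f z h) \<le> M * norm h" by simp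
  qed
qed (use assms in auto)

text \<open>
  Weierstrass' theorem.  On every complex line the limit is holomorphic by the one-variable theorem,
  and Cauchy's inequality applied to \<open>F\<^sub>k - f\<close> shows that the total derivatives of the \<open>F\<^sub>k\<close>
  converge locally uniformly to the directional derivatives of \<open>f\<close>.
\<close>

lemma entire_uniform_limit:
  assumes F: "\<And>k. entire (F k)"
    and lim: "\<And>R. uniform_limit (cball 0 R) F f sequentially"
  shows "(f has_derivative dirderiv f z) (at z)" "entire f" "(\<lambda>k. dirderiv (F k) z h) \<longlonglongrightarrow> dirderiv f z h"
proof -
  have hol: "(\<lambda>t. f (z + t *s h)) holomorphic_on S" for z h S
  proof (rule holomorphic_on_subset[OF holomorphic_uniform_sequence[of UNIV "\<lambda>k t. F k (z + t *s h)"]])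
    fix t :: complex
    have "uniform_limit (cball t 1) (\<lambda>k t. F k (z + t *s h)) (\<lambda>t. f (z + t *s h)) sequentially"
    proof (rule uniform_limit_compose'[OF lim[of "norm z + (norm t + 1) * norm h"]])
      show "(\<lambda>t. z + t *s h) \<in> cball t 1 \<rightarrow> cball 0 (norm z + (norm t + 1) * norm h)"
      proof
        fix s assume "s \<in> cball t 1"
        then have "norm s \<le> norm t + 1"
          using norm_triangle_sub[of s t] by (auto simp: dist_norm norm_minus_commute)
        then have "norm (s *s h) \<le> (norm t + 1) * norm h"
          by (simp add: norm_vector_scalar_mult mult_right_mono)
        then show "z + s *s h \<in> cball 0 (norm z + (norm t + 1) * norm h)"
          using norm_triangle_ineq[of z "s *s h"] by simp
      qed
    qed
    then show "\<exists>d>0. cball t d \<subseteq> UNIV \<and>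
        uniform_limit (cball t d) (\<lambda>k t. F k (z + t *s h)) (\<lambda>t. f (z + t *s h)) sequentially"
      by (intro exI[of _ 1]) auto
  qed (auto intro: entire_holomorphic_on_line F)
  have dirderiv_diff: "dirderiv (\<lambda>w. F k w - f w) z h = dirderiv (F k) z h - dirderiv f z h" for k z h
    unfolding dirderiv_def
    by (rule deriv_diff)
       (use hol[of z h UNIV] entire_holomorphic_on_line[OF F, of k z h UNIV] in
         \<open>auto simp: holomorphic_on_def\<close>)
  have dirderiv_lim: "\<forall>\<^sub>F k in sequentially. \<forall>z\<in>ball 0 R. \<forall>h. norm (dirderiv (F k) z h - dirderiv f z h) \<le> e * norm h"
    if "e > 0" for e R :: real
    using uniform_limitD[OF lim[of "R + 1"] \<open>e > 0\<close>]
  proof eventually_elim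
    case (elim k)
    show ?case
    proof (intro ballI allI)
      fix z h :: "complex ^ 'a" assume z: "z \<in> ball 0 R"
      have "norm (dirderiv (\<lambda>w. F k w - f w) z h) \<le> e / 1 * norm h"
      proof (rule dirderiv_bound)
        show "(\<lambda>t. F k (z + t *s h) - f (z + t *s h)) holomorphic_on S" for S
          by (intro holomorphic_intros hol entire_holomorphic_on_line F)
        fix w assume "dist z w \<le> 1"
        then have "w \<in> cball 0 (R + 1)"
          using z norm_triangle_sub[of w z] by (auto simp: dist_norm norm_minus_commute)
        with elim show "norm (F k w - f w) \<le> e"
          by (auto simp: dist_norm intro: less_imp_le)
      qed auto
      then show "norm (dirderiv (F k) z h - dirderiv f z h) \<le> e * norm h"
        by (simp add: dirderiv_diff)
    qed
  qed
  show der: "(f has_derivative dirderiv f z) (at z)" for z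
  proof -
    have pt: "(\<lambda>k. F k w) \<longlonglongrightarrow> f w" for w
      by (rule tendsto_uniform_limitI[OF lim[of "norm w"]]) simp
    have "\<exists>g. \<forall>x\<in>ball 0 (norm z + 1). (\<lambda>n. F n x) \<longlonglongrightarrow> g x \<and>
            (g has_derivative dirderiv f x) (at x within ball 0 (norm z + 1))"
    proof (rule has_derivative_sequence)
      show "(F n has_derivative dirderiv (F n) x) (at x within ball 0 (norm z + 1))" for n x
        by (rule has_derivative_at_withinI[OF entire_has_derivative_dirderiv(1)[OF F]])
      show "z \<in> ball 0 (norm z + 1)" by simp
      show "(\<lambda>n. F n z) \<longlonglongrightarrow> f z" by (rule pt)
    qed (use dirderiv_lim in auto)
    then obtain g where g: "\<And>x. x \<in> ball 0 (norm z + 1) \<Longrightarrow> (\<lambda>n. F n x) \<longlonglongrightarrow> g x"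
        "\<And>x. x \<in> ball 0 (norm z + 1) \<Longrightarrow> (g has_derivative dirderiv f x) (at x within ball 0 (norm z + 1))"
      by blast
    have eq: "g x = f x" if "x \<in> ball 0 (norm z + 1)" for x
      using LIMSEQ_unique[OF g(1)[OF that] pt] .
    have "(g has_derivative dirderiv f z) (at z)"
      using g(2)[of z] at_within_open[of z "ball 0 (norm z + 1)"] by simp
    then show ?thesis
      by (rule has_derivative_transform_within_open[where s = "ball 0 (norm z + 1)"]) (auto simp: eq)
  qed
  have "dirderiv f z (c *s h) = c * dirderiv f z h" for z c h
    by (rule dirderiv_scale) (use hol[of z h UNIV] in \<open>auto simp: holomorphic_on_def\<close>)
  with der show "entire f" unfolding entire_def by blast
  show "(\<lambda>k. dirderiv (F k) z h) \<longlonglongrightarrow> dirderiv f z h"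
  proof (rule LIMSEQ_I)
    fix e :: real assume "e > 0"
    define e' where "e' = e / 2 / (norm h + 1)"
    have nh: "norm h + 1 > 0" using norm_ge_zero[of h] by linarith
    have "e' > 0" using \<open>e > 0\<close> nh by (simp add: e'_def)
    have "e' * norm h < e"
    proof -
      have "e' * norm h \<le> e' * (norm h + 1)" using \<open>e' > 0\<close> by simp
      also have "\<dots> = e / 2" using nh by (simp add: e'_def field_simps)
      finally show ?thesis using \<open>e > 0\<close> by simp
    qed
    moreover have "\<forall>\<^sub>F k in sequentially. norm (dirderiv (F k) z h - dirderiv f z h) \<le> e' * norm h"
      using dirderiv_lim[OF \<open>e' > 0\<close>, of "norm z + 1"] by eventually_elim auto
    ultimately have "\<forall>\<^sub>F k in sequentially. norm (dirderiv (F k) z h - dirderiv f z h) < e"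
      by (auto elim: eventually_mono)
    then show "\<exists>no. \<forall>n\<ge>no. norm (dirderiv (F n) z h - dirderiv f z h) < e"
      unfolding eventually_sequentially .
  qed
qed

section \<open>Entire functions of several variables: closure properties and partial derivatives\<close>

lemma entire_diff:
  assumes "entire f" "entire g" shows "entire (\<lambda>z. f z - g z)"
  unfolding entire_def
proof (intro allI exI conjI)
  fix z c h
  show "((\<lambda>z. f z - g z) has_derivative (\<lambda>h. dirderiv f z h - dirderiv g z h)) (at z)"
    by (intro has_derivative_diff entire_has_derivative_dirderiv assms)
  show "dirderiv f z (c *s h) - dirderiv g z (c *s h) = c * (dirderiv f z h - dirderiv g z h)"
    by (simp add: entire_has_derivative_dirderiv(2) assms right_diff_distrib)
qed

lemma entire_mult:
  assumes "entire f" "entire g" shows "entire (\<lambda>z. f z * g z)"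
  unfolding entire_def
proof (intro allI exI conjI)
  fix z c h
  show "((\<lambda>z. f z * g z) has_derivative (\<lambda>h. f z * dirderiv g z h + dirderiv f z h * g z)) (at z)"
    by (intro has_derivative_mult entire_has_derivative_dirderiv assms)
  show "f z * dirderiv g z (c *s h) + dirderiv f z (c *s h) * g z = c * (f z * dirderiv g z h + dirderiv f z h * g z)"
    by (simp add: entire_has_derivative_dirderiv(2) assms algebra_simps)
qed

lemma entire_const: "entire (\<lambda>z. c)"
  unfolding entire_def by (intro allI exI[of _ "\<lambda>h. 0"]) auto

lemma entire_cmult: "entire f \<Longrightarrow> entire (\<lambda>z. c * f z)"
  by (intro entire_mult entire_const)

lemma entire_translate:
  assumes "entire f" shows "entire (\<lambda>z. f (z + a))"
  unfolding entire_def
proof (intro allI exI conjI)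
  fix z c h
  have "((\<lambda>z. z + a) has_derivative (\<lambda>h. h)) (at z)"
    by (auto intro!: derivative_eq_intros)
  from has_derivative_compose[OF this entire_has_derivative_dirderiv(1)[OF assms]]
  show "((\<lambda>z. f (z + a)) has_derivative dirderiv f (z + a)) (at z)" .
qed (simp add: entire_has_derivative_dirderiv(2) assms)

lemma entire_compose:
  fixes f :: "complex ^ 'k \<Rightarrow> complex" and \<psi> :: "complex ^ 'n \<Rightarrow> complex ^ 'k"
  assumes "entire f" "entire_map \<psi>" shows "entire (\<lambda>z. f (\<psi> z))"
  unfolding entire_def
proof (intro allI exI conjI)
  fix z h :: "complex ^ 'n" and c
  let ?D = "\<lambda>h. \<Sum>j\<in>UNIV. axis j (dirderiv (\<lambda>z. \<psi> z $ j) z h)"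
  have psi: "entire (\<lambda>z. \<psi> z $ j)" for j
    using assms(2) by (simp add: entire_map_def)
  have ax: "bounded_linear (axis j :: complex \<Rightarrow> complex ^ 'k)" for j
    by (intro linear_conv_bounded_linear[THEN iffD1] linearI) (simp_all add: vec_eq_iff axis_def)
  have "((\<lambda>z. \<Sum>j\<in>UNIV. axis j (\<psi> z $ j)) has_derivative ?D) (at z)"
    by (intro has_derivative_sum bounded_linear.has_derivative[OF ax] entire_has_derivative_dirderiv psi)
  moreover have "(\<lambda>z. \<Sum>j\<in>UNIV. axis j (\<psi> z $ j)) = \<psi>"
    by (simp add: fun_eq_iff vec_eq_iff axis_def)
  ultimately have "(\<psi> has_derivative ?D) (at z)" by simp
  from has_derivative_compose[OF this entire_has_derivative_dirderiv(1)[OF assms(1)]]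
  show "((\<lambda>z. f (\<psi> z)) has_derivative (\<lambda>h. dirderiv f (\<psi> z) (?D h))) (at z)" .
  have "?D (c *s h) = c *s ?D h"
    by (simp add: vec_eq_iff entire_has_derivative_dirderiv(2)[OF psi] axis_def)
  then show "dirderiv f (\<psi> z) (?D (c *s h)) = c * dirderiv f (\<psi> z) (?D h)"
    by (simp add: entire_has_derivative_dirderiv(2) assms)
qed

lemma entire_wcomp: "entire u \<Longrightarrow> entire_map \<psi> \<Longrightarrow> entire f \<Longrightarrow> entire (wcomp u \<psi> f)"
  unfolding wcomp_def by (blast intro: entire_mult[OF _ entire_compose])

lemma entire_map_continuous_on:
  assumes "entire_map \<psi>" shows "continuous_on S \<psi>"
proof -
  have "continuous_on S (\<lambda>z. \<chi> j. \<psi> z $ j)"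
    by (intro continuous_on_vec_lambda entire_continuous_on) (use assms in \<open>auto simp: entire_map_def\<close>)
  then show ?thesis by simp
qed

lemma entire_bounded_cball:
  assumes "entire f"
  obtains M where "M \<ge> 0" "\<And>w. norm w \<le> R \<Longrightarrow> norm (f w) \<le> M"
proof -
  have "bounded (f ` cball 0 R)"
    by (intro compact_imp_bounded compact_continuous_image entire_continuous_on assms compact_cball)
  then obtain M where "M > 0" "\<And>w. w \<in> cball 0 R \<Longrightarrow> norm (f w) \<le> M"
    unfolding bounded_pos by auto
  with that[of M] show ?thesis by auto
qed

text \<open>
  Taylor's formula of first order, with the second derivative bounded by Cauchy's inequality.  It
  gives the rate \<open>O(1/k)\<close> with which the difference quotients below converge.
\<close>

lemma holomorphic_quadratic_remainder:
  assumes hol: "g holomorphic_on UNIV" and M: "\<And>t. norm t \<le> 2 \<Longrightarrow> norm (g t) \<le> M" and "norm s \<le> 1"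
  shows "norm (g s - g 0 - deriv g 0 * s) \<le> 2 * M * norm s ^ 2"
proof -
  have "norm ((deriv ^^ 0) g s - (\<Sum>i\<le>1. (deriv ^^ i) g 0 * (s - 0) ^ i / fact i))
      \<le> (2 * M) * norm (s - 0) ^ Suc 1 / fact 1"
  proof (rule complex_Taylor[where S = "cball 0 1" and f = "\<lambda>i. (deriv ^^ i) g"])
    fix i :: nat and x :: complex
    have "(deriv ^^ i) g holomorphic_on UNIV"
      by (rule holomorphic_higher_deriv[OF hol]) auto
    then show "((deriv ^^ i) g has_field_derivative (deriv ^^ Suc i) g x) (at x within cball 0 1)"
      using holomorphic_derivI[of _ UNIV x] by (auto intro: has_field_derivative_at_within)
  next
    fix x :: complex assume x: "x \<in> cball 0 1"
    have "norm ((deriv ^^ 2) g x) \<le> fact 2 * M / 1 ^ 2"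
    proof (rule Cauchy_inequality)
      fix t assume "norm (x - t) = 1"
      then show "norm (g t) \<le> M"
        using x norm_triangle_sub[of t x] by (intro M) (auto simp: norm_minus_commute)
    qed (use hol in \<open>auto intro: holomorphic_on_subset holomorphic_on_imp_continuous_on\<close>)
    then show "norm ((deriv ^^ Suc 1) g x) \<le> 2 * M"
      by (simp add: numeral_2_eq_2)
  qed (use assms in auto)
  then show ?thesis by (simp add: algebra_simps power2_eq_square)
qed

text \<open>
  The difference quotient with increment \<open>1/(k+1)\<close> in the \<open>j\<close>-th variable.  It exhibits
  \<open>partial j f\<close> as a locally uniform limit of entire functions, which makes \<open>partial j f\<close> entire and
  shows that partial derivatives commute.
\<close>

definition diffquot :: "'n \<Rightarrow> nat \<Rightarrow> (complex ^ 'n \<Rightarrow> complex) \<Rightarrow> complex ^ 'n \<Rightarrow> complex" where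
  "diffquot j k f z = of_nat (Suc k) * (f (z + axis j (1 / of_nat (Suc k))) - f z)"

lemma entire_diffquot: "entire f \<Longrightarrow> entire (diffquot j k f)"
  unfolding diffquot_def by (intro entire_cmult entire_diff entire_translate)

lemma diffquot_uniform_limit:
  assumes "entire f"
  shows "uniform_limit (cball 0 R) (\<lambda>k. diffquot j k f) (partial j f) sequentially"
proof -
  obtain M where M: "M \<ge> 0" "\<And>w. norm w \<le> R + 2 \<Longrightarrow> norm (f w) \<le> M"
    using entire_bounded_cball[OF assms] by blast
  have bound: "norm (diffquot j k f z - partial j f z) \<le> 2 * M / real (Suc k)"
    if z: "norm z \<le> R" for k z
  proof -
    let ?g = "\<lambda>t. f (z + t *s axis j 1)" and ?s = "1 / of_nat (Suc k) :: complex"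
    have "norm (?g ?s - ?g 0 - deriv ?g 0 * ?s) \<le> 2 * M * norm ?s ^ 2"
    proof (rule holomorphic_quadratic_remainder)
      fix t :: complex assume "norm t \<le> 2"
      then have "norm (z + t *s axis j 1) \<le> R + 2"
        using z norm_triangle_ineq[of z "t *s axis j 1"] by (simp add: norm_vector_scalar_mult)
      then show "norm (?g t) \<le> M" by (rule M)
    next
      show "norm ?s \<le> 1"
        by (simp only: norm_divide norm_one norm_of_nat) (simp add: divide_simps)
    qed (intro entire_holomorphic_on_line assms)
    moreover have "deriv ?g 0 = partial j f z"
      by (simp add: partial_eq_dirderiv dirderiv_def)
    moreover have "?s *s axis j (1::complex) = axis j ?s"
      by (simp add: vec_eq_iff axis_def)
    ultimately have *: "norm (f (z + axis j ?s) - f z - partial j f z * ?s) \<le> 2 * M * norm ?s ^ 2"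
      by simp
    have "diffquot j k f z - partial j f z
        = of_nat (Suc k) * (f (z + axis j ?s) - f z - partial j f z * ?s)"
      unfolding diffquot_def by (simp add: field_simps del: of_nat_Suc)
    then have "norm (diffquot j k f z - partial j f z)
        = real (Suc k) * norm (f (z + axis j ?s) - f z - partial j f z * ?s)"
      by (simp only: norm_mult norm_of_nat)
    also have "\<dots> \<le> real (Suc k) * (2 * M * norm ?s ^ 2)"
      using * by (intro mult_left_mono) auto
    also have "norm ?s = 1 / real (Suc k)"
      by (simp only: norm_divide norm_one norm_of_nat)
    also have "real (Suc k) * (2 * M * (1 / real (Suc k)) ^ 2) = 2 * M / real (Suc k)"
      by (simp add: power2_eq_square field_simps del: of_nat_Suc)
    finally show ?thesis .
  qed
  have "(\<lambda>k. 2 * M / real (Suc k)) \<longlonglongrightarrow> 0"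
    using LIMSEQ_Suc[OF lim_const_over_n[of "2 * M"]] .
  then have small: "\<forall>\<^sub>F k in sequentially. 2 * M / real (Suc k) < e" if "e > 0" for e
    using that by (rule order_tendstoD(2))
  have "\<forall>\<^sub>F k in sequentially. \<forall>x\<in>cball 0 R. dist (diffquot j k f x) (partial j f x) < e"
    if "e > 0" for e
    using small[OF that] by (rule eventually_mono) (auto simp: dist_norm intro: le_less_trans[OF bound])
  then show ?thesis unfolding uniform_limit_iff by blast
qed

lemma entire_partial:
  assumes "entire f" shows "entire (partial j f)"
  using entire_uniform_limit(2)[OF entire_diffquot[OF assms] diffquot_uniform_limit[OF assms]] .

lemma dirderiv_translate: "dirderiv (\<lambda>z. f (z + a)) z h = dirderiv f (z + a) h"
  by (simp add: dirderiv_def ac_simps)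

text \<open>
  A partial derivative commutes with difference quotients, which are combinations of translates, and
  by Weierstrass' theorem with their locally uniform limit.
\<close>

lemma partial_commute:
  assumes "entire f" shows "partial i (partial j f) = partial j (partial i f)"
proof
  fix z
  have "(\<lambda>k. dirderiv (diffquot j k f) z (axis i 1)) \<longlonglongrightarrow> dirderiv (partial j f) z (axis i 1)"
    by (rule entire_uniform_limit(3)[OF entire_diffquot[OF assms] diffquot_uniform_limit[OF assms]])
  moreover have "dirderiv (diffquot j k f) z (axis i 1) = diffquot j k (partial i f) z" for k
  proof -
    let ?a = "axis j (1 / of_nat (Suc k))" and ?c = "of_nat (Suc k) :: complex"
    have *: "((\<lambda>z. ?c * (f (z + ?a) - f z)) has_derivative
        (\<lambda>h. ?c * (dirderiv (\<lambda>z. f (z + ?a)) z h - dirderiv f z h))) (at z)"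
      by (intro has_derivative_mult_right has_derivative_diff entire_has_derivative_dirderiv
          entire_translate assms)
    have "dirderiv (\<lambda>z. ?c * (f (z + ?a) - f z)) z =
        (\<lambda>h. ?c * (dirderiv (\<lambda>z. f (z + ?a)) z h - dirderiv f z h))"
      by (rule complex_linear_derivative_eq_dirderiv[OF *])
        (simp add: entire_has_derivative_dirderiv(2) entire_translate assms algebra_simps)
    then show ?thesis
      unfolding diffquot_def[abs_def] partial_eq_dirderiv dirderiv_translate by simp
  qed
  moreover have "(\<lambda>k. diffquot j k (partial i f) z) \<longlonglongrightarrow> partial j (partial i f) z"
    by (rule tendsto_uniform_limitI[OF diffquot_uniform_limit[OF entire_partial[OF assms]]])
      (rule mem_cball_0[THEN iffD2], rule order_refl)
  ultimately show "partial i (partial j f) z = partial j (partial i f) z"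
    using LIMSEQ_unique by (simp add: partial_eq_dirderiv)
qed

lemma entire_partial_funpow: "entire f \<Longrightarrow> entire ((partial j ^^ k) f)"
  by (induction k) (auto intro: entire_partial)

lemma entire_foldr_partial: "entire f \<Longrightarrow> entire (foldr (\<lambda>j. partial j ^^ \<beta> j) js f)"
  by (induction js) (auto intro: entire_partial_funpow)

lemma entire_mpartial: "entire f \<Longrightarrow> entire (mpartial \<beta> f)"
  unfolding mpartial_def by (rule entire_foldr_partial)

lemma partial_funpow_commute:
  "entire f \<Longrightarrow> partial i ((partial j ^^ k) f) = (partial j ^^ k) (partial i f)"
proof (induction k)
  case (Suc k)
  then show ?case using partial_commute[OF entire_partial_funpow[of f k j], of i j] by simp
qed simp

text \<open>
  Commutation lets one more derivative be inserted at its place in the fixed enumeration of the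
  coordinates.
\<close>

lemma mpartial_Suc:
  assumes "entire f"
  shows "mpartial (\<beta>(j := Suc (\<beta> j))) f = partial j (mpartial \<beta> f)"
proof -
  let ?\<beta> = "\<beta>(j := Suc (\<beta> j))"
  have notin: "foldr (\<lambda>j. partial j ^^ ?\<beta> j) js f = foldr (\<lambda>j. partial j ^^ \<beta> j) js f"
    if "j \<notin> set js" for js
    using that by (induction js) auto
  have main: "foldr (\<lambda>j. partial j ^^ ?\<beta> j) js f = partial j (foldr (\<lambda>j. partial j ^^ \<beta> j) js f)"
    if "distinct js" "j \<in> set js" for js
    using that
  proof (induction js)
    case (Cons i js)
    show ?case
    proof (cases "i = j")
      case True
      with Cons.prems notin[of js] show ?thesis by simp
    next
      case False
      with Cons show ?thesis
        by (simp add: partial_funpow_commute[OF entire_foldr_partial[OF assms]])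
    qed
  qed simp
  show ?thesis unfolding mpartial_def by (rule main) (simp_all add: coords)
qed

section \<open>Growth of an entire function and of its derivatives\<close>

text \<open>
  The pointwise form of membership in the Fock--Sobolev space with exponent \<open>\<infinity>\<close> and order \<open>k\<close>.  The
  weight \<open>1 + |z|\<close> is bounded away from \<open>0\<close>, so the condition also controls the function near the
  origin and gets weaker as \<open>k\<close> decreases.
\<close>

definition decay :: "real \<Rightarrow> nat \<Rightarrow> (complex ^ 'n \<Rightarrow> complex) \<Rightarrow> bool" where
  "decay \<alpha> k g \<longleftrightarrow>
     entire g \<and> (\<exists>C. \<forall>z. (1 + norm z) ^ k * norm (g z) \<le> C * exp (\<alpha> / 2 * (norm z)\<^sup>2))"

lemma decayE:
  assumes "decay \<alpha> k g"
  obtains C where "C > 0" "\<And>z. (1 + norm z) ^ k * norm (g z) \<le> C * exp (\<alpha> / 2 * (norm z)\<^sup>2)"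
proof -
  obtain C where C: "\<And>z. (1 + norm z) ^ k * norm (g z) \<le> C * exp (\<alpha> / 2 * (norm z)\<^sup>2)"
    using assms unfolding decay_def by blast
  have "(1 + norm z) ^ k * norm (g z) \<le> max C 1 * exp (\<alpha> / 2 * (norm z)\<^sup>2)" for z
    by (rule order_trans[OF C]) (intro mult_right_mono; simp)
  then show ?thesis by (intro that[of "max C 1"]) auto
qed

text \<open>
  Cauchy's estimate with radius \<open>r = 1 / (1 + |z|)\<close>.  On the ball of radius \<open>r\<close> around \<open>z\<close> both
  \<open>1 + |w|\<close> and \<open>exp (\<alpha>/2 |w|\<^sup>2)\<close> are comparable to their values at \<open>z\<close>, since
  \<open>(|z| + r)\<^sup>2 \<le> |z|\<^sup>2 + 3\<close>; the division by \<open>r\<close> costs one power of the weight.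
\<close>

lemma decay_partial:
  assumes "decay \<alpha> (Suc k) g" "\<alpha> > 0"
  shows "decay \<alpha> k (partial j g)"
proof -
  have g: "entire g" using assms by (simp add: decay_def)
  obtain C where "C > 0"
    and C: "\<And>z. (1 + norm z) ^ Suc k * norm (g z) \<le> C * exp (\<alpha> / 2 * (norm z)\<^sup>2)"
    using decayE[OF assms(1)] by blast
  define K where "K = C * 2 ^ Suc k * exp (\<alpha> / 2 * 3)"
  have "(1 + norm z) ^ k * norm (partial j g z) \<le> K * exp (\<alpha> / 2 * (norm z)\<^sup>2)" for z
  proof -
    define x where "x = norm z"
    have x: "x \<ge> 0" by (simp add: x_def)
    let ?r = "1 / (1 + x)"
    let ?M = "K * exp (\<alpha> / 2 * x\<^sup>2) / (1 + x) ^ Suc k"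
    have r: "?r \<le> 1" "?r > 0" "x * ?r \<le> 1" using x by (auto simp: divide_simps)
    have "norm (dirderiv g z (axis j 1)) \<le> ?M / ?r * norm (axis j (1 :: complex))"
    proof (rule dirderiv_bound)
      fix w assume w: "dist z w \<le> ?r"
      have w1: "norm w \<le> x + ?r" "x \<le> norm w + 1"
        using w norm_triangle_sub[of w z] norm_triangle_sub[of z w] r(1)
        unfolding dist_norm norm_minus_commute[of z w] x_def by linarith+
      have "(norm w)\<^sup>2 \<le> (x + ?r)\<^sup>2" using w1(1) by (intro power_mono) auto
      also have "\<dots> = x\<^sup>2 + 2 * (x * ?r) + ?r * ?r" by (simp add: power2_eq_square algebra_simps)
      also have "\<dots> \<le> x\<^sup>2 + 2 * 1 + 1 * 1"
        using r by (intro add_mono mult_mono) auto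
      finally have w2: "(norm w)\<^sup>2 \<le> x\<^sup>2 + 3" by simp
      have w3: "1 + x \<le> 2 * (1 + norm w)" using w1(2) norm_ge_zero[of w] by argo
      have "(1 + x) ^ Suc k * norm (g w) \<le> (2 * (1 + norm w)) ^ Suc k * norm (g w)"
        using w3 x by (intro mult_right_mono power_mono) auto
      also have "\<dots> = 2 ^ Suc k * ((1 + norm w) ^ Suc k * norm (g w))"
        by (simp only: power_mult_distrib mult_ac)
      also have "\<dots> \<le> 2 ^ Suc k * (C * exp (\<alpha> / 2 * (norm w)\<^sup>2))"
        by (intro mult_left_mono C) auto
      also have "\<dots> \<le> 2 ^ Suc k * (C * exp (\<alpha> / 2 * (x\<^sup>2 + 3)))"
        using w2 \<open>C > 0\<close> assms(2) by (intro mult_left_mono) auto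
      also have "\<dots> = K * exp (\<alpha> / 2 * x\<^sup>2)"
        by (simp add: K_def distrib_left exp_add)
      finally show "norm (g w) \<le> ?M"
        using x by (simp add: pos_le_divide_eq mult.commute del: power_Suc)
    qed (use r in \<open>auto intro: entire_holomorphic_on_line[OF g]\<close>)
    then have "norm (partial j g z) \<le> ?M * (1 + x)"
      by (simp add: partial_eq_dirderiv)
    then have "(1 + x) ^ k * norm (partial j g z) \<le> (1 + x) ^ k * (?M * (1 + x))"
      using x by (intro mult_left_mono) auto
    also have "\<dots> = K * exp (\<alpha> / 2 * x\<^sup>2)"
      using x by (simp add: divide_simps)
    finally show ?thesis by (simp add: x_def)
  qed
  then show ?thesis unfolding decay_def using entire_partial[OF g] by blast
qed

lemma dirderiv_eq_sum_partial:
  assumes "entire g" shows "dirderiv g z h = (\<Sum>j\<in>UNIV. h $ j * partial j g z)"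
proof -
  have lin: "linear (dirderiv g z)"
    using entire_has_derivative_dirderiv(1)[OF assms] has_derivative_linear by blast
  have "h = (\<Sum>j\<in>UNIV. h $ j *s axis j 1)"
    by (simp add: vec_eq_iff axis_def if_distrib cong: if_cong)
  then have "dirderiv g z h = dirderiv g z (\<Sum>j\<in>UNIV. h $ j *s axis j 1)" by simp
  also have "\<dots> = (\<Sum>j\<in>UNIV. dirderiv g z (h $ j *s axis j 1))"
    by (rule linear_sum[OF lin])
  finally show ?thesis
    by (simp add: entire_has_derivative_dirderiv(2)[OF assms] partial_eq_dirderiv)
qed

text \<open>
  Integrate the gradient along a ray.  With \<open>\<omega>(s) = exp (\<alpha>/2 s\<^sup>2) / (1 + s)\<^bsup>k+1\<^esup>\<close>, the derivative
  \<open>\<omega>'\<close> is, for large \<open>s\<close>, at least a multiple of \<open>exp (\<alpha>/2 s\<^sup>2) / (1 + s)\<^sup>k\<close>: the factor \<open>\<alpha> s\<close>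
  produced by the exponential is the gained power of \<open>1 + s\<close>.  So a multiple of \<open>\<omega>\<close> dominates the
  growth of \<open>g\<close> along every ray.
\<close>

lemma decay_of_partials:
  assumes g: "entire g" and part: "\<And>j. decay \<alpha> k (partial j g)" and "\<alpha> > 0"
  shows "decay \<alpha> (Suc k) g"
proof -
  have "\<exists>C>0. \<forall>z. (1 + norm z) ^ k * norm (partial j g z) \<le> C * exp (\<alpha> / 2 * (norm z)\<^sup>2)" for j
    by (rule decayE[OF part[of j]]) blast
  then obtain c where c: "\<And>j. c j > 0"
      "\<And>j z. (1 + norm z) ^ k * norm (partial j g z) \<le> c j * exp (\<alpha> / 2 * (norm z)\<^sup>2)"
    by metis
  define C where "C = (\<Sum>j\<in>UNIV. c j)"
  have "C > 0" unfolding C_def by (intro sum_pos c) auto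
  have dirderiv: "(1 + norm z) ^ k * norm (dirderiv g z h) \<le> C * exp (\<alpha> / 2 * (norm z)\<^sup>2)"
    if "norm h \<le> 1" for z h
  proof -
    have "norm (dirderiv g z h) \<le> (\<Sum>j\<in>UNIV. norm (h $ j * partial j g z))"
      unfolding dirderiv_eq_sum_partial[OF g] by (rule norm_sum)
    also have "\<dots> \<le> (\<Sum>j\<in>UNIV. norm (partial j g z))"
    proof (rule sum_mono)
      fix j
      have "norm (h $ j) \<le> 1" using Finite_Cartesian_Product.norm_nth_le[of h j] that by simp
      then show "norm (h $ j * partial j g z) \<le> norm (partial j g z)"
        by (simp add: norm_mult mult_left_le_one_le)
    qed
    finally have "(1 + norm z) ^ k * norm (dirderiv g z h)
        \<le> (1 + norm z) ^ k * (\<Sum>j\<in>UNIV. norm (partial j g z))"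
      by (intro mult_left_mono) auto
    also have "\<dots> \<le> (\<Sum>j\<in>UNIV. c j * exp (\<alpha> / 2 * (norm z)\<^sup>2))"
      unfolding sum_distrib_left by (intro sum_mono c)
    finally show ?thesis by (simp add: C_def sum_distrib_right)
  qed
  \<comment> \<open>Beyond \<open>s0\<close>, half of \<open>\<alpha> s (1 + s)\<close> absorbs the term \<open>k + 1\<close> that comes from the denominator of \<open>\<omega>\<close>.\<close>
  define s0 where "s0 = max 1 (2 * (real k + 1) / \<alpha>)"
  define K where "K = 4 * C / \<alpha>"
  have "K > 0" using \<open>C > 0\<close> \<open>\<alpha> > 0\<close> by (simp add: K_def)
  have s0: "s0 \<ge> 1" "2 * (real k + 1) / \<alpha> \<le> s0" by (auto simp: s0_def)
  define \<omega> where "\<omega> s = exp (\<alpha> / 2 * s\<^sup>2) / (1 + s) ^ Suc k" for s :: real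
  define \<omega>' where "\<omega>' s = exp (\<alpha> / 2 * s\<^sup>2) * (\<alpha> * s * (1 + s) - (real k + 1)) / (1 + s) ^ (k + 2)"
    for s :: real
  have \<omega>_deriv: "(\<omega> has_real_derivative \<omega>' s) (at s)" if "s > 0" for s
  proof -
    have "1 + s \<noteq> 0" using that by simp
    then show ?thesis unfolding \<omega>_def \<omega>'_def
      by (auto intro!: derivative_eq_intros simp del: power_Suc)
         (simp add: divide_simps, simp add: algebra_simps power2_eq_square)
  qed
  have \<omega>'_bound: "C * exp (\<alpha> / 2 * s\<^sup>2) / (1 + s) ^ k \<le> K * \<omega>' s" if "s \<ge> s0" for s
  proof -
    have "2 * (real k + 1) / \<alpha> \<le> s" using that s0 by linarith
    then have s: "s \<ge> 1" "real k + 1 \<le> \<alpha> * s / 2"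
      using that s0 \<open>\<alpha> > 0\<close> by (auto simp: divide_simps mult.commute)
    have "\<alpha> * s / 2 * 1 \<le> \<alpha> * s / 2 * (1 + s)"
      using s \<open>\<alpha> > 0\<close> by (intro mult_left_mono) auto
    moreover have "\<alpha> * (1 + s) * ((1 + s) / 2) \<le> \<alpha> * (1 + s) * s"
      using s \<open>\<alpha> > 0\<close> by (intro mult_left_mono) auto
    ultimately have "\<alpha> / 4 * (1 + s)\<^sup>2 \<le> \<alpha> * s * (1 + s) - (real k + 1)"
      using s by (simp add: power2_eq_square algebra_simps)
    then have "K * (\<alpha> / 4 * (1 + s)\<^sup>2) \<le> K * (\<alpha> * s * (1 + s) - (real k + 1))"
      using \<open>K > 0\<close> by (intro mult_left_mono) auto
    moreover have "K * (\<alpha> / 4 * (1 + s)\<^sup>2) = C * (1 + s)\<^sup>2" using \<open>\<alpha> > 0\<close> by (simp add: K_def)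
    ultimately have "C * (1 + s)\<^sup>2 \<le> K * (\<alpha> * s * (1 + s) - (real k + 1))"
      by (simp only:)
    then have "C * (1 + s)\<^sup>2 * (exp (\<alpha> / 2 * s\<^sup>2) / (1 + s) ^ (k + 2))
        \<le> K * (\<alpha> * s * (1 + s) - (real k + 1)) * (exp (\<alpha> / 2 * s\<^sup>2) / (1 + s) ^ (k + 2))"
      using s by (intro mult_right_mono) auto
    moreover have "C * (1 + s)\<^sup>2 * (exp (\<alpha> / 2 * s\<^sup>2) / (1 + s) ^ (k + 2))
        = C * exp (\<alpha> / 2 * s\<^sup>2) / (1 + s) ^ k"
      using s by (simp add: power_add power2_eq_square divide_simps)
    ultimately show ?thesis by (simp add: \<omega>'_def mult_ac)
  qed
  have ray: "norm (g z - g ((s0 / norm z) *\<^sub>R z)) \<le> K * \<omega> (norm z) - K * \<omega> s0"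
    if "norm z > s0" for z
  proof -
    define e where "e = (1 / norm z) *\<^sub>R z"
    have "z \<noteq> 0" using that s0 by auto
    then have e: "norm e = 1" "norm z *\<^sub>R e = z" by (auto simp: e_def)
    have "norm (g (norm z *\<^sub>R e) - g (s0 *\<^sub>R e)) \<le> K * \<omega> (norm z) - K * \<omega> s0"
    proof (rule differentiable_bound_general[OF that])
      have "continuous_on {s0..norm z} (\<lambda>s. s *\<^sub>R e)" by (intro continuous_intros)
      then show "continuous_on {s0..norm z} (\<lambda>s. g (s *\<^sub>R e))"
        by (rule continuous_on_compose2[OF entire_continuous_on[OF g, of UNIV]]) auto
      have "isCont \<omega> s" if "s \<ge> s0" for s
        using \<omega>_deriv[of s] that s0 DERIV_isCont by force
      then show "continuous_on {s0..norm z} (\<lambda>s. K * \<omega> s)"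
        by (intro continuous_intros continuous_at_imp_continuous_on) auto
      fix s assume s: "s0 < s" "s < norm z"
      have "((\<lambda>s. s *\<^sub>R e) has_derivative (\<lambda>h. h *\<^sub>R e)) (at s)"
        by (auto intro!: derivative_eq_intros)
      from has_derivative_compose[OF this entire_has_derivative_dirderiv(1)[OF g]]
      have "((\<lambda>s. g (s *\<^sub>R e)) has_derivative (\<lambda>h. dirderiv g (s *\<^sub>R e) (h *\<^sub>R e))) (at s)" .
      moreover have "dirderiv g (s *\<^sub>R e) (h *\<^sub>R e) = h *\<^sub>R dirderiv g (s *\<^sub>R e) e" for h
        using entire_has_derivative_dirderiv(1)[OF g] has_derivative_linear linear_scale by blast
      ultimately show "((\<lambda>s. g (s *\<^sub>R e)) has_vector_derivative dirderiv g (s *\<^sub>R e) e) (at s)"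
        by (simp add: has_vector_derivative_def)
      show "((\<lambda>s. K * \<omega> s) has_vector_derivative K * \<omega>' s) (at s)"
        using \<omega>_deriv[of s] s s0 DERIV_cmult has_real_derivative_iff_has_vector_derivative by fastforce
      have "(1 + s) ^ k * norm (dirderiv g (s *\<^sub>R e) e) \<le> C * exp (\<alpha> / 2 * s\<^sup>2)"
        using dirderiv[of e "s *\<^sub>R e"] e s s0 by simp
      then have "norm (dirderiv g (s *\<^sub>R e) e) \<le> C * exp (\<alpha> / 2 * s\<^sup>2) / (1 + s) ^ k"
        using s s0 by (simp add: pos_le_divide_eq mult.commute)
      with \<omega>'_bound[of s] s show "norm (dirderiv g (s *\<^sub>R e) e) \<le> K * \<omega>' s" by simp
    qed
    then show ?thesis unfolding e by (simp add: e_def)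
  qed
  obtain S where S: "S \<ge> 0" "\<And>w. norm w \<le> s0 \<Longrightarrow> norm (g w) \<le> S"
    using entire_bounded_cball[OF g] by blast
  \<comment> \<open>On \<open>[0, s0]\<close> the bound \<open>S\<close> is dominated by a multiple of \<open>\<omega>\<close>, as \<open>\<omega> \<ge> (1 + s0)\<^bsup>-(k+1)\<^esup>\<close> there.\<close>
  define K2 where "K2 = S * (1 + s0) ^ Suc k"
  have "K2 \<ge> 0" using S s0 by (simp add: K2_def)
  have low: "S \<le> K2 * \<omega> s" if "0 \<le> s" "s \<le> s0" for s
  proof -
    have "(1 + s) ^ Suc k \<le> (1 + s0) ^ Suc k" using that by (intro power_mono) auto
    then have "1 * (1 + s) ^ Suc k \<le> exp (\<alpha> / 2 * s\<^sup>2) * (1 + s0) ^ Suc k"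
      using that s0 \<open>\<alpha> > 0\<close> by (intro mult_mono) auto
    then have "1 \<le> (1 + s0) ^ Suc k * \<omega> s"
      using that by (simp add: \<omega>_def divide_simps mult.commute del: power_Suc)
    from mult_left_mono[OF this \<open>S \<ge> 0\<close>] show ?thesis by (simp add: K2_def mult.assoc)
  qed
  have bound: "norm (g z) \<le> (K + K2) * \<omega> (norm z)" for z
  proof (cases "norm z \<le> s0")
    case True
    have "K * \<omega> (norm z) \<ge> 0" using \<open>K > 0\<close> by (simp add: \<omega>_def)
    with S(2)[OF True] low[OF _ True] show ?thesis by (simp add: distrib_right)
  next
    case False
    then have "norm z > 0" using s0 by linarith
    have "norm (g ((s0 / norm z) *\<^sub>R z)) \<le> S"
      using \<open>norm z > 0\<close> s0 by (intro S) simp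
    moreover have "norm (g z) \<le> norm (g ((s0 / norm z) *\<^sub>R z)) + norm (g z - g ((s0 / norm z) *\<^sub>R z))"
      by (rule norm_triangle_sub)
    moreover have r: "norm (g z - g ((s0 / norm z) *\<^sub>R z)) \<le> K * \<omega> (norm z) - K * \<omega> s0"
      using False by (intro ray) simp
    moreover have "K * \<omega> s0 \<ge> 0" using \<open>K > 0\<close> s0 by (simp add: \<omega>_def)
    moreover have "K2 * \<omega> s0 \<le> K2 * \<omega> (norm z)"
    proof -
      have "0 \<le> K * \<omega> (norm z) - K * \<omega> s0" using r norm_ge_zero order_trans by blast
      then have "\<omega> s0 \<le> \<omega> (norm z)" using \<open>K > 0\<close> by simp
      then show ?thesis using \<open>K2 \<ge> 0\<close> by (intro mult_left_mono)
    qed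
    ultimately show ?thesis using low[of s0] s0 by (simp add: distrib_right)
  qed
  have "(1 + norm z) ^ Suc k * norm (g z) \<le> (K + K2) * exp (\<alpha> / 2 * (norm z)\<^sup>2)" for z
  proof -
    have "(1 + norm z) ^ Suc k > 0" by (intro zero_less_power) (simp add: add_pos_nonneg)
    with bound[of z] show ?thesis
      by (simp add: \<omega>_def pos_le_divide_eq mult.commute del: power_Suc)
  qed
  then show ?thesis unfolding decay_def using g by blast
qed

lemma decay_mono:
  assumes "decay \<alpha> k g" "l \<le> k" shows "decay \<alpha> l g"
proof -
  obtain C where "C > 0" and C: "\<And>z. (1 + norm z) ^ k * norm (g z) \<le> C * exp (\<alpha> / 2 * (norm z)\<^sup>2)"
    using decayE[OF assms(1)] by blast
  have "(1 + norm z) ^ l * norm (g z) \<le> C * exp (\<alpha> / 2 * (norm z)\<^sup>2)" for z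
    by (rule order_trans[OF _ C]) (intro mult_right_mono power_increasing assms; simp)
  then show ?thesis using assms(1) unfolding decay_def by blast
qed

lemma decay_partial_funpow:
  assumes "\<alpha> > 0" shows "decay \<alpha> (k + l) g \<Longrightarrow> decay \<alpha> k ((partial j ^^ l) g)"
proof (induction l arbitrary: k)
  case (Suc l)
  then show ?case using decay_partial[OF _ assms, of k "(partial j ^^ l) g"] by simp
qed simp

lemma decay_mpartial:
  assumes "\<alpha> > 0" "decay \<alpha> m f" "(\<Sum>j\<in>UNIV. \<beta> j) \<le> m"
  shows "decay \<alpha> 0 (mpartial \<beta> f)"
proof -
  have *: "decay \<alpha> (k + sum_list (map \<beta> js)) f \<Longrightarrow> decay \<alpha> k (foldr (\<lambda>j. partial j ^^ \<beta> j) js f)"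
    for k js
  proof (induction js arbitrary: k)
    case (Cons j js)
    then have "decay \<alpha> (k + \<beta> j) (foldr (\<lambda>j. partial j ^^ \<beta> j) js f)"
      by (simp add: add.assoc)
    then show ?case using decay_partial_funpow[OF assms(1)] by simp
  qed simp
  have "sum_list (map \<beta> coords) = (\<Sum>j\<in>UNIV. \<beta> j)"
    using sum_list_distinct_conv_sum_set[OF coords(1), of \<beta>] by (simp add: coords(2))
  with assms have "decay \<alpha> (0 + sum_list (map \<beta> coords)) f"
    using decay_mono by simp
  from *[OF this] show ?thesis by (simp add: mpartial_def)
qed

lemma mpartial_0: "mpartial (\<lambda>_. 0) f = f"
proof -
  have "foldr (\<lambda>j. partial j ^^ 0) js f = f" for js by (induction js) auto
  then show ?thesis by (simp add: mpartial_def)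
qed

text \<open>
  Descending induction on the order of differentiation, with one application of
  \<open>decay_of_partials\<close> per step.
\<close>

lemma decay_of_mpartials:
  assumes "\<alpha> > 0" "entire f"
    and "\<And>\<beta>. (\<Sum>j\<in>UNIV. \<beta> j) \<le> m \<Longrightarrow> decay \<alpha> 0 (mpartial \<beta> f)"
  shows "decay \<alpha> m f"
proof -
  have "k + (\<Sum>j\<in>UNIV. \<beta> j) \<le> m \<Longrightarrow> decay \<alpha> k (mpartial \<beta> f)" for k \<beta>
  proof (induction k arbitrary: \<beta>)
    case 0
    then show ?case using assms(3) by simp
  next
    case (Suc k)
    show ?case
    proof (rule decay_of_partials[OF entire_mpartial[OF assms(2)] _ assms(1)])
      fix j
      have "(\<Sum>i\<in>UNIV. (\<beta>(j := Suc (\<beta> j))) i) = Suc (\<Sum>i\<in>UNIV. \<beta> i)"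
        by (simp add: sum.remove[of UNIV j])
      then have "decay \<alpha> k (mpartial (\<beta>(j := Suc (\<beta> j))) f)"
        using Suc by (intro Suc.IH) simp
      then show "decay \<alpha> k (partial j (mpartial \<beta> f))"
        by (simp only: mpartial_Suc[OF assms(2)])
    qed
  qed
  from this[of m "\<lambda>_. 0"] show ?thesis by (simp add: mpartial_0)
qed

section \<open>Point evaluations\<close>

text \<open>
  The Hermitian product of \<open>\<complex>\<^sup>n\<close>, linear in its first argument; its real part is the Euclidean inner
  product.
\<close>

definition cdot :: "complex ^ 'n \<Rightarrow> complex ^ 'n \<Rightarrow> complex" where
  "cdot z w = (\<Sum>j\<in>UNIV. z $ j * cnj (w $ j))"

lemma Re_cdot: "Re (cdot z w) = z \<bullet> w"
  by (simp add: cdot_def inner_vec_def inner_complex_def)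

lemma norm_exp_cdot: "norm (exp (complex_of_real c * cdot z w)) = exp (c * (z \<bullet> w))"
  by (simp add: norm_exp_eq_Re Re_cdot)

lemma exp_cdot_has_derivative:
  "((\<lambda>z. exp (c * cdot z w)) has_derivative (\<lambda>h. exp (c * cdot z w) * (c * cdot h w))) (at z)"
proof -
  have "linear (\<lambda>z. cdot z w)"
    by (rule linearI) (simp_all add: cdot_def algebra_simps sum.distrib scaleR_sum_right)
  then have "bounded_linear (\<lambda>z. c * cdot z w)"
    by (intro bounded_linear_compose[OF bounded_linear_mult_right] linear_conv_bounded_linear[THEN iffD1])
  then have "((\<lambda>z. c * cdot z w) has_derivative (\<lambda>h. c * cdot h w)) (at z)"
    by (rule bounded_linear_imp_has_derivative)
  from has_derivative_compose[OF this DERIV_exp[unfolded has_field_derivative_def]]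
  show ?thesis by simp
qed

lemma cdot_scale: "cdot (c *s z) w = c * cdot z w"
  by (simp add: cdot_def sum_distrib_left mult.assoc)

lemma entire_exp_cdot: "entire (\<lambda>z. exp (c * cdot z w))"
  unfolding entire_def using exp_cdot_has_derivative[of c w] by (auto simp: cdot_scale mult_ac intro!: exI)

text \<open>
  Let \<open>d\<close> be the real dimension, \<open>s = d/q\<close>, and let \<open>z\<^sub>0\<close> maximise \<open>|F(z)| (1 - |z|)\<^sup>s\<close> over the closed
  unit ball; put \<open>\<rho> = 1 - |z\<^sub>0|\<close>.  On the ball of radius \<open>\<rho>/2\<close> around \<open>z\<^sub>0\<close> the weight drops by at most
  \<open>2\<^bsup>-s\<^esup>\<close>, so \<open>|F| \<le> 2\<^sup>s |F(z\<^sub>0)|\<close>.  By Cauchy's estimate \<open>|F| \<ge> |F(z\<^sub>0)|/2\<close> on the ball of radius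
  \<open>\<delta> \<rho>\<close> with \<open>\<delta>\<close> depending on \<open>s\<close> only.  The integral over it is at least a constant times
  \<open>|F(z\<^sub>0)|\<^sup>q \<rho>\<^sup>d\<close>, the \<open>q\<close>-th power of the maximum, and the maximum is at least \<open>|F(0)|\<close>.
\<close>

lemma powr_local_bound_at_0:
  fixes q :: real
  assumes "q > 0"
  obtains c where "c > 0" "\<And>F :: complex ^ 'n \<Rightarrow> complex. entire F \<Longrightarrow>
    ennreal (norm (F 0) powr q) \<le>
      ennreal c * (\<integral>\<^sup>+ v. ennreal (norm (F v) powr q) * indicator (ball 0 1) v \<partial>lborel)"
proof -
  define d where "d = DIM(complex ^ 'n)"
  define s where "s = real d / q"
  have "d > 0" by (simp add: d_def)
  then have "s > 0" using assms by (simp add: s_def)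
  \<comment> \<open>Cauchy with radius \<open>\<rho>/4\<close> gives the Lipschitz constant \<open>4 \<cdot> 2\<^sup>s a / \<rho>\<close>, which over distance \<open>\<delta> \<rho>\<close> amounts to \<open>a/2\<close>.\<close>
  define \<delta> where "\<delta> = 1 / (8 * 2 powr s)"
  have "2 powr s \<ge> 1" using \<open>s > 0\<close> by (simp add: ge_one_powr_ge_zero)
  then have \<delta>: "\<delta> > 0" "\<delta> \<le> 1/8" by (auto simp: \<delta>_def divide_simps)
  define V where "V = unit_ball_vol (real d)"
  have "V > 0" by (simp add: V_def)
  define c where "c = 2 powr q / (V * \<delta> ^ d)"
  have "c > 0" using \<delta> \<open>V > 0\<close> by (simp add: c_def)
  have "ennreal (norm (F 0) powr q) \<le>
      ennreal c * (\<integral>\<^sup>+ v. ennreal (norm (F v) powr q) * indicator (ball 0 1) v \<partial>lborel)"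
    if F: "entire F" for F :: "complex ^ 'n \<Rightarrow> complex"
  proof (cases "F 0 = 0")
    case False
    define A where "A z = norm (F z) * (1 - norm z) powr s" for z
    have "continuous_on (cball 0 1) A"
      unfolding A_def using \<open>s > 0\<close>
      by (intro continuous_intros continuous_on_powr' entire_continuous_on[OF F]) auto
    then obtain z0 where "z0 \<in> cball 0 1" and max: "\<And>z. z \<in> cball 0 1 \<Longrightarrow> A z \<le> A z0"
      using continuous_attains_sup[of "cball (0 :: complex ^ 'n) 1" A] by auto
    define a where "a = norm (F z0)"
    define \<rho> where "\<rho> = 1 - norm z0"
    have A0: "norm (F 0) \<le> a * \<rho> powr s" using max[of 0] by (simp add: A_def a_def \<rho>_def)
    have "norm (F 0) > 0" using False by simp
    then have "a > 0" "\<rho> \<noteq> 0" using A0 by (auto simp: a_def)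
    then have "\<rho> > 0" using \<open>z0 \<in> cball 0 1\<close> by (simp add: \<rho>_def)
    have near: "norm (F z) \<le> 2 powr s * a" if "dist z0 z \<le> \<rho> / 2" for z
    proof -
      have z: "1 - norm z \<ge> \<rho> / 2"
        using that norm_triangle_sub[of z z0] by (simp add: \<rho>_def dist_norm norm_minus_commute)
      have "norm (F z) * (\<rho> / 2) powr s \<le> A z"
        unfolding A_def using z \<open>\<rho> > 0\<close> \<open>s > 0\<close> by (intro mult_left_mono powr_mono2) auto
      also have "A z \<le> a * \<rho> powr s"
        using max[of z] z \<open>\<rho> > 0\<close> by (simp add: A_def a_def \<rho>_def)
      finally show ?thesis using \<open>\<rho> > 0\<close> by (simp add: powr_divide field_simps)
    qed
    have lower: "norm (F z) \<ge> a / 2" if z: "z \<in> ball z0 (\<delta> * \<rho>)" for z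
    proof -
      have "norm (F z - F z0) \<le> (2 powr s * a / (\<rho> / 4)) * norm (z - z0)"
      proof (rule differentiable_bound[where S = "ball z0 (\<delta> * \<rho>)" and f' = "dirderiv F"])
        show "(F has_derivative dirderiv F x) (at x within ball z0 (\<delta> * \<rho>))" for x
          by (rule has_derivative_at_withinI[OF entire_has_derivative_dirderiv(1)[OF F]])
        fix x assume x: "x \<in> ball z0 (\<delta> * \<rho>)"
        have "\<delta> * \<rho> \<le> 1 / 8 * \<rho>" using \<delta> \<open>\<rho> > 0\<close> by (intro mult_right_mono) auto
        with x have x: "dist z0 x \<le> \<rho> / 4" using \<open>\<rho> > 0\<close> unfolding mem_ball by linarith
        show "onorm (dirderiv F x) \<le> 2 powr s * a / (\<rho> / 4)"
        proof (intro onorm_le dirderiv_bound entire_holomorphic_on_line F)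
          fix w assume "dist x w \<le> \<rho> / 4"
          then show "norm (F w) \<le> 2 powr s * a"
            using x dist_triangle[of z0 w x] by (intro near) linarith
        qed (use \<open>\<rho> > 0\<close> in auto)
      qed (use z \<open>\<rho> > 0\<close> \<delta> in auto)
      also have "\<dots> \<le> (2 powr s * a / (\<rho> / 4)) * (\<delta> * \<rho>)"
        using z \<open>a > 0\<close> \<open>\<rho> > 0\<close> by (intro mult_left_mono) (auto simp: dist_norm norm_minus_commute)
      also have "\<dots> = a / 2" using \<open>\<rho> > 0\<close> by (simp add: \<delta>_def)
      finally show ?thesis using norm_triangle_sub[of "F z0" "F z"] by (simp add: a_def norm_minus_commute)
    qed
    have sub: "ball z0 (\<delta> * \<rho>) \<subseteq> ball 0 1"
    proof
      fix z assume "z \<in> ball z0 (\<delta> * \<rho>)"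
      moreover have "\<delta> * \<rho> \<le> 1 * \<rho>" using \<delta> \<open>\<rho> > 0\<close> by (intro mult_right_mono) auto
      ultimately show "z \<in> ball 0 1"
        using norm_triangle_sub[of z z0] by (simp add: \<rho>_def dist_norm norm_minus_commute)
    qed
    have "norm (F 0) powr q \<le> (a * \<rho> powr s) powr q"
      using A0 assms by (intro powr_mono2) auto
    also have "\<dots> = a powr q * \<rho> ^ d"
      using \<open>a > 0\<close> \<open>\<rho> > 0\<close> assms by (simp add: powr_mult powr_powr s_def powr_realpow)
    also have "\<dots> = c * ((a / 2) powr q * (V * (\<delta> * \<rho>) ^ d))"
      using \<open>a > 0\<close> \<open>V > 0\<close> \<delta> by (simp add: c_def powr_divide power_mult_distrib)
    finally have "ennreal (norm (F 0) powr q) \<le> ennreal (c * ((a / 2) powr q * (V * (\<delta> * \<rho>) ^ d)))"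
      by (rule ennreal_leI)
    also have "\<dots> = ennreal c * (ennreal ((a / 2) powr q) * emeasure lborel (ball z0 (\<delta> * \<rho>)))"
      using \<open>c > 0\<close> \<delta> \<open>\<rho> > 0\<close> \<open>V > 0\<close>
      by (simp add: emeasure_ball ennreal_mult V_def d_def)
    also have "ennreal ((a / 2) powr q) * emeasure lborel (ball z0 (\<delta> * \<rho>))
        = (\<integral>\<^sup>+ v. ennreal ((a / 2) powr q) * indicator (ball z0 (\<delta> * \<rho>)) v \<partial>lborel)"
      by (simp add: nn_integral_cmult_indicator)
    also have "\<dots> \<le> (\<integral>\<^sup>+ v. ennreal (norm (F v) powr q) * indicator (ball 0 1) v \<partial>lborel)"
    proof (intro nn_integral_mono)
      fix v
      show "ennreal ((a / 2) powr q) * indicator (ball z0 (\<delta> * \<rho>)) v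
          \<le> ennreal (norm (F v) powr q) * indicator (ball 0 1) v"
      proof (cases "v \<in> ball z0 (\<delta> * \<rho>)")
        case True
        then have "(a / 2) powr q \<le> norm (F v) powr q"
          using lower \<open>a > 0\<close> assms by (intro powr_mono2) auto
        then show ?thesis using True sub by (auto simp: indicator_def intro!: ennreal_leI)
      qed simp
    qed
    finally show ?thesis by (simp add: mult_left_mono)
  qed (use assms in simp)
  with \<open>c > 0\<close> show ?thesis by (rule that)
qed

text \<open>
  The Gaussian-weighted modulus.  In terms of it the Fock norms are \<open>L\<^sup>p\<close> norms, which lets the
  finite and the infinite exponents share their estimates.
\<close>

definition wabs :: "real \<Rightarrow> (complex ^ 'n \<Rightarrow> complex) \<Rightarrow> complex ^ 'n \<Rightarrow> real" where
  "wabs \<alpha> f z = norm (f z) * exp (- (\<alpha> / 2) * (norm z)\<^sup>2)"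

lemma wabs_nonneg [simp]: "wabs \<alpha> f z \<ge> 0"
  by (simp add: wabs_def)

lemma wabs_measurable: "entire f \<Longrightarrow> wabs \<alpha> f \<in> borel_measurable borel"
  unfolding wabs_def[abs_def] by (intro borel_measurable_continuous_onI continuous_intros entire_continuous_on)

lemma nn_integral_lborel_translate:
  fixes h :: "'a :: euclidean_space \<Rightarrow> ennreal"
  assumes "h \<in> borel_measurable borel"
  shows "(\<integral>\<^sup>+ v. h (w + v) \<partial>lborel) = (\<integral>\<^sup>+ v. h v \<partial>lborel)"
proof -
  have "(\<integral>\<^sup>+ v. h v \<partial>lborel) = (\<integral>\<^sup>+ v. h v \<partial>distr lborel borel ((+) w))"
    by (simp add: lborel_distr_plus)
  also have "\<dots> = (\<integral>\<^sup>+ v. h (w + v) \<partial>lborel)"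
    using assms by (subst nn_integral_distr) auto
  finally show ?thesis ..
qed

text \<open>
  Apply the inequality at the origin to \<open>F(v) = f(w + v) exp (-\<alpha> \<langle>v,w\<rangle> - \<alpha>/2 |w|\<^sup>2)\<close>.  By
  \<open>|w + v|\<^sup>2 = |w|\<^sup>2 + 2 Re \<langle>v,w\<rangle> + |v|\<^sup>2\<close>, its modulus is the weighted modulus of \<open>f\<close> at \<open>w + v\<close> times
  \<open>exp (\<alpha>/2 |v|\<^sup>2)\<close>, a factor between \<open>1\<close> and \<open>exp (\<alpha>/2)\<close> on the unit ball.
\<close>

lemma wabs_powr_local_bound:
  fixes q :: real
  assumes "q > 0" "\<alpha> > 0"
  obtains c where "c > 0" "\<And>(f :: complex ^ 'n \<Rightarrow> complex) w. entire f \<Longrightarrow>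
    ennreal (wabs \<alpha> f w powr q) \<le>
      ennreal c * (\<integral>\<^sup>+ v. ennreal (wabs \<alpha> f v powr q) * indicator (ball w 1) v \<partial>lborel)"
proof -
  obtain c where "c > 0" and c: "\<And>F :: complex ^ 'n \<Rightarrow> complex. entire F \<Longrightarrow>
    ennreal (norm (F 0) powr q) \<le>
      ennreal c * (\<integral>\<^sup>+ v. ennreal (norm (F v) powr q) * indicator (ball 0 1) v \<partial>lborel)"
    using powr_local_bound_at_0[OF assms(1), where 'n = 'n] by blast
  define E where "E = exp (\<alpha> / 2) powr q"
  have "E > 0" by (simp add: E_def)
  have "ennreal (wabs \<alpha> f w powr q) \<le>
      ennreal (c * E) * (\<integral>\<^sup>+ v. ennreal (wabs \<alpha> f v powr q) * indicator (ball w 1) v \<partial>lborel)"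
    if f: "entire f" for f :: "complex ^ 'n \<Rightarrow> complex" and w
  proof -
    note [measurable] = wabs_measurable[OF f]
    have [measurable]: "ball w 1 \<in> sets borel" by simp
    define F where
      "F v = of_real (exp (- (\<alpha> / 2) * (norm w)\<^sup>2)) * (f (v + w) * exp (of_real (- \<alpha>) * cdot v w))" for v
    have "entire F" unfolding F_def
      by (intro entire_cmult entire_mult entire_translate entire_exp_cdot f)
    have normF: "norm (F v) = wabs \<alpha> f (w + v) * exp (\<alpha> / 2 * (norm v)\<^sup>2)" for v
    proof -
      have "(norm (w + v))\<^sup>2 = (norm w)\<^sup>2 + (norm v)\<^sup>2 + 2 * (v \<bullet> w)"
        by (simp add: power2_norm_eq_inner inner_simps inner_commute)
      then have "- (\<alpha> / 2) * (norm (w + v))\<^sup>2 + \<alpha> / 2 * (norm v)\<^sup>2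
          = - (\<alpha> / 2) * (norm w)\<^sup>2 + (- \<alpha>) * (v \<bullet> w)"
        by (simp add: algebra_simps)
      then have "exp (- (\<alpha> / 2) * (norm (w + v))\<^sup>2) * exp (\<alpha> / 2 * (norm v)\<^sup>2)
          = exp (- (\<alpha> / 2) * (norm w)\<^sup>2) * exp ((- \<alpha>) * (v \<bullet> w))"
        by (simp only: exp_add[symmetric])
      then show ?thesis
        unfolding F_def wabs_def norm_mult norm_exp_cdot norm_of_real abs_exp_cancel
          add.commute[of v w] by (simp only: mult_ac)
    qed
    have "ennreal (wabs \<alpha> f w powr q) = ennreal (norm (F 0) powr q)"
      by (simp add: normF)
    also have "\<dots> \<le> ennreal c * (\<integral>\<^sup>+ v. ennreal (norm (F v) powr q) * indicator (ball 0 1) v \<partial>lborel)"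
      by (rule c[OF \<open>entire F\<close>])
    also have "(\<integral>\<^sup>+ v. ennreal (norm (F v) powr q) * indicator (ball 0 1) v \<partial>lborel)
        \<le> (\<integral>\<^sup>+ v. ennreal E * (ennreal (wabs \<alpha> f (w + v) powr q) * indicator (ball w 1) (w + v)) \<partial>lborel)"
    proof (intro nn_integral_mono)
      fix v :: "complex ^ 'n"
      show "ennreal (norm (F v) powr q) * indicator (ball 0 1) v
        \<le> ennreal E * (ennreal (wabs \<alpha> f (w + v) powr q) * indicator (ball w 1) (w + v))"
      proof (cases "v \<in> ball 0 1")
        case True
        then have "(norm v)\<^sup>2 \<le> 1" by (simp add: abs_square_le_1)
        then have "exp (\<alpha> / 2 * (norm v)\<^sup>2) \<le> exp (\<alpha> / 2)"
          using assms by (simp add: mult_left_le)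
        then have "norm (F v) powr q \<le> (wabs \<alpha> f (w + v) * exp (\<alpha> / 2)) powr q"
          unfolding normF using assms by (intro powr_mono2 mult_left_mono) auto
        also have "\<dots> = E * wabs \<alpha> f (w + v) powr q"
          by (simp add: E_def powr_mult mult.commute)
        finally have "ennreal (norm (F v) powr q) \<le> ennreal (E * wabs \<alpha> f (w + v) powr q)"
          by (rule ennreal_leI)
        then show ?thesis using True \<open>E > 0\<close>
          by (simp add: indicator_def ennreal_mult dist_norm)
      qed simp
    qed
    also have "\<dots> = ennreal E * (\<integral>\<^sup>+ v. ennreal (wabs \<alpha> f (w + v) powr q) * indicator (ball w 1) (w + v) \<partial>lborel)"
      by (rule nn_integral_cmult) measurable
    also have "(\<integral>\<^sup>+ v. ennreal (wabs \<alpha> f (w + v) powr q) * indicator (ball w 1) (w + v) \<partial>lborel)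
        = (\<integral>\<^sup>+ v. ennreal (wabs \<alpha> f v powr q) * indicator (ball w 1) v \<partial>lborel)"
      by (rule nn_integral_lborel_translate[of "\<lambda>v. ennreal (wabs \<alpha> f v powr q) * indicator (ball w 1) v"])
         measurable
    finally show ?thesis
      using \<open>c > 0\<close> \<open>E > 0\<close> by (simp add: ennreal_mult mult.assoc mult_left_mono)
  qed
  then show ?thesis using that[of "c * E"] \<open>c > 0\<close> \<open>E > 0\<close> by simp
qed

text \<open>
  The weight \<open>|z|\<^sup>m\<close> of the norms says nothing near the origin; the maximum principle does.  For
  \<open>|w| < 2\<close>, the circle of radius \<open>4\<close> around \<open>w\<close> in a coordinate line lies in \<open>2 \<le> |v| \<le> 6\<close>, where the
  Gaussian factor is at least \<open>exp (-18 \<alpha>)\<close>.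
\<close>

lemma weighted_bound_extend_inside:
  fixes f :: "complex ^ 'n \<Rightarrow> complex"
  assumes "entire f" "\<alpha> > 0" "B \<ge> 0"
    and out: "\<And>w. norm w \<ge> 2 \<Longrightarrow> (1 + norm w) ^ m * wabs \<alpha> f w \<le> B"
  shows "(1 + norm w) ^ m * wabs \<alpha> f w \<le> 3 ^ m * exp (\<alpha> * 18) * B"
proof (cases "norm w \<ge> 2")
  case True
  have "1 * 1 \<le> (3::real) ^ m * exp (\<alpha> * 18)" using assms by (intro mult_mono) auto
  from mult_right_mono[OF this \<open>B \<ge> 0\<close>] out[OF True] show ?thesis by simp
next
  case False
  obtain j :: 'n where True by blast
  let ?g = "\<lambda>t. f (w + t *s axis j 1)"
  have "norm ((deriv ^^ 0) ?g 0) \<le> fact 0 * (exp (\<alpha> * 18) * B) / 4 ^ 0"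
  proof (rule Cauchy_inequality)
    fix t :: complex assume "norm (0 - t) = 4"
    then have n: "norm (t *s axis j (1::complex)) = 4" by (simp add: norm_vector_scalar_mult)
    define v where "v = w + t *s axis j 1"
    have v: "norm v \<le> 6" "norm v \<ge> 2"
      using False n norm_triangle_ineq[of w "t *s axis j 1"] norm_diff_ineq[of "t *s axis j 1" w]
      by (auto simp: v_def add.commute)
    have "1 * wabs \<alpha> f v \<le> (1 + norm v) ^ m * wabs \<alpha> f v"
      by (intro mult_right_mono one_le_power) auto
    also have "\<dots> \<le> B" by (rule out[OF v(2)])
    finally have "norm (f v) * exp (- (\<alpha> / 2) * (norm v)\<^sup>2) \<le> B" by (simp add: wabs_def)
    moreover have "exp (- (\<alpha> * 18)) \<le> exp (- (\<alpha> / 2) * (norm v)\<^sup>2)"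
      using v power_mono[of "norm v" 6 2] assms by simp
    ultimately have "norm (f v) * exp (- (\<alpha> * 18)) \<le> B"
      by (meson mult_left_mono norm_ge_zero order_trans)
    then show "norm (?g t) \<le> exp (\<alpha> * 18) * B"
      by (simp add: v_def exp_minus field_simps)
  qed (use assms in \<open>auto intro!: entire_holomorphic_on_line holomorphic_on_imp_continuous_on\<close>)
  then have "norm (f w) \<le> exp (\<alpha> * 18) * B" by simp
  moreover have "exp (- (\<alpha> / 2) * (norm w)\<^sup>2) \<le> 1" using assms by simp
  ultimately have "wabs \<alpha> f w \<le> exp (\<alpha> * 18) * B * 1"
    unfolding wabs_def using assms by (intro mult_mono) auto
  then have "(1 + norm w) ^ m * wabs \<alpha> f w \<le> 3 ^ m * (exp (\<alpha> * 18) * B * 1)"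
    using False assms by (intro mult_mono power_mono) auto
  then show ?thesis by (simp add: mult.assoc)
qed

lemma ennreal_pow_less_top_iff: "ennreal_pow x r < \<infinity> \<longleftrightarrow> x < \<infinity>"
  by (auto simp: ennreal_pow_def less_top)

lemma exp_weight_powr:
  "norm (f z) powr q * exp (- (\<alpha> * q / 2) * (norm z)\<^sup>2) = wabs \<alpha> f z powr q"
  by (simp add: wabs_def powr_mult exp_powr_real mult_ac)

lemma fs_norm_finite_eq:
  assumes "p \<noteq> \<infinity>"
  shows "fs_norm p m \<alpha> (f :: complex ^ 'n \<Rightarrow> complex) =
    ennreal_pow (ennreal (fs_const (enn2real p) m \<alpha> CARD('n)) *
      (\<integral>\<^sup>+ z. ennreal ((norm z ^ m * wabs \<alpha> f z) powr enn2real p) \<partial>lborel)) (1 / enn2real p)"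
proof -
  have "(norm z ^ m) powr q * norm (f z) powr q * exp (- (\<alpha> * q / 2) * (norm z)\<^sup>2)
      = (norm z ^ m * wabs \<alpha> f z) powr q" for z q
    by (simp add: powr_mult exp_weight_powr[symmetric] mult.assoc)
  then show ?thesis using assms by (simp add: fs_norm_def Let_def)
qed

lemma fs_norm_infinity: "fs_norm \<infinity> m \<alpha> f = (SUP z. ennreal (norm z ^ m * wabs \<alpha> f z))"
  by (simp add: fs_norm_def wabs_def mult.assoc)

lemma fs_const_pos: "q > 0 \<Longrightarrow> \<alpha> > 0 \<Longrightarrow> n > 0 \<Longrightarrow> fs_const q m \<alpha> n > 0"
  unfolding fs_const_def
  by (intro mult_pos_pos divide_pos_pos Gamma_real_pos) (auto intro: add_nonneg_pos)

text \<open>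
  By \<open>weighted_bound_extend_inside\<close> only points with \<open>|w| \<ge> 2\<close> matter.  There \<open>1 + |w| \<le> 2 |w|\<close>,
  which settles \<open>p = \<infinity>\<close>, and \<open>1 + |w| \<le> 3 |v|\<close> for \<open>v\<close> in the unit ball around \<open>w\<close>, so that the weight
  can be moved into the integral of \<open>wabs_powr_local_bound\<close>, which settles \<open>p < \<infinity>\<close>.
\<close>

lemma point_evaluation_bound:
  assumes "\<alpha> > 0" "p > 0"
  obtains C where "C > 0" "\<And>(f :: complex ^ 'n \<Rightarrow> complex) w. entire f \<Longrightarrow>
    ennreal ((1 + norm w) ^ m * wabs \<alpha> f w) \<le> ennreal C * fs_norm p m \<alpha> f"
proof -
  have "\<exists>C0>0. \<forall>f :: complex ^ 'n \<Rightarrow> complex. entire f \<longrightarrow> fs_norm p m \<alpha> f < \<infinity> \<longrightarrow>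
      (\<forall>w. norm w \<ge> 2 \<longrightarrow> (1 + norm w) ^ m * wabs \<alpha> f w \<le> C0 * enn2real (fs_norm p m \<alpha> f))"
  proof (cases "p = \<infinity>")
    case True
    show ?thesis
    proof (intro exI[of _ "2 ^ m"] conjI allI impI)
      fix f :: "complex ^ 'n \<Rightarrow> complex" and w :: "complex ^ 'n"
      assume fin: "fs_norm p m \<alpha> f < \<infinity>" and w: "norm w \<ge> 2"
      have "ennreal (norm w ^ m * wabs \<alpha> f w) \<le> fs_norm p m \<alpha> f"
        unfolding True fs_norm_infinity by (rule SUP_upper) simp
      also have "\<dots> = ennreal (enn2real (fs_norm p m \<alpha> f))" using fin by simp
      finally have *: "norm w ^ m * wabs \<alpha> f w \<le> enn2real (fs_norm p m \<alpha> f)"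
        by simp
      have "(1 + norm w) ^ m * wabs \<alpha> f w \<le> (2 * norm w) ^ m * wabs \<alpha> f w"
        using w by (intro mult_right_mono power_mono) auto
      also have "\<dots> = 2 ^ m * (norm w ^ m * wabs \<alpha> f w)" by (simp add: power_mult_distrib)
      also have "\<dots> \<le> 2 ^ m * enn2real (fs_norm p m \<alpha> f)" by (intro mult_left_mono *) simp
      finally show "(1 + norm w) ^ m * wabs \<alpha> f w \<le> 2 ^ m * enn2real (fs_norm p m \<alpha> f)" .
    qed simp
  next
    case False
    define q where "q = enn2real p"
    have "q > 0" using assms False by (simp add: q_def enn2real_positive_iff less_top)
    define K where "K = fs_const q m \<alpha> CARD('n)"
    have "K > 0" unfolding K_def using \<open>q > 0\<close> assms by (intro fs_const_pos) auto
    obtain c where "c > 0" and c: "\<And>(f :: complex ^ 'n \<Rightarrow> complex) w. entire f \<Longrightarrow>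
        ennreal (wabs \<alpha> f w powr q) \<le>
          ennreal c * (\<integral>\<^sup>+ v. ennreal (wabs \<alpha> f v powr q) * indicator (ball w 1) v \<partial>lborel)"
      using wabs_powr_local_bound[OF \<open>q > 0\<close> \<open>\<alpha> > 0\<close>, where 'n = 'n] by blast
    define c' where "c' = c * (3 ^ m) powr q / K"
    have "c' > 0" using \<open>c > 0\<close> \<open>K > 0\<close> by (simp add: c'_def)
    show ?thesis
    proof (intro exI[of _ "c' powr (1 / q)"] conjI allI impI)
      show "c' powr (1 / q) > 0" using \<open>c' > 0\<close> by simp
      fix f :: "complex ^ 'n \<Rightarrow> complex" and w :: "complex ^ 'n"
      assume f: "entire f" and fin: "fs_norm p m \<alpha> f < \<infinity>" and w: "norm w \<ge> 2"
      note [measurable] = wabs_measurable[OF f]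
      have [measurable]: "ball w 1 \<in> sets borel" by simp
      let ?I = "\<integral>\<^sup>+ z. ennreal ((norm z ^ m * wabs \<alpha> f z) powr q) \<partial>lborel"
      have eq: "fs_norm p m \<alpha> f = ennreal_pow (ennreal K * ?I) (1 / q)"
        using fs_norm_finite_eq[OF False, of m \<alpha> f] by (simp add: K_def q_def)
      have "ennreal K * ?I < \<infinity>" using fin unfolding eq ennreal_pow_less_top_iff .
      then have "?I < \<infinity>" using \<open>K > 0\<close> by (auto simp: ennreal_mult_less_top less_top[symmetric])
      then obtain X where X: "?I = ennreal X" "X \<ge> 0" by (cases ?I) auto
      have N: "enn2real (fs_norm p m \<alpha> f) = (K * X) powr (1 / q)"
        unfolding eq X(1) using \<open>K > 0\<close> X(2)
        by (simp add: ennreal_pow_def ennreal_mult[symmetric])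
      have "ennreal (((1 + norm w) ^ m * wabs \<alpha> f w) powr q)
          = ennreal (((1 + norm w) ^ m) powr q) * ennreal (wabs \<alpha> f w powr q)"
        by (simp add: powr_mult ennreal_mult)
      also have "\<dots> \<le> ennreal (((1 + norm w) ^ m) powr q) * (ennreal c *
          (\<integral>\<^sup>+ v. ennreal (wabs \<alpha> f v powr q) * indicator (ball w 1) v \<partial>lborel))"
        by (intro mult_left_mono c f) simp
      also have "\<dots> = ennreal c * (ennreal (((1 + norm w) ^ m) powr q) *
          (\<integral>\<^sup>+ v. ennreal (wabs \<alpha> f v powr q) * indicator (ball w 1) v \<partial>lborel))"
        by (simp only: mult_ac)
      also have "ennreal (((1 + norm w) ^ m) powr q) *
          (\<integral>\<^sup>+ v. ennreal (wabs \<alpha> f v powr q) * indicator (ball w 1) v \<partial>lborel) =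
          (\<integral>\<^sup>+ v. ennreal (((1 + norm w) ^ m) powr q) * (ennreal (wabs \<alpha> f v powr q) * indicator (ball w 1) v) \<partial>lborel)"
        by (rule nn_integral_cmult[symmetric]) measurable
      also have "\<dots> \<le> (\<integral>\<^sup>+ v. ennreal ((3 ^ m) powr q) * ennreal ((norm v ^ m * wabs \<alpha> f v) powr q) \<partial>lborel)"
      proof (intro nn_integral_mono)
        fix v
        show "ennreal (((1 + norm w) ^ m) powr q) * (ennreal (wabs \<alpha> f v powr q) * indicator (ball w 1) v)
            \<le> ennreal ((3 ^ m) powr q) * ennreal ((norm v ^ m * wabs \<alpha> f v) powr q)"
        proof (cases "v \<in> ball w 1")
          case True
          then have "1 + norm w \<le> 3 * norm v"
            using w norm_triangle_sub[of w v] by (simp add: dist_norm)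
          then have "((1 + norm w) ^ m * wabs \<alpha> f v) powr q \<le> ((3 * norm v) ^ m * wabs \<alpha> f v) powr q"
            using \<open>q > 0\<close> by (intro powr_mono2 mult_right_mono power_mono) auto
          then have "((1 + norm w) ^ m) powr q * wabs \<alpha> f v powr q
              \<le> (3 ^ m) powr q * (norm v ^ m * wabs \<alpha> f v) powr q"
            by (simp add: powr_mult power_mult_distrib mult.assoc)
          from ennreal_leI[OF this] show ?thesis using True by (simp add: ennreal_mult)
        qed simp
      qed
      also have "\<dots> = ennreal ((3 ^ m) powr q) * ?I"
        by (rule nn_integral_cmult) measurable
      finally have "ennreal (((1 + norm w) ^ m * wabs \<alpha> f w) powr q)
          \<le> ennreal c * (ennreal ((3 ^ m) powr q) * ennreal X)"
        unfolding X(1) by (simp add: mult_left_mono)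
      also have "\<dots> = ennreal (c' * (K * X))"
        using \<open>c > 0\<close> \<open>K > 0\<close> X(2) by (simp add: c'_def ennreal_mult[symmetric])
      finally have "((1 + norm w) ^ m * wabs \<alpha> f w) powr q \<le> c' * (K * X)"
        using \<open>c' > 0\<close> \<open>K > 0\<close> X(2) by simp
      then have "(((1 + norm w) ^ m * wabs \<alpha> f w) powr q) powr (1 / q) \<le> (c' * (K * X)) powr (1 / q)"
        using \<open>q > 0\<close> by (intro powr_mono2) auto
      then show "(1 + norm w) ^ m * wabs \<alpha> f w \<le> c' powr (1 / q) * enn2real (fs_norm p m \<alpha> f)"
        using \<open>q > 0\<close> \<open>c' > 0\<close> \<open>K > 0\<close> X(2)
        by (simp add: N powr_powr powr_mult)
    qed
  qed
  then obtain C0 where "C0 > 0" and C0: "\<And>(f :: complex ^ 'n \<Rightarrow> complex) w. entire f \<Longrightarrow>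
      fs_norm p m \<alpha> f < \<infinity> \<Longrightarrow> norm w \<ge> 2 \<Longrightarrow>
      (1 + norm w) ^ m * wabs \<alpha> f w \<le> C0 * enn2real (fs_norm p m \<alpha> f)"
    by blast
  define C where "C = 3 ^ m * exp (\<alpha> * 18) * C0"
  have "C > 0" using \<open>C0 > 0\<close> by (simp add: C_def)
  have "ennreal ((1 + norm w) ^ m * wabs \<alpha> f w) \<le> ennreal C * fs_norm p m \<alpha> f"
    if f: "entire f" for f :: "complex ^ 'n \<Rightarrow> complex" and w
  proof (cases "fs_norm p m \<alpha> f < \<infinity>")
    case True
    have "(1 + norm w) ^ m * wabs \<alpha> f w \<le> 3 ^ m * exp (\<alpha> * 18) * (C0 * enn2real (fs_norm p m \<alpha> f))"
      by (rule weighted_bound_extend_inside[OF f assms(1) _ C0[OF f True]]) (use \<open>C0 > 0\<close> in auto)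
    then have "ennreal ((1 + norm w) ^ m * wabs \<alpha> f w) \<le> ennreal (C * enn2real (fs_norm p m \<alpha> f))"
      by (intro ennreal_leI) (simp add: C_def mult.assoc)
    also have "\<dots> = ennreal C * fs_norm p m \<alpha> f"
      using \<open>C > 0\<close> True by (simp add: ennreal_mult)
    finally show ?thesis .
  next
    case False
    then have "fs_norm p m \<alpha> f = \<infinity>" by (simp add: less_top[symmetric])
    then show ?thesis using \<open>C > 0\<close> by (simp add: ennreal_mult_eq_top_iff)
  qed
  with \<open>C > 0\<close> show ?thesis by (rule that)
qed

section \<open>Membership in the Fock--Sobolev spaces and test functions\<close>

lemma decay_iff_wabs:
  "decay \<alpha> k g \<longleftrightarrow> entire g \<and> (\<exists>C. \<forall>z. (1 + norm z) ^ k * wabs \<alpha> g z \<le> C)"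
proof -
  have "(1 + norm z) ^ k * norm (g z) \<le> C * exp (\<alpha> / 2 * (norm z)\<^sup>2) \<longleftrightarrow>
      (1 + norm z) ^ k * wabs \<alpha> g z \<le> C" for z C
    by (simp add: wabs_def exp_minus divide_simps mult.assoc)
  then show ?thesis by (simp add: decay_def)
qed

lemma ennreal_cmult_less_top_iff: "c > 0 \<Longrightarrow> ennreal c * x < \<infinity> \<longleftrightarrow> x < \<infinity>"
  by (auto simp: ennreal_mult_less_top)

text \<open>
  For order \<open>0\<close> both norms are built from the same supremum or integral, up to positive constants.
\<close>

lemma fock_norm_finite_iff:
  fixes f :: "complex ^ 'n \<Rightarrow> complex"
  assumes "p > 0" "\<alpha> > 0"
  shows "fock_norm p \<alpha> f < \<infinity> \<longleftrightarrow> fs_norm p 0 \<alpha> f < \<infinity>"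
proof (cases "p = \<infinity>")
  case True
  show ?thesis unfolding True fs_norm_infinity by (simp add: fock_norm_def wabs_def)
next
  case False
  define q where "q = enn2real p"
  have "q > 0" using assms False by (simp add: q_def enn2real_positive_iff less_top)
  then have "(\<alpha> * q / (2 * pi)) ^ CARD('n) > 0" using assms by simp
  moreover have "fs_const q 0 \<alpha> CARD('n) > 0"
    using \<open>q > 0\<close> assms by (intro fs_const_pos) auto
  moreover have "fock_norm p \<alpha> f =
    ennreal_pow (ennreal ((\<alpha> * q / (2 * pi)) ^ CARD('n)) *
           (\<integral>\<^sup>+ z. ennreal (wabs \<alpha> f z powr q) \<partial>lborel)) (1 / q)"
    using False by (simp only: fock_norm_def exp_weight_powr q_def Let_def if_False)
  moreover have "fs_norm p 0 \<alpha> f =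
    ennreal_pow (ennreal (fs_const q 0 \<alpha> CARD('n)) *
           (\<integral>\<^sup>+ z. ennreal (wabs \<alpha> f z powr q) \<partial>lborel)) (1 / q)"
    using fs_norm_finite_eq[OF False, of 0 \<alpha> f] by (simp add: q_def)
  ultimately show ?thesis
    by (simp only: ennreal_pow_less_top_iff ennreal_cmult_less_top_iff)
qed

lemma fock_sobolev_iff:
  "f \<in> fock_sobolev p m \<alpha> \<longleftrightarrow>
     entire f \<and> (\<forall>\<beta>. (\<Sum>j\<in>UNIV. \<beta> j) \<le> m \<longrightarrow> fock_norm p \<alpha> (mpartial \<beta> f) < \<infinity>)"
  unfolding fock_sobolev_def by (simp add: finite_multiindices)

text \<open>
  Point evaluation turns the integrability of each derivative into a pointwise bound, and the bounds
  for all derivatives up to order \<open>m\<close> combine to the weight of order \<open>m\<close>.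
\<close>

lemma fock_sobolev_imp_decay:
  assumes "f \<in> fock_sobolev p m \<alpha>" "p > 0" "\<alpha> > 0"
  shows "decay \<alpha> m f"
proof (rule decay_of_mpartials[OF \<open>\<alpha> > 0\<close>])
  show f: "entire f" using assms(1) by (simp add: fock_sobolev_iff)
  fix \<beta> :: "'a \<Rightarrow> nat" assume "(\<Sum>j\<in>UNIV. \<beta> j) \<le> m"
  then have "fock_norm p \<alpha> (mpartial \<beta> f) < \<infinity>"
    using assms by (simp add: fock_sobolev_iff)
  then have fin: "fs_norm p 0 \<alpha> (mpartial \<beta> f) < \<infinity>"
    by (rule fock_norm_finite_iff[OF assms(2,3), THEN iffD1])
  have ent: "entire (mpartial \<beta> f)" by (rule entire_mpartial[OF f])
  obtain C where "C > 0" and C: "\<And>(f :: complex ^ 'a \<Rightarrow> complex) w. entire f \<Longrightarrow>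
    ennreal ((1 + norm w) ^ 0 * wabs \<alpha> f w) \<le> ennreal C * fs_norm p 0 \<alpha> f"
    using point_evaluation_bound[OF assms(3,2), of 0, where 'n = 'a] by blast
  have "(1 + norm w) ^ 0 * wabs \<alpha> (mpartial \<beta> f) w \<le> C * enn2real (fs_norm p 0 \<alpha> (mpartial \<beta> f))" for w
  proof -
    have "ennreal ((1 + norm w) ^ 0 * wabs \<alpha> (mpartial \<beta> f) w)
        \<le> ennreal C * ennreal (enn2real (fs_norm p 0 \<alpha> (mpartial \<beta> f)))"
      using C[OF ent, of w] fin by simp
    also have "\<dots> = ennreal (C * enn2real (fs_norm p 0 \<alpha> (mpartial \<beta> f)))"
      using \<open>C > 0\<close> by (simp add: ennreal_mult)
    finally show ?thesis using \<open>C > 0\<close> by simp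
  qed
  then show "decay \<alpha> 0 (mpartial \<beta> f)" unfolding decay_iff_wabs using ent by blast
qed

lemma fs_norm_infinity_le:
  "(\<And>z. norm z ^ m * wabs \<alpha> f z \<le> B) \<Longrightarrow> fs_norm \<infinity> m \<alpha> f \<le> ennreal B"
  unfolding fs_norm_infinity by (intro SUP_least ennreal_leI)

lemma decay_imp_fs_norm_finite:
  assumes "decay \<alpha> m f" shows "fs_norm \<infinity> m \<alpha> f < \<infinity>"
proof -
  obtain C where C: "\<And>z. (1 + norm z) ^ m * wabs \<alpha> f z \<le> C"
    using assms by (auto simp: decay_iff_wabs)
  have "fs_norm \<infinity> m \<alpha> f \<le> ennreal C"
  proof (rule fs_norm_infinity_le)
    fix z
    have "norm z ^ m * wabs \<alpha> f z \<le> (1 + norm z) ^ m * wabs \<alpha> f z"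
      by (intro mult_right_mono power_mono) auto
    with C[of z] show "norm z ^ m * wabs \<alpha> f z \<le> C" by linarith
  qed
  then show ?thesis by (simp add: le_less_trans)
qed

lemma fock_sobolev_infinity_iff_decay:
  assumes "\<alpha> > 0" shows "f \<in> fock_sobolev \<infinity> m \<alpha> \<longleftrightarrow> decay \<alpha> m f"
proof
  assume f: "decay \<alpha> m f"
  have "fock_norm \<infinity> \<alpha> (mpartial \<beta> f) < \<infinity>" if "(\<Sum>j\<in>UNIV. \<beta> j) \<le> m" for \<beta>
    by (rule fock_norm_finite_iff[THEN iffD2, OF _ assms
          decay_imp_fs_norm_finite[OF decay_mpartial[OF assms f that]]]) simp
  with f show "f \<in> fock_sobolev \<infinity> m \<alpha>"
    by (simp add: fock_sobolev_iff decay_def)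
next
  assume "f \<in> fock_sobolev \<infinity> m \<alpha>"
  then show "decay \<alpha> m f"
    by (rule fock_sobolev_imp_decay[OF _ _ assms]) (simp add: zero_less_iff_neq_zero)
qed

text \<open>
  From \<open>1 + x \<le> e\<^sup>x\<close> and, by completing the square, \<open>m x \<le> m\<^sup>2/\<alpha> + (\<alpha>/4) x\<^sup>2\<close>.
\<close>

lemma power_times_gauss_le:
  fixes x \<alpha> :: real
  assumes "\<alpha> > 0" "x \<ge> 0"
  shows "(1 + x) ^ m * exp (- (\<alpha> / 2) * x\<^sup>2) \<le> exp ((real m)\<^sup>2 / \<alpha>) * exp (- (\<alpha> / 4) * x\<^sup>2)"
proof -
  have "(1 + x) ^ m \<le> exp x ^ m"
    using assms by (intro power_mono exp_ge_add_one_self) auto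
  also have "\<dots> = exp (real m * x)" by (simp add: exp_of_nat_mult)
  also have "\<dots> \<le> exp ((real m)\<^sup>2 / \<alpha> + \<alpha> / 4 * x\<^sup>2)"
  proof -
    have "0 \<le> (\<alpha> * x / 2 - real m)\<^sup>2 / \<alpha>" using assms by simp
    also have "\<dots> = (real m)\<^sup>2 / \<alpha> + \<alpha> / 4 * x\<^sup>2 - real m * x"
      using assms by (simp add: power2_eq_square field_simps)
    finally show ?thesis by simp
  qed
  finally have "(1 + x) ^ m * exp (- (\<alpha> / 2) * x\<^sup>2)
      \<le> exp ((real m)\<^sup>2 / \<alpha> + \<alpha> / 4 * x\<^sup>2) * exp (- (\<alpha> / 2) * x\<^sup>2)"
    by (intro mult_right_mono) auto
  also have "\<dots> = exp ((real m)\<^sup>2 / \<alpha>) * exp (- (\<alpha> / 4) * x\<^sup>2)"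
    by (simp add: exp_add[symmetric] algebra_simps)
  finally show ?thesis .
qed

lemma nn_integral_gauss_real_finite:
  assumes "c > 0" shows "(\<integral>\<^sup>+ x. ennreal (exp (- c * x\<^sup>2)) \<partial>lborel) < \<infinity>"
proof -
  \<comment> \<open>The variance of the normal density proportional to \<open>exp (-c x\<^sup>2)\<close>.\<close>
  define \<sigma> where "\<sigma> = sqrt (1 / (2 * c))"
  have "\<sigma> > 0" "\<sigma>\<^sup>2 = 1 / (2 * c)" using assms by (auto simp: \<sigma>_def)
  then have "exp (- c * x\<^sup>2) = sqrt (2 * pi * \<sigma>\<^sup>2) * normal_density 0 \<sigma> x" for x
    using assms by (simp add: normal_density_def)
  moreover have "integrable lborel (\<lambda>x. sqrt (2 * pi * \<sigma>\<^sup>2) * normal_density 0 \<sigma> x)"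
    using \<open>\<sigma> > 0\<close> by (intro integrable_mult_right integrable_normal_density)
  ultimately have "integrable lborel (\<lambda>x. exp (- c * x\<^sup>2))" by simp
  from nn_integral_eq_integral[OF this] show ?thesis by simp
qed

lemma nn_integral_gauss_finite:
  assumes "c > 0"
  shows "(\<integral>\<^sup>+ x. ennreal (exp (- c * (norm x)\<^sup>2)) \<partial>(lborel :: 'a :: euclidean_space measure)) < \<infinity>"
proof -
  have "ennreal (exp (- c * (norm x)\<^sup>2)) = (\<Prod>b\<in>Basis. ennreal (exp (- c * (x \<bullet> b)\<^sup>2)))" for x :: 'a
  proof -
    have "(norm x)\<^sup>2 = (\<Sum>b\<in>Basis. (x \<bullet> b)\<^sup>2)"
      unfolding power2_norm_eq_inner by (subst euclidean_inner) (simp add: power2_eq_square)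
    then have "exp (- c * (norm x)\<^sup>2) = (\<Prod>b\<in>Basis. exp (- c * (x \<bullet> b)\<^sup>2))"
      by (simp add: sum_distrib_left sum_negf[symmetric] exp_sum)
    then show ?thesis by (simp add: prod_ennreal)
  qed
  then have "(\<integral>\<^sup>+ x. ennreal (exp (- c * (norm x)\<^sup>2)) \<partial>(lborel :: 'a measure))
      = (\<integral>\<^sup>+ x. (\<Prod>b\<in>Basis. ennreal (exp (- c * (x \<bullet> b)\<^sup>2))) \<partial>(lborel :: 'a measure))"
    by (simp only:)
  also have "\<dots> = (\<Prod>b\<in>(Basis :: 'a set). (\<integral>\<^sup>+ x. ennreal (exp (- c * x\<^sup>2)) \<partial>lborel))"
    by (rule nn_integral_lborel_prod) auto
  also have "\<dots> < \<infinity>"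
    using nn_integral_gauss_real_finite[OF assms] by (simp add: power_less_top_ennreal)
  finally show ?thesis .
qed

lemma nn_integral_power_gauss_finite:
  assumes "\<alpha> > 0" "q > 0"
  shows "(\<integral>\<^sup>+ x. ennreal (((1 + norm x) ^ m * exp (- (\<alpha> / 2) * (norm x)\<^sup>2)) powr q)
    \<partial>(lborel :: 'a :: euclidean_space measure)) < \<infinity>"
proof -
  have "(\<integral>\<^sup>+ x. ennreal (((1 + norm x) ^ m * exp (- (\<alpha> / 2) * (norm x)\<^sup>2)) powr q) \<partial>(lborel :: 'a measure))
      \<le> (\<integral>\<^sup>+ x. ennreal (exp ((real m)\<^sup>2 / \<alpha>) powr q) * ennreal (exp (- (\<alpha> * q / 4) * (norm x)\<^sup>2)) \<partial>(lborel :: 'a measure))"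
  proof (intro nn_integral_mono)
    fix x :: 'a
    have "((1 + norm x) ^ m * exp (- (\<alpha> / 2) * (norm x)\<^sup>2)) powr q
        \<le> (exp ((real m)\<^sup>2 / \<alpha>) * exp (- (\<alpha> / 4) * (norm x)\<^sup>2)) powr q"
      using assms by (intro powr_mono2 power_times_gauss_le) auto
    also have "\<dots> = exp ((real m)\<^sup>2 / \<alpha>) powr q * exp (- (\<alpha> * q / 4) * (norm x)\<^sup>2)"
      by (simp add: powr_mult exp_powr_real mult_ac)
    finally show "ennreal (((1 + norm x) ^ m * exp (- (\<alpha> / 2) * (norm x)\<^sup>2)) powr q)
        \<le> ennreal (exp ((real m)\<^sup>2 / \<alpha>) powr q) * ennreal (exp (- (\<alpha> * q / 4) * (norm x)\<^sup>2))"
      by (simp add: ennreal_mult[symmetric])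
  qed
  also have "\<dots> = ennreal (exp ((real m)\<^sup>2 / \<alpha>) powr q) *
      (\<integral>\<^sup>+ x. ennreal (exp (- (\<alpha> * q / 4) * (norm x)\<^sup>2)) \<partial>(lborel :: 'a measure))"
    by (rule nn_integral_cmult) measurable
  also have "\<dots> < \<infinity>"
    using nn_integral_gauss_finite[of "\<alpha> * q / 4", where 'a = 'a] assms
    by (simp add: ennreal_mult_less_top)
  finally show ?thesis .
qed

text \<open>
  The reproducing kernel at \<open>w\<close> of the Fock space of order \<open>0\<close>, normalised and divided by
  \<open>(1 + |w|)\<^sup>m\<close>.  Its weighted modulus is \<open>exp (-\<alpha>/2 |z - w|\<^sup>2) / (1 + |w|)\<^sup>m\<close>, a Gaussian centred
  at \<open>w\<close>.
\<close>

definition scaled_kernel :: "real \<Rightarrow> nat \<Rightarrow> complex ^ 'n \<Rightarrow> complex ^ 'n \<Rightarrow> complex" where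
  "scaled_kernel \<alpha> m w z = of_real (exp (- (\<alpha> / 2) * (norm w)\<^sup>2) / (1 + norm w) ^ m) * exp (of_real \<alpha> * cdot z w)"

lemma wabs_exp_cdot:
  "wabs \<alpha> (\<lambda>z. c * exp (of_real \<alpha> * cdot z w)) z
    = norm c * exp (\<alpha> / 2 * (norm w)\<^sup>2) * exp (- (\<alpha> / 2) * (norm (z - w))\<^sup>2)"
proof -
  have eq: "(norm (z - w))\<^sup>2 = (norm z)\<^sup>2 + (norm w)\<^sup>2 - 2 * (z \<bullet> w)"
    by (simp add: power2_norm_eq_inner inner_simps inner_commute)
  have "\<alpha> * (z \<bullet> w) + - (\<alpha> / 2) * (norm z)\<^sup>2
      = \<alpha> / 2 * (norm w)\<^sup>2 + - (\<alpha> / 2) * (norm (z - w))\<^sup>2"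
    unfolding eq by (simp add: algebra_simps)
  then have "exp (\<alpha> * (z \<bullet> w)) * exp (- (\<alpha> / 2) * (norm z)\<^sup>2)
      = exp (\<alpha> / 2 * (norm w)\<^sup>2) * exp (- (\<alpha> / 2) * (norm (z - w))\<^sup>2)"
    by (simp only: exp_add[symmetric])
  then show ?thesis unfolding wabs_def norm_mult norm_exp_cdot by (simp only: mult.assoc)
qed

lemma wabs_scaled_kernel:
  "wabs \<alpha> (\<lambda>z. of_real c * scaled_kernel \<alpha> m w z) z = \<bar>c\<bar> * exp (- (\<alpha> / 2) * (norm (z - w))\<^sup>2) / (1 + norm w) ^ m"
proof -
  have "wabs \<alpha> (\<lambda>z. of_real c * scaled_kernel \<alpha> m w z) z =
    wabs \<alpha> (\<lambda>z. of_real (c * (exp (- (\<alpha> / 2) * (norm w)\<^sup>2) / (1 + norm w) ^ m)) * exp (of_real \<alpha> * cdot z w)) z"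
    by (simp add: scaled_kernel_def[abs_def] mult.assoc)
  also have "\<dots> = \<bar>c\<bar> * exp (- (\<alpha> / 2) * (norm (z - w))\<^sup>2) / (1 + norm w) ^ m"
    unfolding wabs_exp_cdot norm_of_real by (simp add: abs_mult exp_minus field_simps)
  finally show ?thesis .
qed

text \<open>
  The bound depends on \<open>z - w\<close> only, because \<open>|z| \<le> (1 + |w|) (1 + |z - w|)\<close>.  This is what makes the
  norms of the scaled kernels uniformly bounded in \<open>w\<close>.
\<close>

lemma scaled_kernel_weight_le:
  "norm z ^ m * wabs \<alpha> (\<lambda>z. of_real c * scaled_kernel \<alpha> m w z) z
    \<le> \<bar>c\<bar> * ((1 + norm (z - w)) ^ m * exp (- (\<alpha> / 2) * (norm (z - w))\<^sup>2))"
proof -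
  have "norm z \<le> norm w + norm (z - w)" by (rule norm_triangle_sub)
  also have "\<dots> \<le> (1 + norm w) * (1 + norm (z - w))"
    by (simp add: algebra_simps)
  finally have "norm z ^ m \<le> ((1 + norm w) * (1 + norm (z - w))) ^ m"
    by (intro power_mono) auto
  then have "norm z ^ m \<le> (1 + norm w) ^ m * (1 + norm (z - w)) ^ m"
    by (simp only: power_mult_distrib)
  moreover have "(1 + norm w) ^ m > 0" by (intro zero_less_power add_pos_nonneg) auto
  ultimately have "norm z ^ m / (1 + norm w) ^ m \<le> (1 + norm (z - w)) ^ m"
    by (simp add: pos_divide_le_eq mult.commute)
  then have "\<bar>c\<bar> * exp (- (\<alpha> / 2) * (norm (z - w))\<^sup>2) * (norm z ^ m / (1 + norm w) ^ m)
      \<le> \<bar>c\<bar> * exp (- (\<alpha> / 2) * (norm (z - w))\<^sup>2) * (1 + norm (z - w)) ^ m"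
    by (intro mult_left_mono) auto
  then show ?thesis by (simp add: wabs_scaled_kernel mult_ac)
qed

lemma partial_exp_cdot:
  "partial j (\<lambda>z. c * exp (a * cdot z w)) = (\<lambda>z. (c * a * cnj (w $ j)) * exp (a * cdot z w))"
proof
  fix z
  have "((\<lambda>z. c * exp (a * cdot z w)) has_derivative (\<lambda>h. c * (exp (a * cdot z w) * (a * cdot h w)))) (at z)"
    by (intro has_derivative_mult_right exp_cdot_has_derivative)
  then have "dirderiv (\<lambda>z. c * exp (a * cdot z w)) z = (\<lambda>h. c * (exp (a * cdot z w) * (a * cdot h w)))"
    by (rule complex_linear_derivative_eq_dirderiv) (simp add: cdot_scale mult_ac)
  moreover have "cdot (axis j 1) w = cnj (w $ j)"
    by (simp add: cdot_def axis_def if_distrib[of "\<lambda>x. x * _"] cong: if_cong)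
  ultimately show "partial j (\<lambda>z. c * exp (a * cdot z w)) z = (c * a * cnj (w $ j)) * exp (a * cdot z w)"
    by (simp add: partial_eq_dirderiv mult_ac)
qed

text \<open>
  Differentiation only multiplies an exponential by a constant, so the derivatives of a kernel
  satisfy the same integrability conditions as the kernel.
\<close>

lemma mpartial_exp_cdot:
  "\<exists>c'. mpartial \<beta> (\<lambda>z. c * exp (a * cdot z w)) = (\<lambda>z. c' * exp (a * cdot z w))"
proof -
  have pow: "\<exists>c'. (partial j ^^ k) (\<lambda>z. c * exp (a * cdot z w)) = (\<lambda>z. c' * exp (a * cdot z w))" for j k c
    by (induction k) (auto simp: partial_exp_cdot)
  have "\<exists>c'. foldr (\<lambda>j. partial j ^^ \<beta> j) js (\<lambda>z. c * exp (a * cdot z w)) = (\<lambda>z. c' * exp (a * cdot z w))" for js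
    by (induction js) (auto simp: pow)
  then show ?thesis unfolding mpartial_def .
qed

lemma fs_norm_exp_cdot_finite:
  fixes w :: "complex ^ 'n"
  assumes "\<alpha> > 0" "p > 0"
  shows "fs_norm p 0 \<alpha> (\<lambda>z. c * exp (of_real \<alpha> * cdot z w)) < \<infinity>"
proof (cases "p = \<infinity>")
  case True
  have "fs_norm \<infinity> 0 \<alpha> (\<lambda>z. c * exp (of_real \<alpha> * cdot z w)) \<le> ennreal (norm c * exp (\<alpha> / 2 * (norm w)\<^sup>2))"
    by (rule fs_norm_infinity_le) (use assms in \<open>auto simp: wabs_exp_cdot intro!: mult_left_le\<close>)
  then show ?thesis using True by (simp add: le_less_trans)
next
  case False
  define q where "q = enn2real p"
  have "q > 0" using assms False by (simp add: q_def enn2real_positive_iff less_top)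
  define b where "b = norm c * exp (\<alpha> / 2 * (norm w)\<^sup>2)"
  have "b \<ge> 0" by (simp add: b_def)
  define h where "h v = ennreal (((1 + norm v) ^ 0 * exp (- (\<alpha> / 2) * (norm v)\<^sup>2)) powr q)" for v :: "complex ^ 'n"
  have h: "h \<in> borel_measurable borel" unfolding h_def by measurable
  have "(\<integral>\<^sup>+ z. ennreal ((norm z ^ 0 * wabs \<alpha> (\<lambda>z. c * exp (of_real \<alpha> * cdot z w)) z) powr q) \<partial>lborel)
     = (\<integral>\<^sup>+ z. ennreal (b powr q) * h (- w + z) \<partial>lborel)"
    unfolding wabs_exp_cdot b_def[symmetric]
    using \<open>b \<ge> 0\<close> by (simp add: h_def powr_mult ennreal_mult)
  also have "\<dots> = ennreal (b powr q) * (\<integral>\<^sup>+ z. h (- w + z) \<partial>lborel)"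
    by (rule nn_integral_cmult) (use h in measurable)
  also have "(\<integral>\<^sup>+ z. h (- w + z) \<partial>lborel) = (\<integral>\<^sup>+ z. h z \<partial>lborel)"
    by (rule nn_integral_lborel_translate[OF h])
  also have "ennreal (b powr q) * \<dots> < \<infinity>"
    unfolding h_def using nn_integral_power_gauss_finite[OF \<open>\<alpha> > 0\<close> \<open>q > 0\<close>, of 0, where 'a = "complex ^ 'n"]
    by (simp add: ennreal_mult_less_top)
  finally have "ennreal (fs_const q 0 \<alpha> CARD('n)) * (\<integral>\<^sup>+ z. ennreal ((norm z ^ 0 *
      wabs \<alpha> (\<lambda>z. c * exp (of_real \<alpha> * cdot z w)) z) powr q) \<partial>lborel) < \<infinity>"
    by (intro ennreal_cmult_less_top_iff[THEN iffD2] fs_const_pos \<open>q > 0\<close> \<open>\<alpha> > 0\<close>) auto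
  then show ?thesis unfolding fs_norm_finite_eq[OF False] ennreal_pow_less_top_iff q_def .
qed

lemma scaled_kernel_in_fock_sobolev:
  assumes "\<alpha> > 0" "p > 0"
  shows "(\<lambda>z. of_real c * scaled_kernel \<alpha> m w z) \<in> fock_sobolev p l \<alpha>"
proof -
  let ?b = "of_real c * of_real (exp (- (\<alpha> / 2) * (norm w)\<^sup>2) / (1 + norm w) ^ m) :: complex"
  have eq: "(\<lambda>z. of_real c * scaled_kernel \<alpha> m w z) = (\<lambda>z. ?b * exp (of_real \<alpha> * cdot z w))"
    by (simp add: scaled_kernel_def fun_eq_iff)
  have "fock_norm p \<alpha> (mpartial \<beta> (\<lambda>z. ?b * exp (of_real \<alpha> * cdot z w))) < \<infinity>" for \<beta>
    using mpartial_exp_cdot[of \<beta> ?b "of_real \<alpha>" w] fs_norm_exp_cdot_finite[OF assms]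
    by (metis fock_norm_finite_iff[OF assms(2,1)])
  moreover have "entire (\<lambda>z. ?b * exp (of_real \<alpha> * cdot z w))"
    by (intro entire_cmult entire_exp_cdot)
  ultimately show ?thesis unfolding eq fock_sobolev_iff by blast
qed

text \<open>
  One constant serves all \<open>w\<close>: the weight bound is a function of \<open>z - w\<close>, and Lebesgue measure is
  translation invariant.
\<close>

lemma scaled_kernel_in_unit_ball:
  assumes "\<alpha> > 0" "p > 0"
  obtains c where "c > 0" "\<And>w :: complex ^ 'n. (\<lambda>z. of_real c * scaled_kernel \<alpha> m w z) \<in> unit_ball p m \<alpha>"
proof -
  have "\<exists>c>0. \<forall>w :: complex ^ 'n. fs_norm p m \<alpha> (\<lambda>z. of_real c * scaled_kernel \<alpha> m w z) \<le> 1"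
  proof (cases "p = \<infinity>")
    case True
    define c where "c = exp (- ((real m)\<^sup>2 / \<alpha>))"
    have "fs_norm \<infinity> m \<alpha> (\<lambda>z. of_real c * scaled_kernel \<alpha> m w z) \<le> ennreal 1" for w :: "complex ^ 'n"
    proof (rule fs_norm_infinity_le)
      fix z
      have "norm z ^ m * wabs \<alpha> (\<lambda>z. of_real c * scaled_kernel \<alpha> m w z) z
          \<le> \<bar>c\<bar> * (exp ((real m)\<^sup>2 / \<alpha>) * exp (- (\<alpha> / 4) * (norm (z - w))\<^sup>2))"
        by (rule order_trans[OF scaled_kernel_weight_le])
           (intro mult_left_mono power_times_gauss_le; use assms in simp)
      also have "\<dots> = exp (- (\<alpha> / 4) * (norm (z - w))\<^sup>2)"
        by (simp add: c_def exp_minus)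
      also have "\<dots> \<le> 1" using assms by simp
      finally show "norm z ^ m * wabs \<alpha> (\<lambda>z. of_real c * scaled_kernel \<alpha> m w z) z \<le> 1" .
    qed
    then show ?thesis using True by (intro exI[of _ c]) (simp add: c_def)
  next
    case False
    define q where "q = enn2real p"
    have "q > 0" using assms False by (simp add: q_def enn2real_positive_iff less_top)
    define K where "K = fs_const q m \<alpha> CARD('n)"
    have "K > 0" unfolding K_def using \<open>q > 0\<close> assms by (intro fs_const_pos) auto
    define h where "h v = ennreal (((1 + norm v) ^ m * exp (- (\<alpha> / 2) * (norm v)\<^sup>2)) powr q)" for v :: "complex ^ 'n"
    have h: "h \<in> borel_measurable borel" unfolding h_def by measurable
    have "(\<integral>\<^sup>+ v. h v \<partial>lborel) < \<infinity>"
      unfolding h_def by (rule nn_integral_power_gauss_finite[OF \<open>\<alpha> > 0\<close> \<open>q > 0\<close>])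
    then obtain G where G: "(\<integral>\<^sup>+ v. h v \<partial>lborel) = ennreal G" "G \<ge> 0"
      by (cases "\<integral>\<^sup>+ v. h v \<partial>lborel") auto
    \<comment> \<open>With this \<open>c\<close> the normalised integral is at most \<open>G / (G + 1)\<close>; the shift by \<open>1\<close> avoids dividing by zero.\<close>
    define c where "c = (1 / (K * (G + 1))) powr (1 / q)"
    have "c > 0" using \<open>K > 0\<close> \<open>G \<ge> 0\<close> by (simp add: c_def)
    have cq: "c powr q = 1 / (K * (G + 1))"
      using \<open>K > 0\<close> \<open>G \<ge> 0\<close> \<open>q > 0\<close> by (simp add: c_def powr_powr)
    have "fs_norm p m \<alpha> (\<lambda>z. of_real c * scaled_kernel \<alpha> m w z) \<le> 1" for w :: "complex ^ 'n"
    proof -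
      let ?f = "\<lambda>z. of_real c * scaled_kernel \<alpha> m w z"
      have "(\<integral>\<^sup>+ z. ennreal ((norm z ^ m * wabs \<alpha> ?f z) powr q) \<partial>lborel)
          \<le> (\<integral>\<^sup>+ z. ennreal (c powr q) * h (- w + z) \<partial>lborel)"
      proof (intro nn_integral_mono)
        fix z
        have "(norm z ^ m * wabs \<alpha> ?f z) powr q
            \<le> (\<bar>c\<bar> * ((1 + norm (z - w)) ^ m * exp (- (\<alpha> / 2) * (norm (z - w))\<^sup>2))) powr q"
          using \<open>q > 0\<close> by (intro powr_mono2 scaled_kernel_weight_le) auto
        also have "\<dots> = c powr q * ((1 + norm (z - w)) ^ m * exp (- (\<alpha> / 2) * (norm (z - w))\<^sup>2)) powr q"
          using \<open>c > 0\<close> by (subst powr_mult) auto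
        finally show "ennreal ((norm z ^ m * wabs \<alpha> ?f z) powr q) \<le> ennreal (c powr q) * h (- w + z)"
          by (simp add: h_def ennreal_mult[symmetric])
      qed
      also have "\<dots> = ennreal (c powr q) * (\<integral>\<^sup>+ z. h (- w + z) \<partial>lborel)"
        by (rule nn_integral_cmult) (use h in measurable)
      also have "\<dots> = ennreal (c powr q * G)"
        unfolding nn_integral_lborel_translate[OF h] G(1) using G(2) by (simp add: ennreal_mult)
      finally have "ennreal K * (\<integral>\<^sup>+ z. ennreal ((norm z ^ m * wabs \<alpha> ?f z) powr q) \<partial>lborel)
          \<le> ennreal K * ennreal (c powr q * G)" by (rule mult_left_mono) simp
      also have "\<dots> = ennreal (G / (G + 1))"
        using \<open>K > 0\<close> \<open>G \<ge> 0\<close> by (simp add: cq ennreal_mult[symmetric])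
      finally have *: "ennreal K * (\<integral>\<^sup>+ z. ennreal ((norm z ^ m * wabs \<alpha> ?f z) powr q) \<partial>lborel)
          \<le> ennreal (G / (G + 1))" (is "?x \<le> _") .
      have "?x \<noteq> \<infinity>" using * by (auto simp: top_unique)
      moreover have "enn2real ?x \<le> 1"
      proof -
        have "enn2real ?x \<le> G / (G + 1)" using enn2real_mono[OF *] \<open>G \<ge> 0\<close> by simp
        also have "\<dots> \<le> 1" using \<open>G \<ge> 0\<close> by simp
        finally show ?thesis .
      qed
      ultimately have "ennreal_pow ?x (1 / q) \<le> 1"
        using \<open>q > 0\<close> by (simp add: ennreal_pow_def powr_le1)
      then show ?thesis
        unfolding fs_norm_finite_eq[OF False] by (simp add: K_def q_def)
    qed
    with \<open>c > 0\<close> show ?thesis by blast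
  qed
  then show ?thesis using that scaled_kernel_in_fock_sobolev[OF assms] unfolding unit_ball_def by blast
qed

section \<open>Boundedness\<close>

text \<open>
  The identity that defines \<^const>\<open>berezin\<close>: it is the factor between the weight of the target
  space at \<open>z\<close> and the full weight of the source space at \<open>\<psi> z\<close>.
\<close>

lemma wabs_wcomp:
  "norm z ^ m * wabs \<alpha> (wcomp u \<psi> f) z
    = berezin m \<alpha> u \<psi> z * ((1 + norm (\<psi> z)) ^ m * wabs \<alpha> f (\<psi> z))"
proof -
  have "1 + norm (\<psi> z) > 0" by (simp add: add_pos_nonneg)
  then have "(1 + norm (\<psi> z)) ^ m \<noteq> 0" by simp
  moreover have "exp (- (\<alpha> / 2) * (norm z)\<^sup>2)
      = exp (\<alpha> / 2 * ((norm (\<psi> z))\<^sup>2 - (norm z)\<^sup>2)) * exp (- (\<alpha> / 2) * (norm (\<psi> z))\<^sup>2)"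
    by (simp add: exp_add[symmetric] algebra_simps)
  ultimately show ?thesis
    by (simp add: berezin_def wabs_def wcomp_def norm_mult del: power_eq_0_iff)
qed

lemma berezin_eq_scaled_kernel:
  assumes "c \<ge> 0"
  shows "norm z ^ m * wabs \<alpha> (wcomp u \<psi> (\<lambda>v. of_real c * scaled_kernel \<alpha> m (\<psi> z) v)) z = c * berezin m \<alpha> u \<psi> z"
proof -
  have "1 + norm (\<psi> z) > 0" by (simp add: add_pos_nonneg)
  then have "(1 + norm (\<psi> z)) ^ m \<noteq> 0" by simp
  with assms show ?thesis unfolding wabs_wcomp wabs_scaled_kernel by simp
qed

lemma berezin_nonneg [simp]: "berezin m \<alpha> u \<psi> z \<ge> 0"
  by (simp add: berezin_def)

lemma berezin_continuous_on:
  assumes "entire u" "entire_map \<psi>"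
  shows "continuous_on UNIV (berezin m \<alpha> u \<psi>)"
  unfolding berezin_def
proof (intro continuous_intros entire_continuous_on entire_map_continuous_on assms ballI)
  fix z
  have "1 + norm (\<psi> z) > 0" by (simp add: add_pos_nonneg)
  then show "(1 + norm (\<psi> z)) ^ m \<noteq> 0" by simp
qed

text \<open>
  For a continuous function the set where a bound holds is closed, and a closed set of full measure
  is everything.
\<close>

lemma continuous_le_Linf_norm:
  fixes F :: "complex ^ 'n \<Rightarrow> real"
  assumes "continuous_on UNIV F"
  shows "ennreal \<bar>F z\<bar> \<le> Linf_norm F"
proof (cases "Linf_norm F")
  case (real l)
  have "AE x in lborel. ennreal \<bar>F x\<bar> \<le> Linf_norm F"
    unfolding Linf_norm_def by (rule esssup_AE)
  then have "AE x in lborel. x \<in> {x. \<bar>F x\<bar> \<le> l}" using real by simp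
  then have "AE x in lebesgue. x \<in> {x. \<bar>F x\<bar> \<le> l}" by (rule AE_completion)
  moreover have "closed {x. \<bar>F x\<bar> \<le> l}"
    by (intro closed_Collect_le continuous_intros assms)
  ultimately have "z \<in> {x. \<bar>F x\<bar> \<le> l}"
    by (intro mem_closed_if_AE_lebesgue)
  then show ?thesis using real by (simp add: ennreal_leI)
qed simp

lemma Linf_norm_le:
  assumes "continuous_on UNIV F" "\<And>z. ennreal \<bar>F z\<bar> \<le> B"
  shows "Linf_norm F \<le> B"
proof -
  have "F \<in> borel_measurable borel" by (rule borel_measurable_continuous_onI[OF assms(1)])
  then have "(\<lambda>z. ennreal \<bar>F z\<bar>) \<in> borel_measurable lborel" by measurable
  then show ?thesis unfolding Linf_norm_def by (rule esssup_I) (use assms in auto)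
qed

lemma Linf_iff_bounded:
  fixes F :: "complex ^ 'n \<Rightarrow> real"
  assumes "continuous_on UNIV F" "\<And>z. F z \<ge> 0"
  shows "F \<in> Linf \<longleftrightarrow> (\<exists>B. \<forall>z. F z \<le> B)"
proof
  assume "F \<in> Linf"
  then have "Linf_norm F < \<infinity>" by (simp add: Linf_def)
  then obtain B where "Linf_norm F = ennreal B" "B \<ge> 0" by (cases "Linf_norm F") auto
  then have "F z \<le> B" for z
    using continuous_le_Linf_norm[OF assms(1), of z] assms(2)[of z] by simp
  then show "\<exists>B. \<forall>z. F z \<le> B" by blast
next
  assume "\<exists>B. \<forall>z. F z \<le> B"
  then obtain B where "\<And>z. F z \<le> B" by blast
  then have "Linf_norm F \<le> ennreal B"
    using assms by (intro Linf_norm_le ennreal_leI) auto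
  then have "Linf_norm F < \<infinity>" by (simp add: le_less_trans)
  moreover have "F \<in> borel_measurable lborel"
    using borel_measurable_continuous_onI[OF assms(1)] by simp
  ultimately show "F \<in> Linf" by (simp add: Linf_def)
qed

lemma decay_iff_fs_norm_finite:
  fixes g :: "complex ^ 'n \<Rightarrow> complex"
  assumes "\<alpha> > 0" "entire g"
  shows "decay \<alpha> m g \<longleftrightarrow> fs_norm \<infinity> m \<alpha> g < \<infinity>"
proof
  assume fin: "fs_norm \<infinity> m \<alpha> g < \<infinity>"
  obtain C where "C > 0" and C: "\<And>(f :: complex ^ 'n \<Rightarrow> complex) w. entire f \<Longrightarrow>
      ennreal ((1 + norm w) ^ m * wabs \<alpha> f w) \<le> ennreal C * fs_norm \<infinity> m \<alpha> f"
    using point_evaluation_bound[OF assms(1), of \<infinity> m, where 'n = 'n] by (auto simp: zero_less_iff_neq_zero)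
  obtain X where X: "fs_norm \<infinity> m \<alpha> g = ennreal X" "X \<ge> 0"
    using fin by (cases "fs_norm \<infinity> m \<alpha> g") auto
  have "(1 + norm w) ^ m * wabs \<alpha> g w \<le> C * X" for w
    using C[OF assms(2), of w] X \<open>C > 0\<close> by (simp add: ennreal_mult[symmetric])
  then show "decay \<alpha> m g" unfolding decay_iff_wabs using assms by blast
qed (rule decay_imp_fs_norm_finite)

text \<open>
  Test the operator on the scaled kernel at \<open>\<psi> z\<close>.
\<close>

lemma berezin_le_op_norm:
  assumes "\<alpha> > 0" "p > 0"
  obtains c where "c > 0" "\<And>(u :: complex ^ 'n \<Rightarrow> complex) \<psi> z.
    ennreal (c * berezin m \<alpha> u \<psi> z) \<le> op_norm p m \<alpha> (wcomp u \<psi>)"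
proof -
  obtain c where "c > 0" and c: "\<And>w :: complex ^ 'n. (\<lambda>z. of_real c * scaled_kernel \<alpha> m w z) \<in> unit_ball p m \<alpha>"
    using scaled_kernel_in_unit_ball[OF assms, of m, where 'n = 'n] by blast
  have "ennreal (c * berezin m \<alpha> u \<psi> z) \<le> op_norm p m \<alpha> (wcomp u \<psi>)"
    for u :: "complex ^ 'n \<Rightarrow> complex" and \<psi> z
  proof -
    let ?f = "\<lambda>v. of_real c * scaled_kernel \<alpha> m (\<psi> z) v"
    have "ennreal (c * berezin m \<alpha> u \<psi> z) = ennreal (norm z ^ m * wabs \<alpha> (wcomp u \<psi> ?f) z)"
      using \<open>c > 0\<close> by (simp only: berezin_eq_scaled_kernel less_imp_le)
    also have "\<dots> \<le> fs_norm \<infinity> m \<alpha> (wcomp u \<psi> ?f)"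
      unfolding fs_norm_infinity by (rule SUP_upper) simp
    also have "\<dots> \<le> op_norm p m \<alpha> (wcomp u \<psi>)"
      unfolding op_norm_def by (rule SUP_upper[OF c])
    finally show ?thesis .
  qed
  with \<open>c > 0\<close> show ?thesis by (rule that)
qed

lemma fs_norm_wcomp_le:
  assumes "\<alpha> > 0" "p > 0"
  obtains C where "C > 0" "\<And>(u :: complex ^ 'n \<Rightarrow> complex) \<psi> f B. entire f \<Longrightarrow>
    (\<And>z. berezin m \<alpha> u \<psi> z \<le> B) \<Longrightarrow>
    fs_norm \<infinity> m \<alpha> (wcomp u \<psi> f) \<le> ennreal (C * B) * fs_norm p m \<alpha> f"
proof -
  obtain C where "C > 0" and C: "\<And>(f :: complex ^ 'n \<Rightarrow> complex) w. entire f \<Longrightarrow>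
      ennreal ((1 + norm w) ^ m * wabs \<alpha> f w) \<le> ennreal C * fs_norm p m \<alpha> f"
    using point_evaluation_bound[OF assms, of m, where 'n = 'n] by blast
  have "fs_norm \<infinity> m \<alpha> (wcomp u \<psi> f) \<le> ennreal (C * B) * fs_norm p m \<alpha> f"
    if f: "entire f" and B: "\<And>z. berezin m \<alpha> u \<psi> z \<le> B"
    for u :: "complex ^ 'n \<Rightarrow> complex" and \<psi> f B
    unfolding fs_norm_infinity
  proof (rule SUP_least)
    fix z
    have "B \<ge> 0" using B[of z] berezin_nonneg[of m \<alpha> u \<psi> z] by linarith
    have "ennreal (norm z ^ m * wabs \<alpha> (wcomp u \<psi> f) z)
        = ennreal (berezin m \<alpha> u \<psi> z) * ennreal ((1 + norm (\<psi> z)) ^ m * wabs \<alpha> f (\<psi> z))"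
      unfolding wabs_wcomp by (simp add: ennreal_mult)
    also have "\<dots> \<le> ennreal B * (ennreal C * fs_norm p m \<alpha> f)"
      by (intro mult_mono ennreal_leI B C f) auto
    also have "\<dots> = ennreal (C * B) * fs_norm p m \<alpha> f"
      using \<open>B \<ge> 0\<close> \<open>C > 0\<close> by (simp add: ennreal_mult mult_ac)
    finally show "ennreal (norm z ^ m * wabs \<alpha> (wcomp u \<psi> f) z) \<le> ennreal (C * B) * fs_norm p m \<alpha> f" .
  qed
  with \<open>C > 0\<close> show ?thesis by (rule that)
qed

text \<open>
  The argument uses the pointwise decay of \<open>f\<close>, which membership provides directly, rather than the
  weighted norm of \<open>f\<close>, whose finiteness is not part of the definition of the space.
\<close>

lemma wcomp_maps_fock_sobolev:
  assumes "\<alpha> > 0" "p > 0" "entire u" "entire_map \<psi>" "\<And>z. berezin m \<alpha> u \<psi> z \<le> B"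
    and f: "f \<in> fock_sobolev p m \<alpha>"
  shows "wcomp u \<psi> f \<in> fock_sobolev \<infinity> m \<alpha>"
proof -
  have dec: "decay \<alpha> m f" by (rule fock_sobolev_imp_decay[OF f assms(2,1)])
  then obtain C where C: "\<And>z. (1 + norm z) ^ m * wabs \<alpha> f z \<le> C" and "entire f"
    by (auto simp: decay_iff_wabs)
  have "fs_norm \<infinity> m \<alpha> (wcomp u \<psi> f) \<le> ennreal (B * C)"
  proof (rule fs_norm_infinity_le)
    fix z
    have "B \<ge> 0" using assms(5)[of z] berezin_nonneg[of m \<alpha> u \<psi> z] by linarith
    then show "norm z ^ m * wabs \<alpha> (wcomp u \<psi> f) z \<le> B * C"
      unfolding wabs_wcomp by (intro mult_mono assms(5) C) auto
  qed
  then have "fs_norm \<infinity> m \<alpha> (wcomp u \<psi> f) < \<infinity>" by (simp add: le_less_trans)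
  then show ?thesis
    using fock_sobolev_infinity_iff_decay[OF assms(1)]
      decay_iff_fs_norm_finite[OF assms(1) entire_wcomp[OF assms(3,4) \<open>entire f\<close>]] by blast
qed

lemma op_norm_le_bounded:
  fixes T :: "(complex ^ 'n \<Rightarrow> complex) \<Rightarrow> complex ^ 'n \<Rightarrow> complex"
  assumes "\<And>f. f \<in> fock_sobolev p m \<alpha> \<Longrightarrow> fs_norm \<infinity> m \<alpha> (T f) \<le> ennreal C * fs_norm p m \<alpha> f"
  shows "op_norm p m \<alpha> T \<le> ennreal C"
  unfolding op_norm_def
proof (rule SUP_least)
  fix f :: "complex ^ 'n \<Rightarrow> complex" assume "f \<in> unit_ball p m \<alpha>"
  then have f: "f \<in> fock_sobolev p m \<alpha>" "fs_norm p m \<alpha> f \<le> 1" by (auto simp: unit_ball_def)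
  have "fs_norm \<infinity> m \<alpha> (T f) \<le> ennreal C * fs_norm p m \<alpha> f" by (rule assms[OF f(1)])
  also have "\<dots> \<le> ennreal C * 1" by (intro mult_left_mono f) simp
  finally show "fs_norm \<infinity> m \<alpha> (T f) \<le> ennreal C" by simp
qed

lemma op_norm_finite_imp_berezin_bounded:
  fixes u :: "complex ^ 'n \<Rightarrow> complex"
  assumes "\<alpha> > 0" "p > 0" "op_norm p m \<alpha> (wcomp u \<psi>) < \<infinity>"
  shows "\<exists>B. \<forall>z. berezin m \<alpha> u \<psi> z \<le> B"
proof -
  obtain c where "c > 0" and c: "\<And>(u :: complex ^ 'n \<Rightarrow> complex) \<psi> z.
      ennreal (c * berezin m \<alpha> u \<psi> z) \<le> op_norm p m \<alpha> (wcomp u \<psi>)"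
    using berezin_le_op_norm[OF assms(1,2), of m, where 'n = 'n] by blast
  obtain X where X: "op_norm p m \<alpha> (wcomp u \<psi>) = ennreal X" "X \<ge> 0"
    using assms(3) by (cases "op_norm p m \<alpha> (wcomp u \<psi>)") auto
  have "c * berezin m \<alpha> u \<psi> z \<le> X" for z
    using c[of u \<psi> z] X by simp
  then have "berezin m \<alpha> u \<psi> z \<le> X / c" for z
    using \<open>c > 0\<close> by (simp add: pos_le_divide_eq mult.commute)
  then show ?thesis by blast
qed

lemma bounded_op_iff:
  fixes u :: "complex ^ 'n \<Rightarrow> complex"
  assumes "\<alpha> > 0" "p > 0" "entire u" "entire_map \<psi>"
  shows "bounded_op p m \<alpha> (wcomp u \<psi>) \<longleftrightarrow> (\<exists>B. \<forall>z. berezin m \<alpha> u \<psi> z \<le> B)"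
proof
  assume "bounded_op p m \<alpha> (wcomp u \<psi>)"
  then obtain C where "\<And>f. f \<in> fock_sobolev p m \<alpha> \<Longrightarrow>
      fs_norm \<infinity> m \<alpha> (wcomp u \<psi> f) \<le> ennreal C * fs_norm p m \<alpha> f"
    unfolding bounded_op_def by blast
  from op_norm_le_bounded[OF this] have "op_norm p m \<alpha> (wcomp u \<psi>) < \<infinity>"
    by (simp add: le_less_trans)
  then show "\<exists>B. \<forall>z. berezin m \<alpha> u \<psi> z \<le> B"
    by (rule op_norm_finite_imp_berezin_bounded[OF assms(1,2)])
next
  assume "\<exists>B. \<forall>z. berezin m \<alpha> u \<psi> z \<le> B"
  then obtain B where B: "\<And>z. berezin m \<alpha> u \<psi> z \<le> B" by blast
  obtain C where "C > 0" and C: "\<And>(u :: complex ^ 'n \<Rightarrow> complex) \<psi> f B. entire f \<Longrightarrow>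
      (\<And>z. berezin m \<alpha> u \<psi> z \<le> B) \<Longrightarrow>
      fs_norm \<infinity> m \<alpha> (wcomp u \<psi> f) \<le> ennreal (C * B) * fs_norm p m \<alpha> f"
    using fs_norm_wcomp_le[OF assms(1,2), of m, where 'n = 'n] by blast
  have "wcomp u \<psi> ` fock_sobolev p m \<alpha> \<subseteq> fock_sobolev \<infinity> m \<alpha>"
    using wcomp_maps_fock_sobolev[OF assms B] by blast
  moreover have "fs_norm \<infinity> m \<alpha> (wcomp u \<psi> f) \<le> ennreal (C * B) * fs_norm p m \<alpha> f"
    if "f \<in> fock_sobolev p m \<alpha>" for f
    using that by (intro C B) (simp add: fock_sobolev_iff)
  ultimately show "bounded_op p m \<alpha> (wcomp u \<psi>)" unfolding bounded_op_def by blast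
qed

lemma op_norm_equiv_Linf_norm:
  assumes "\<alpha> > 0" "p > 0"
  shows "\<exists>C>0. \<forall>(u :: complex ^ 'n \<Rightarrow> complex) \<psi>. entire u \<longrightarrow> entire_map \<psi> \<longrightarrow>
        bounded_op p m \<alpha> (wcomp u \<psi>) \<longrightarrow>
          op_norm p m \<alpha> (wcomp u \<psi>) \<le> ennreal C * Linf_norm (berezin m \<alpha> u \<psi>) \<and>
          Linf_norm (berezin m \<alpha> u \<psi>) \<le> ennreal C * op_norm p m \<alpha> (wcomp u \<psi>)"
proof -
  obtain C where "C > 0" and C: "\<And>(u :: complex ^ 'n \<Rightarrow> complex) \<psi> f B. entire f \<Longrightarrow>
      (\<And>z. berezin m \<alpha> u \<psi> z \<le> B) \<Longrightarrow>
      fs_norm \<infinity> m \<alpha> (wcomp u \<psi> f) \<le> ennreal (C * B) * fs_norm p m \<alpha> f"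
    using fs_norm_wcomp_le[OF assms, of m, where 'n = 'n] by blast
  obtain c where "c > 0" and c: "\<And>(u :: complex ^ 'n \<Rightarrow> complex) \<psi> z.
      ennreal (c * berezin m \<alpha> u \<psi> z) \<le> op_norm p m \<alpha> (wcomp u \<psi>)"
    using berezin_le_op_norm[OF assms, of m, where 'n = 'n] by blast
  show ?thesis
  proof (intro exI[of _ "max C (1 / c)"] conjI allI impI)
    show "max C (1 / c) > 0" using \<open>C > 0\<close> by simp
    fix u :: "complex ^ 'n \<Rightarrow> complex" and \<psi> :: "complex ^ 'n \<Rightarrow> complex ^ 'n"
    assume u: "entire u" and \<psi>: "entire_map \<psi>" and bd: "bounded_op p m \<alpha> (wcomp u \<psi>)"
    note cont = berezin_continuous_on[OF u \<psi>, of m \<alpha>]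
    have "berezin m \<alpha> u \<psi> \<in> Linf"
      using bd bounded_op_iff[OF assms u \<psi>] Linf_iff_bounded[OF cont berezin_nonneg] by blast
    then have "Linf_norm (berezin m \<alpha> u \<psi>) < \<infinity>" by (simp add: Linf_def)
    then obtain B where B: "Linf_norm (berezin m \<alpha> u \<psi>) = ennreal B" "B \<ge> 0"
      by (cases "Linf_norm (berezin m \<alpha> u \<psi>)") auto
    have le: "berezin m \<alpha> u \<psi> z \<le> B" for z
      using continuous_le_Linf_norm[OF cont, of z] B by simp
    have "op_norm p m \<alpha> (wcomp u \<psi>) \<le> ennreal (C * B)"
      by (intro op_norm_le_bounded C le) (simp add: fock_sobolev_iff)
    also have "\<dots> \<le> ennreal (max C (1 / c) * B)"
      using B(2) by (intro ennreal_leI mult_right_mono) auto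
    also have "\<dots> = ennreal (max C (1 / c)) * Linf_norm (berezin m \<alpha> u \<psi>)"
      using B \<open>C > 0\<close> by (simp add: ennreal_mult)
    finally show "op_norm p m \<alpha> (wcomp u \<psi>) \<le> ennreal (max C (1 / c)) * Linf_norm (berezin m \<alpha> u \<psi>)" .
    show "Linf_norm (berezin m \<alpha> u \<psi>) \<le> ennreal (max C (1 / c)) * op_norm p m \<alpha> (wcomp u \<psi>)"
    proof (rule Linf_norm_le[OF cont])
      fix z
      have "ennreal \<bar>berezin m \<alpha> u \<psi> z\<bar> = ennreal (1 / c) * ennreal (c * berezin m \<alpha> u \<psi> z)"
        using \<open>c > 0\<close> by (simp add: ennreal_mult[symmetric])
      also have "\<dots> \<le> ennreal (max C (1 / c)) * op_norm p m \<alpha> (wcomp u \<psi>)"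
        by (intro mult_mono c ennreal_leI) auto
      finally show "ennreal \<bar>berezin m \<alpha> u \<psi> z\<bar> \<le> ennreal (max C (1 / c)) * op_norm p m \<alpha> (wcomp u \<psi>)" .
    qed
  qed
qed

section \<open>Compactness\<close>

lemma decay_diff:
  assumes "decay \<alpha> m f" "decay \<alpha> m g"
  shows "decay \<alpha> m (\<lambda>z. f z - g z)"
proof -
  obtain A where A: "\<And>z. (1 + norm z) ^ m * wabs \<alpha> f z \<le> A" and f: "entire f"
    using assms(1) by (auto simp: decay_iff_wabs)
  obtain B where B: "\<And>z. (1 + norm z) ^ m * wabs \<alpha> g z \<le> B" and g: "entire g"
    using assms(2) by (auto simp: decay_iff_wabs)
  have "(1 + norm z) ^ m * wabs \<alpha> (\<lambda>z. f z - g z) z \<le> A + B" for z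
  proof -
    have "wabs \<alpha> (\<lambda>z. f z - g z) z \<le> wabs \<alpha> f z + wabs \<alpha> g z"
      unfolding wabs_def distrib_right[symmetric]
      by (intro mult_right_mono norm_triangle_ineq4) simp
    then have "(1 + norm z) ^ m * wabs \<alpha> (\<lambda>z. f z - g z) z
        \<le> (1 + norm z) ^ m * (wabs \<alpha> f z + wabs \<alpha> g z)"
      by (intro mult_left_mono) auto
    with A[of z] B[of z] show ?thesis by (simp add: distrib_left)
  qed
  then show ?thesis unfolding decay_iff_wabs using entire_diff[OF f g] by blast
qed

lemma wabs_diff_commute: "wabs \<alpha> (\<lambda>z. f z - g z) z = wabs \<alpha> (\<lambda>z. g z - f z) z"
  by (simp add: wabs_def norm_minus_commute)

lemma weight_le_fs_dist:
  assumes "decay \<alpha> m f" "decay \<alpha> m g"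
  shows "norm z ^ m * wabs \<alpha> (\<lambda>z. f z - g z) z \<le> fs_dist m \<alpha> f g"
proof -
  let ?h = "\<lambda>z. f z - g z"
  have fin: "fs_norm \<infinity> m \<alpha> ?h < \<infinity>"
    by (rule decay_imp_fs_norm_finite[OF decay_diff[OF assms]])
  have "ennreal (norm z ^ m * wabs \<alpha> ?h z) \<le> fs_norm \<infinity> m \<alpha> ?h"
    unfolding fs_norm_infinity by (rule SUP_upper) simp
  also have "\<dots> = ennreal (fs_dist m \<alpha> f g)" using fin by (simp add: fs_dist_def)
  finally show ?thesis by (simp add: fs_dist_def)
qed

lemma fs_dist_le:
  assumes "\<And>z. norm z ^ m * wabs \<alpha> (\<lambda>z. f z - g z) z \<le> B" "B \<ge> 0"
  shows "fs_dist m \<alpha> f g \<le> B"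
  unfolding fs_dist_def using enn2real_mono[OF fs_norm_infinity_le[OF assms(1)]] assms(2) by simp

text \<open>
  Convergence in the metric implies locally uniform convergence, including near the origin, where
  the weight \<open>|z|\<^sup>m\<close> degenerates.
\<close>

lemma full_weight_le_fs_dist:
  assumes "\<alpha> > 0"
  obtains C where "C > 0" "\<And>(f :: complex ^ 'n \<Rightarrow> complex) g w. decay \<alpha> m f \<Longrightarrow> decay \<alpha> m g \<Longrightarrow>
    (1 + norm w) ^ m * wabs \<alpha> (\<lambda>z. f z - g z) w \<le> C * fs_dist m \<alpha> f g"
proof -
  obtain C where "C > 0" and C: "\<And>(f :: complex ^ 'n \<Rightarrow> complex) w. entire f \<Longrightarrow>
      ennreal ((1 + norm w) ^ m * wabs \<alpha> f w) \<le> ennreal C * fs_norm \<infinity> m \<alpha> f"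
    using point_evaluation_bound[OF assms, of \<infinity> m, where 'n = 'n] by (auto simp: zero_less_iff_neq_zero)
  have "(1 + norm w) ^ m * wabs \<alpha> (\<lambda>z. f z - g z) w \<le> C * fs_dist m \<alpha> f g"
    if "decay \<alpha> m f" "decay \<alpha> m g" for f g :: "complex ^ 'n \<Rightarrow> complex" and w
  proof -
    let ?h = "\<lambda>z. f z - g z"
    have dec: "decay \<alpha> m ?h" by (rule decay_diff[OF that])
    then have "entire ?h" by (simp add: decay_def)
    have "ennreal ((1 + norm w) ^ m * wabs \<alpha> ?h w) \<le> ennreal C * ennreal (fs_dist m \<alpha> f g)"
      using C[OF \<open>entire ?h\<close>, of w] decay_imp_fs_norm_finite[OF dec] by (simp add: fs_dist_def)
    then show ?thesis using \<open>C > 0\<close> by (simp add: ennreal_mult[symmetric] fs_dist_def)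
  qed
  with \<open>C > 0\<close> show ?thesis by (rule that)
qed

lemma wabs_eq_0_iff: "wabs \<alpha> f z = 0 \<longleftrightarrow> f z = 0"
  by (simp add: wabs_def)

lemma Metric_space_fock_sobolev:
  assumes "\<alpha> > 0"
  shows "Metric_space (fock_sobolev \<infinity> m \<alpha> :: (complex ^ 'n \<Rightarrow> complex) set) (fs_dist m \<alpha>)"
proof
  fix f g h :: "complex ^ 'n \<Rightarrow> complex"
  show "0 \<le> fs_dist m \<alpha> f g" by (simp add: fs_dist_def)
  show "fs_dist m \<alpha> f g = fs_dist m \<alpha> g f"
    unfolding fs_dist_def fs_norm_infinity by (simp only: wabs_diff_commute[of \<alpha> f g])
  assume "f \<in> fock_sobolev \<infinity> m \<alpha>" "g \<in> fock_sobolev \<infinity> m \<alpha>"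
  then have f: "decay \<alpha> m f" and g: "decay \<alpha> m g"
    using fock_sobolev_infinity_iff_decay[OF assms] by blast+
  show "fs_dist m \<alpha> f g = 0 \<longleftrightarrow> f = g"
  proof
    assume 0: "fs_dist m \<alpha> f g = 0"
    obtain C where "C > 0" and C: "\<And>(f :: complex ^ 'n \<Rightarrow> complex) g w. decay \<alpha> m f \<Longrightarrow> decay \<alpha> m g \<Longrightarrow>
        (1 + norm w) ^ m * wabs \<alpha> (\<lambda>z. f z - g z) w \<le> C * fs_dist m \<alpha> f g"
      using full_weight_le_fs_dist[OF assms, where m = m and 'n = 'n] by blast
    have "f w = g w" for w
    proof -
      have "1 + norm w > 0" by (simp add: add_pos_nonneg)
      then have pos: "(1 + norm w) ^ m > 0" by (rule zero_less_power)
      have "(1 + norm w) ^ m * wabs \<alpha> (\<lambda>z. f z - g z) w \<le> 0"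
        using C[OF f g, of w] 0 by simp
      then have "wabs \<alpha> (\<lambda>z. f z - g z) w \<le> 0"
        using pos by (simp add: mult_le_0_iff not_le)
      then have "wabs \<alpha> (\<lambda>z. f z - g z) w = 0"
        by (intro antisym) auto
      then show ?thesis by (simp add: wabs_eq_0_iff)
    qed
    then show "f = g" by blast
  next
    assume "f = g"
    then have "fs_dist m \<alpha> f g \<le> 0" by (intro fs_dist_le) (auto simp: wabs_def)
    then show "fs_dist m \<alpha> f g = 0" by (intro antisym) (auto simp: fs_dist_def)
  qed
  assume "h \<in> fock_sobolev \<infinity> m \<alpha>"
  then have h: "decay \<alpha> m h"
    using fock_sobolev_infinity_iff_decay[OF assms] by blast
  show "fs_dist m \<alpha> f h \<le> fs_dist m \<alpha> f g + fs_dist m \<alpha> g h"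
  proof (rule fs_dist_le)
    fix z
    have "norm (f z - h z) \<le> norm (f z - g z) + norm (g z - h z)"
      using norm_triangle_ineq[of "f z - g z" "g z - h z"] by simp
    then have "wabs \<alpha> (\<lambda>z. f z - h z) z \<le> wabs \<alpha> (\<lambda>z. f z - g z) z + wabs \<alpha> (\<lambda>z. g z - h z) z"
      unfolding wabs_def distrib_right[symmetric] by (intro mult_right_mono) auto
    then have "norm z ^ m * wabs \<alpha> (\<lambda>z. f z - h z) z
        \<le> norm z ^ m * (wabs \<alpha> (\<lambda>z. f z - g z) z + wabs \<alpha> (\<lambda>z. g z - h z) z)"
      by (intro mult_left_mono) auto
    with weight_le_fs_dist[OF f g, of z] weight_le_fs_dist[OF g h, of z]
    show "norm z ^ m * wabs \<alpha> (\<lambda>z. f z - h z) z \<le> fs_dist m \<alpha> f g + fs_dist m \<alpha> g h"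
      by (simp add: distrib_left)
  qed (simp add: fs_dist_def)
qed

lemma norm_le_wabs:
  assumes "\<alpha> > 0" "norm z \<le> R"
  shows "norm (f z) \<le> exp (\<alpha> / 2 * R\<^sup>2) * wabs \<alpha> f z"
proof -
  have "(norm z)\<^sup>2 \<le> R\<^sup>2" using assms by (intro power_mono) auto
  then have "exp (\<alpha> / 2 * (norm z)\<^sup>2) \<le> exp (\<alpha> / 2 * R\<^sup>2)" using assms by simp
  then have "exp (\<alpha> / 2 * (norm z)\<^sup>2) * wabs \<alpha> f z \<le> exp (\<alpha> / 2 * R\<^sup>2) * wabs \<alpha> f z"
    by (intro mult_right_mono) auto
  moreover have "exp (\<alpha> / 2 * (norm z)\<^sup>2) * wabs \<alpha> f z = norm (f z)"
    by (simp add: wabs_def exp_minus field_simps)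
  ultimately show ?thesis by (simp only:)
qed

lemma wabs_le_norm: "\<alpha> > 0 \<Longrightarrow> wabs \<alpha> f z \<le> norm (f z)"
  unfolding wabs_def by (intro mult_left_le) auto

lemma wabs_le_full_weight: "wabs \<alpha> f z \<le> (1 + norm z) ^ m * wabs \<alpha> f z"
  using mult_right_mono[OF one_le_power[of "1 + norm z" m], of "wabs \<alpha> f z"] by simp

text \<open>
  A Cauchy sequence converges locally uniformly to an entire function; letting one index tend to
  infinity in the pointwise weighted estimates gives convergence in the metric and the decay of
  the limit.
\<close>

lemma mcomplete_fock_sobolev:
  assumes "\<alpha> > 0"
  shows "Metric_space.mcomplete (fock_sobolev \<infinity> m \<alpha> :: (complex ^ 'n \<Rightarrow> complex) set) (fs_dist m \<alpha>)"
proof -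
  interpret Metric_space "fock_sobolev \<infinity> m \<alpha> :: (complex ^ 'n \<Rightarrow> complex) set" "fs_dist m \<alpha>"
    by (rule Metric_space_fock_sobolev[OF assms])
  obtain C where "C > 0" and C: "\<And>(f :: complex ^ 'n \<Rightarrow> complex) g w. decay \<alpha> m f \<Longrightarrow> decay \<alpha> m g \<Longrightarrow>
      (1 + norm w) ^ m * wabs \<alpha> (\<lambda>z. f z - g z) w \<le> C * fs_dist m \<alpha> f g"
    using full_weight_le_fs_dist[OF assms, where m = m and 'n = 'n] by blast
  show ?thesis unfolding mcomplete_def
  proof (intro allI impI)
    fix \<sigma> assume "MCauchy \<sigma>"
    then have mem: "\<And>n. \<sigma> n \<in> fock_sobolev \<infinity> m \<alpha>"
      and cau: "\<And>\<epsilon>. \<epsilon> > 0 \<Longrightarrow> \<exists>N. \<forall>n n'. N \<le> n \<longrightarrow> N \<le> n' \<longrightarrow> fs_dist m \<alpha> (\<sigma> n) (\<sigma> n') < \<epsilon>"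
      unfolding MCauchy_def by blast+
    have dec: "decay \<alpha> m (\<sigma> n)" for n
      using mem fock_sobolev_infinity_iff_decay[OF assms] by blast
    then have ent: "entire (\<sigma> n)" for n by (simp add: decay_def)
    define f where "f z = lim (\<lambda>n. \<sigma> n z)" for z
    have ulim: "uniform_limit (cball 0 R) \<sigma> f sequentially" for R
    proof -
      have "uniformly_Cauchy_on (cball 0 R) \<sigma>"
        unfolding uniformly_Cauchy_on_def
      proof (intro allI impI)
        fix e :: real assume "e > 0"
        define E where "E = exp (\<alpha> / 2 * R\<^sup>2) * C"
        have "E > 0" using \<open>C > 0\<close> by (simp add: E_def)
        then obtain N where N: "\<And>n n'. N \<le> n \<Longrightarrow> N \<le> n' \<Longrightarrow> fs_dist m \<alpha> (\<sigma> n) (\<sigma> n') < e / E"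
          using cau[of "e / E"] \<open>e > 0\<close> by auto
        have "dist (\<sigma> n z) (\<sigma> n' z) < e" if "norm z \<le> R" "N \<le> n" "N \<le> n'" for z n n'
        proof -
          let ?h = "\<lambda>z. \<sigma> n z - \<sigma> n' z"
          have "norm (?h z) \<le> exp (\<alpha> / 2 * R\<^sup>2) * wabs \<alpha> ?h z"
            by (rule norm_le_wabs[OF assms that(1)])
          also have "\<dots> \<le> exp (\<alpha> / 2 * R\<^sup>2) * (C * fs_dist m \<alpha> (\<sigma> n) (\<sigma> n'))"
            by (intro mult_left_mono order_trans[OF wabs_le_full_weight C[OF dec dec]]) auto
          also have "\<dots> = E * fs_dist m \<alpha> (\<sigma> n) (\<sigma> n')" by (simp add: E_def)
          also have "\<dots> < e"
            using N[OF that(2,3)] \<open>E > 0\<close> by (simp add: pos_less_divide_eq mult.commute)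
          finally show ?thesis by (simp add: dist_norm)
        qed
        then show "\<exists>M. \<forall>x\<in>cball 0 R. \<forall>m\<ge>M. \<forall>n\<ge>M. dist (\<sigma> m x) (\<sigma> n x) < e"
          by (intro exI[of _ N]) auto
      qed
      then have "uniformly_convergent_on (cball 0 R) \<sigma>"
        by (rule Cauchy_uniformly_convergent)
      then show ?thesis
        unfolding uniformly_convergent_uniform_limit_iff f_def[abs_def] .
    qed
    have f: "entire f" by (rule entire_uniform_limit(2)[OF ent ulim])
    have ptw: "(\<lambda>n. \<sigma> n z) \<longlonglongrightarrow> f z" for z
      by (rule tendsto_uniform_limitI[OF ulim[of "norm z"]]) simp
    have close: "norm z ^ m * wabs \<alpha> (\<lambda>z. \<sigma> n z - f z) z \<le> \<epsilon>"
      if N: "\<And>n n'. N \<le> n \<Longrightarrow> N \<le> n' \<Longrightarrow> fs_dist m \<alpha> (\<sigma> n) (\<sigma> n') < \<epsilon>" and "N \<le> n" for N n \<epsilon> z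
    proof (rule Lim_bounded)
      show "(\<lambda>k. norm z ^ m * wabs \<alpha> (\<lambda>z. \<sigma> n z - \<sigma> k z) z) \<longlonglongrightarrow>
          norm z ^ m * wabs \<alpha> (\<lambda>z. \<sigma> n z - f z) z"
        unfolding wabs_def by (intro tendsto_intros ptw)
      show "\<forall>k\<ge>N. norm z ^ m * wabs \<alpha> (\<lambda>z. \<sigma> n z - \<sigma> k z) z \<le> \<epsilon>"
        using order_trans[OF weight_le_fs_dist[OF dec dec] less_imp_le[OF N[OF \<open>N \<le> n\<close>]]] by blast
    qed
    have "decay \<alpha> m f"
    proof -
      obtain N where N: "\<And>n n'. N \<le> n \<Longrightarrow> N \<le> n' \<Longrightarrow> fs_dist m \<alpha> (\<sigma> n) (\<sigma> n') < 1"
        using cau[of 1] by auto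
      have "fs_norm \<infinity> m \<alpha> (\<lambda>z. \<sigma> N z - f z) \<le> ennreal 1"
        by (rule fs_norm_infinity_le) (use close[OF N, of N] in auto)
      then have "decay \<alpha> m (\<lambda>z. \<sigma> N z - f z)"
        using decay_iff_fs_norm_finite[OF assms entire_diff[OF ent f]] by (auto intro: le_less_trans)
      from decay_diff[OF dec this, of N] show ?thesis by simp
    qed
    then have "f \<in> fock_sobolev \<infinity> m \<alpha>"
      using fock_sobolev_infinity_iff_decay[OF assms] by blast
    moreover have "\<forall>\<^sub>F n in sequentially. \<sigma> n \<in> fock_sobolev \<infinity> m \<alpha> \<and> fs_dist m \<alpha> (\<sigma> n) f < \<epsilon>"
      if "\<epsilon> > 0" for \<epsilon>
    proof -
      obtain N where N: "\<And>n n'. N \<le> n \<Longrightarrow> N \<le> n' \<Longrightarrow> fs_dist m \<alpha> (\<sigma> n) (\<sigma> n') < \<epsilon> / 2"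
        using cau[of "\<epsilon> / 2"] \<open>\<epsilon> > 0\<close> by auto
      have "fs_dist m \<alpha> (\<sigma> n) f < \<epsilon>" if "N \<le> n" for n
      proof -
        have "fs_dist m \<alpha> (\<sigma> n) f \<le> \<epsilon> / 2"
          by (rule fs_dist_le) (use close[OF N that] \<open>\<epsilon> > 0\<close> in auto)
        with \<open>\<epsilon> > 0\<close> show ?thesis by linarith
      qed
      then have "\<forall>n\<ge>N. \<sigma> n \<in> fock_sobolev \<infinity> m \<alpha> \<and> fs_dist m \<alpha> (\<sigma> n) f < \<epsilon>"
        using mem by blast
      then show ?thesis unfolding eventually_sequentially by blast
    qed
    ultimately show "\<exists>x. limitin mtopology \<sigma> x sequentially"
      unfolding limitin_metric by blast
  qed
qed

text \<open>
  Montel's theorem in the form that total boundedness needs: the sequence is equicontinuous on the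
  ball of radius \<open>R\<close>, so a subsequence converges uniformly there, and two late members are close.
\<close>

lemma Montel_close_pair:
  fixes F :: "nat \<Rightarrow> complex ^ 'n \<Rightarrow> complex"
  assumes ent: "\<And>n. entire (F n)" and M: "\<And>n w. norm w \<le> R + 1 \<Longrightarrow> norm (F n w) \<le> M"
    and "R \<ge> 0" "\<eta> > 0"
  shows "\<exists>i j. i < j \<and> (\<forall>w. norm w \<le> R \<longrightarrow> norm (F i w - F j w) < \<eta>)"
proof -
  have M0: "M \<ge> 0" using order_trans[OF norm_ge_zero M[of 0 0]] \<open>R \<ge> 0\<close> by simp
  obtain g k where k: "strict_mono (k :: nat \<Rightarrow> nat)"
    and lim: "\<And>e. 0 < e \<Longrightarrow> \<exists>N. \<forall>n x. n \<ge> N \<and> x \<in> cball 0 R \<longrightarrow> norm (F (k n) x - g x) < e"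
  proof (rule Arzela_Ascoli[of "cball 0 R" F M])
    show "norm (F n x) \<le> M" if "x \<in> cball 0 R" for n x
      using that by (intro M) simp
    show "\<exists>d>0. \<forall>n y. y \<in> cball 0 R \<and> norm (x - y) < d \<longrightarrow> norm (F n x - F n y) < e"
      if x: "x \<in> cball 0 R" and "e > 0" for x e
    proof (intro exI[of _ "e / (M + 1)"] conjI allI impI)
      show "e / (M + 1) > 0" using M0 \<open>e > 0\<close> by simp
      fix n y assume y: "y \<in> cball 0 R \<and> norm (x - y) < e / (M + 1)"
      have "norm (F n x - F n y) \<le> M * norm (x - y)"
        by (rule entire_Lipschitz[OF ent M]) (use x y in auto)
      also have "\<dots> \<le> (M + 1) * norm (x - y)" by (intro mult_right_mono) auto
      also have "\<dots> < e" using y M0 by (simp add: pos_less_divide_eq mult.commute)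
      finally show "norm (F n x - F n y) < e" .
    qed
  qed auto
  obtain N where N: "\<And>n x. n \<ge> N \<Longrightarrow> norm x \<le> R \<Longrightarrow> norm (F (k n) x - g x) < \<eta> / 2"
    using lim[of "\<eta> / 2"] \<open>\<eta> > 0\<close> by auto
  have "norm (F (k N) w - F (k (Suc N)) w) < \<eta>" if "norm w \<le> R" for w
    using N[of N w] N[of "Suc N" w] that norm_triangle_ineq4[of "F (k N) w - g w" "F (k (Suc N)) w - g w"]
    by simp
  then show ?thesis using strict_monoD[OF k, of N "Suc N"] by blast
qed

lemma (in Metric_space) not_mtotally_bounded_separated_sequence:
  assumes "S \<subseteq> M" "\<not> mtotally_bounded S"
  obtains \<epsilon> x where "\<epsilon> > 0" "\<And>n :: nat. x n \<in> S" "\<And>i j. i < j \<Longrightarrow> \<epsilon> \<le> d (x i) (x j)"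
proof -
  have "\<exists>\<epsilon>>0. \<forall>K. finite K \<longrightarrow> K \<subseteq> S \<longrightarrow> \<not> S \<subseteq> (\<Union>x\<in>K. mball x \<epsilon>)"
    using assms(2) by (simp add: mtotally_bounded_def imp_conjL conj_commute) blast
  then obtain \<epsilon> where "\<epsilon> > 0"
    and \<epsilon>: "\<And>K. finite K \<Longrightarrow> K \<subseteq> S \<Longrightarrow> \<not> S \<subseteq> (\<Union>x\<in>K. mball x \<epsilon>)" by auto
  \<comment> \<open>Pick \<open>x n\<close> outside the balls around its predecessors, which form a finite set.\<close>
  have "\<exists>x. \<forall>n :: nat. x n \<in> S \<and> (\<forall>i<n. \<epsilon> \<le> d (x i) (x n))"
  proof (rule dependent_wellorder_choice)
    fix n :: nat and x assume x: "\<And>i. i < n \<Longrightarrow> x i \<in> S \<and> (\<forall>j<i. \<epsilon> \<le> d (x j) (x i))"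
    have "\<not> S \<subseteq> (\<Union>y\<in>x ` {..<n}. mball y \<epsilon>)"
      using x by (intro \<epsilon>) auto
    then obtain r where "r \<in> S" "\<And>i. i < n \<Longrightarrow> r \<notin> mball (x i) \<epsilon>" by blast
    moreover have "x i \<in> M" if "i < n" for i using x[OF that] assms(1) by blast
    ultimately show "\<exists>r. r \<in> S \<and> (\<forall>i<n. \<epsilon> \<le> d (x i) r)"
      using assms(1) by (intro exI[of _ r]) (auto simp: in_mball not_less)
  qed auto
  then obtain x where x: "\<And>n :: nat. x n \<in> S \<and> (\<forall>i<n. \<epsilon> \<le> d (x i) (x n))" by blast
  show ?thesis by (rule that[OF \<open>\<epsilon> > 0\<close>, of x]) (use x in auto)
qed

text \<open>
  Otherwise some sequence of images is \<open>\<epsilon>\<close>-separated.  Choose \<open>N\<close> such that \<open>berezin\<close> is below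
  \<open>\<epsilon> / (4 C)\<close> where \<open>|\<psi>| > N\<close>, with \<open>C\<close> the bound for point evaluations on the unit ball.  There
  any two images differ by at most \<open>\<epsilon>/2\<close>.  Where \<open>|\<psi>| \<le> N\<close>, so do the images of two functions that
  are close on the ball of radius \<open>N\<close>, and Montel's theorem provides such a pair.
\<close>

lemma mtotally_bounded_wcomp_unit_ball:
  fixes u :: "complex ^ 'n \<Rightarrow> complex"
  assumes "\<alpha> > 0" "p > 0" "entire u" "entire_map \<psi>"
    and B: "\<And>z. berezin m \<alpha> u \<psi> z \<le> B"
    and van: "\<And>\<epsilon>. \<epsilon> > 0 \<Longrightarrow> \<exists>N>0. \<forall>z. norm (\<psi> z) > N \<longrightarrow> berezin m \<alpha> u \<psi> z < \<epsilon>"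
  shows "Metric_space.mtotally_bounded (fock_sobolev \<infinity> m \<alpha>) (fs_dist m \<alpha>)
    (wcomp u \<psi> ` unit_ball p m \<alpha>)"
proof -
  interpret Metric_space "fock_sobolev \<infinity> m \<alpha> :: (complex ^ 'n \<Rightarrow> complex) set" "fs_dist m \<alpha>"
    by (rule Metric_space_fock_sobolev[OF assms(1)])
  let ?S = "wcomp u \<psi> ` unit_ball p m \<alpha>"
  have sub: "?S \<subseteq> fock_sobolev \<infinity> m \<alpha>"
    using wcomp_maps_fock_sobolev[OF assms(1-4) B] by (auto simp: unit_ball_def)
  have "B \<ge> 0" using B[of 0] berezin_nonneg[of m \<alpha> u \<psi> 0] by linarith
  obtain C where "C > 0" and C: "\<And>(f :: complex ^ 'n \<Rightarrow> complex) w. entire f \<Longrightarrow>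
      ennreal ((1 + norm w) ^ m * wabs \<alpha> f w) \<le> ennreal C * fs_norm p m \<alpha> f"
    using point_evaluation_bound[OF assms(1,2), of m, where 'n = 'n] by blast
  have unit: "(1 + norm w) ^ m * wabs \<alpha> f w \<le> C" if "f \<in> unit_ball p m \<alpha>" for f :: "complex ^ 'n \<Rightarrow> complex" and w
  proof -
    have f: "entire f" "fs_norm p m \<alpha> f \<le> 1"
      using that by (auto simp: unit_ball_def fock_sobolev_iff)
    have "ennreal ((1 + norm w) ^ m * wabs \<alpha> f w) \<le> ennreal C * 1"
      by (rule order_trans[OF C[OF f(1)]]) (intro mult_left_mono f(2); simp)
    then show ?thesis using \<open>C > 0\<close> by simp
  qed
  show ?thesis
  proof (rule ccontr)
    assume "\<not> mtotally_bounded ?S"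
    then obtain \<epsilon> x where "\<epsilon> > 0" and x: "\<And>n :: nat. x n \<in> ?S" and sep: "\<And>i j. i < j \<Longrightarrow> \<epsilon> \<le> fs_dist m \<alpha> (x i) (x j)"
      using not_mtotally_bounded_separated_sequence[OF sub] by blast
    have "\<exists>f. f \<in> unit_ball p m \<alpha> \<and> x n = wcomp u \<psi> f" for n using x[of n] by blast
    then obtain F where F: "\<And>n. F n \<in> unit_ball p m \<alpha>" "\<And>n. x n = wcomp u \<psi> (F n)"
      by metis
    have ent: "entire (F n)" for n using F(1)[of n] by (auto simp: unit_ball_def fock_sobolev_iff)
    obtain N where "N > 0" and N: "\<And>z. norm (\<psi> z) > N \<Longrightarrow> berezin m \<alpha> u \<psi> z < \<epsilon> / (4 * C)"
      using van[of "\<epsilon> / (4 * C)"] \<open>\<epsilon> > 0\<close> \<open>C > 0\<close> by auto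
    define D where "D = (B + 1) * (1 + N) ^ m"
    \<comment> \<open>\<open>D\<close> bounds \<open>berezin\<close> times the weight where \<open>|\<psi>| \<le> N\<close>; the summand \<open>1\<close> keeps it positive if \<open>B = 0\<close>.\<close>
    define \<eta> where "\<eta> = \<epsilon> / 2 / D"
    have "D > 0" using \<open>B \<ge> 0\<close> \<open>N > 0\<close> by (simp add: D_def)
    then have "\<eta> > 0" using \<open>\<epsilon> > 0\<close> by (simp add: \<eta>_def)
    have "\<exists>i j. i < j \<and> (\<forall>w. norm w \<le> N \<longrightarrow> norm (F i w - F j w) < \<eta>)"
    proof (rule Montel_close_pair[OF ent])
      fix n and w :: "complex ^ 'n" assume w: "norm w \<le> N + 1"
      have "norm (F n w) \<le> exp (\<alpha> / 2 * (N + 1)\<^sup>2) * wabs \<alpha> (F n) w"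
        by (rule norm_le_wabs[OF assms(1) w])
      also have "\<dots> \<le> exp (\<alpha> / 2 * (N + 1)\<^sup>2) * C"
        by (intro mult_left_mono order_trans[OF wabs_le_full_weight unit[OF F(1)]]) auto
      finally show "norm (F n w) \<le> exp (\<alpha> / 2 * (N + 1)\<^sup>2) * C" .
    qed (use \<open>N > 0\<close> \<open>\<eta> > 0\<close> in auto)
    then obtain i j where "i < j" and ij: "\<And>w. norm w \<le> N \<Longrightarrow> norm (F i w - F j w) < \<eta>"
      by blast
    have "fs_dist m \<alpha> (x i) (x j) \<le> \<epsilon> / 2"
    proof (rule fs_dist_le)
      fix z
      let ?h = "\<lambda>w. F i w - F j w" and ?w = "\<psi> z"
      have "(\<lambda>z. x i z - x j z) = wcomp u \<psi> ?h"
        by (simp add: F(2) wcomp_def right_diff_distrib)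
      then have eq: "norm z ^ m * wabs \<alpha> (\<lambda>z. x i z - x j z) z
          = berezin m \<alpha> u \<psi> z * ((1 + norm ?w) ^ m * wabs \<alpha> ?h ?w)"
        by (simp only: wabs_wcomp)
      show "norm z ^ m * wabs \<alpha> (\<lambda>z. x i z - x j z) z \<le> \<epsilon> / 2"
      proof (cases "norm ?w \<le> N")
        case True
        have "wabs \<alpha> ?h ?w \<le> \<eta>"
          using wabs_le_norm[OF assms(1), of ?h ?w] ij[OF True] by linarith
        then have "(1 + norm ?w) ^ m * wabs \<alpha> ?h ?w \<le> (1 + N) ^ m * \<eta>"
          using True \<open>N > 0\<close> by (intro mult_mono power_mono) auto
        from mult_mono[OF _ this, of "berezin m \<alpha> u \<psi> z" "B + 1"] have "berezin m \<alpha> u \<psi> z * ((1 + norm ?w) ^ m * wabs \<alpha> ?h ?w) \<le> (B + 1) * ((1 + N) ^ m * \<eta>)"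
          using B[of z] \<open>B \<ge> 0\<close> by simp
        also have "\<dots> = D * \<eta>" by (simp only: D_def mult.assoc)
        also have "\<dots> = \<epsilon> / 2" using \<open>D > 0\<close> by (simp add: \<eta>_def)
        finally show ?thesis unfolding eq .
      next
        case False
        have "wabs \<alpha> ?h ?w \<le> wabs \<alpha> (F i) ?w + wabs \<alpha> (F j) ?w"
          unfolding wabs_def distrib_right[symmetric]
          by (intro mult_right_mono norm_triangle_ineq4) simp
        then have "(1 + norm ?w) ^ m * wabs \<alpha> ?h ?w
            \<le> (1 + norm ?w) ^ m * (wabs \<alpha> (F i) ?w + wabs \<alpha> (F j) ?w)"
          by (intro mult_left_mono) auto
        also have "\<dots> \<le> C + C"
          using unit[OF F(1), of ?w i] unit[OF F(1), of ?w j] by (simp add: distrib_left)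
        finally have "berezin m \<alpha> u \<psi> z * ((1 + norm ?w) ^ m * wabs \<alpha> ?h ?w) \<le> \<epsilon> / (4 * C) * (C + C)"
          using N[of z] False \<open>C > 0\<close> \<open>\<epsilon> > 0\<close> by (intro mult_mono) auto
        also have "\<dots> = \<epsilon> / 2" using \<open>C > 0\<close> by simp
        finally show ?thesis unfolding eq .
      qed
    qed (use \<open>\<epsilon> > 0\<close> in simp)
    with sep[OF \<open>i < j\<close>] \<open>\<epsilon> > 0\<close> show False by simp
  qed
qed

text \<open>
  As \<open>|w\<^sub>k| \<rightarrow> \<infinity>\<close> the Gaussian centred at \<open>w\<^sub>k\<close> moves away from every fixed point.
\<close>

lemma scaled_kernel_tendsto_0:
  assumes "\<alpha> > 0" "filterlim (\<lambda>k. norm (w k)) at_top sequentially"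
  shows "(\<lambda>k. of_real c * scaled_kernel \<alpha> m (w k) v) \<longlonglongrightarrow> 0"
proof (rule Lim_null_comparison)
  let ?E = "exp (\<alpha> / 2 * (norm v)\<^sup>2)"
  show "\<forall>\<^sub>F k in sequentially. norm (of_real c * scaled_kernel \<alpha> m (w k) v)
      \<le> ?E * (\<bar>c\<bar> * exp (- (\<alpha> / 2 * (norm (v - w k))\<^sup>2)))"
  proof (intro always_eventually allI)
    fix k
    have "(1 + norm (w k)) ^ m \<ge> 1" by (intro one_le_power) simp
    then have "(1 + norm (w k)) ^ m \<ge> 1" "(1 + norm (w k)) ^ m > 0" by linarith+
    then have "\<bar>c\<bar> * exp (- (\<alpha> / 2) * (norm (v - w k))\<^sup>2) / (1 + norm (w k)) ^ m
        \<le> \<bar>c\<bar> * exp (- (\<alpha> / 2) * (norm (v - w k))\<^sup>2) / 1"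
      by (intro divide_left_mono) auto
    then have "wabs \<alpha> (\<lambda>z. of_real c * scaled_kernel \<alpha> m (w k) z) v
        \<le> \<bar>c\<bar> * exp (- (\<alpha> / 2) * (norm (v - w k))\<^sup>2)"
      unfolding wabs_scaled_kernel by simp
    then have "?E * wabs \<alpha> (\<lambda>z. of_real c * scaled_kernel \<alpha> m (w k) z) v
        \<le> ?E * (\<bar>c\<bar> * exp (- (\<alpha> / 2) * (norm (v - w k))\<^sup>2))"
      by (intro mult_left_mono) auto
    with norm_le_wabs[OF assms(1) order_refl[of "norm v"], of "\<lambda>z. of_real c * scaled_kernel \<alpha> m (w k) z"]
    show "norm (of_real c * scaled_kernel \<alpha> m (w k) v) \<le> ?E * (\<bar>c\<bar> * exp (- (\<alpha> / 2 * (norm (v - w k))\<^sup>2)))"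
      unfolding mult_minus_left by linarith
  qed
  have "filterlim (\<lambda>k. norm (v - w k)) at_top sequentially"
  proof (rule filterlim_at_top_mono)
    show "filterlim (\<lambda>k. - norm v + norm (w k)) at_top sequentially"
      by (rule filterlim_tendsto_add_at_top[OF tendsto_const assms(2)])
    show "\<forall>\<^sub>F k in sequentially. - norm v + norm (w k) \<le> norm (v - w k)"
      using norm_triangle_ineq2[of "w _" v] by (auto simp: norm_minus_commute)
  qed
  then have "filterlim (\<lambda>k. \<alpha> / 2 * (norm (v - w k))\<^sup>2) at_top sequentially"
    using assms(1) by (intro filterlim_tendsto_pos_mult_at_top[OF tendsto_const] filterlim_pow_at_top) auto
  then have "filterlim (\<lambda>k. - (\<alpha> / 2 * (norm (v - w k))\<^sup>2)) at_bot sequentially"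
    by (simp only: filterlim_uminus_at_top)
  then have "(\<lambda>k. exp (- (\<alpha> / 2 * (norm (v - w k))\<^sup>2))) \<longlonglongrightarrow> 0"
    by (rule filterlim_compose[OF exp_at_bot])
  then show "(\<lambda>k. ?E * (\<bar>c\<bar> * exp (- (\<alpha> / 2 * (norm (v - w k))\<^sup>2)))) \<longlonglongrightarrow> 0"
    by (intro tendsto_mult_right_zero)
qed

text \<open>
  Suppose \<open>berezin\<close> is at least \<open>\<epsilon>\<close> at points \<open>\<zeta>\<^sub>k\<close> with \<open>|\<psi>(\<zeta>\<^sub>k)| \<rightarrow> \<infinity>\<close>.  By total boundedness and
  completeness the images of the kernels at \<open>\<psi>(\<zeta>\<^sub>k)\<close> have a convergent subsequence.  Its limit is
  \<open>0\<close> because the kernels tend to \<open>0\<close> pointwise, whereas the image of the \<open>k\<close>-th kernel has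
  weighted value at least \<open>c \<epsilon>\<close> at \<open>\<zeta>\<^sub>k\<close>.
\<close>

lemma berezin_vanishes_if_mtotally_bounded:
  fixes u :: "complex ^ 'n \<Rightarrow> complex"
  assumes "\<alpha> > 0" "p > 0"
    and tb: "Metric_space.mtotally_bounded (fock_sobolev \<infinity> m \<alpha>) (fs_dist m \<alpha>)
      (wcomp u \<psi> ` unit_ball p m \<alpha>)"
    and "\<epsilon> > 0"
  shows "\<exists>N>0. \<forall>z. norm (\<psi> z) > N \<longrightarrow> berezin m \<alpha> u \<psi> z < \<epsilon>"
proof (rule ccontr)
  interpret Metric_space "fock_sobolev \<infinity> m \<alpha> :: (complex ^ 'n \<Rightarrow> complex) set" "fs_dist m \<alpha>"
    by (rule Metric_space_fock_sobolev[OF assms(1)])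
  assume "\<not> ?thesis"
  then have "\<exists>z. norm (\<psi> z) > real (Suc k) \<and> berezin m \<alpha> u \<psi> z \<ge> \<epsilon>" for k
    by (metis not_less of_nat_0_less_iff zero_less_Suc)
  then obtain \<zeta> where \<zeta>: "\<And>k. norm (\<psi> (\<zeta> k)) > real (Suc k)" "\<And>k. berezin m \<alpha> u \<psi> (\<zeta> k) \<ge> \<epsilon>"
    by metis
  obtain c where "c > 0" and c: "\<And>w :: complex ^ 'n. (\<lambda>z. of_real c * scaled_kernel \<alpha> m w z) \<in> unit_ball p m \<alpha>"
    using scaled_kernel_in_unit_ball[OF assms(1,2), of m, where 'n = 'n] by blast
  define g where "g k = (\<lambda>z. of_real c * scaled_kernel \<alpha> m (\<psi> (\<zeta> k)) z)" for k
  define h where "h k = wcomp u \<psi> (g k)" for k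
  have "range h \<subseteq> wcomp u \<psi> ` unit_ball p m \<alpha>"
    unfolding h_def g_def using c by blast
  then obtain r where r: "strict_mono (r :: nat \<Rightarrow> nat)" "MCauchy (h \<circ> r)"
    using tb unfolding mtotally_bounded_sequentially by blast
  then obtain l where l: "limitin mtopology (h \<circ> r) l sequentially"
    using mcomplete_fock_sobolev[OF assms(1), where m = m and 'n = 'n] unfolding mcomplete_def by blast
  then have "l \<in> fock_sobolev \<infinity> m \<alpha>" by (rule limitin_mspace)
  then have dl: "decay \<alpha> m l"
    using fock_sobolev_infinity_iff_decay[OF assms(1)] by blast
  have "(h \<circ> r) n \<in> fock_sobolev \<infinity> m \<alpha>" for n
    using r(2) unfolding MCauchy_def by blast
  then have dh: "decay \<alpha> m (h (r n))" for n
    using fock_sobolev_infinity_iff_decay[OF assms(1)] by auto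
  have dist0: "(\<lambda>n. fs_dist m \<alpha> (h (r n)) l) \<longlonglongrightarrow> 0"
    using l unfolding limitin_metric_dist_null by (simp add: o_def)
  obtain C where "C > 0" and C: "\<And>(f :: complex ^ 'n \<Rightarrow> complex) g w. decay \<alpha> m f \<Longrightarrow> decay \<alpha> m g \<Longrightarrow>
      (1 + norm w) ^ m * wabs \<alpha> (\<lambda>z. f z - g z) w \<le> C * fs_dist m \<alpha> f g"
    using full_weight_le_fs_dist[OF assms(1), where m = m and 'n = 'n] by blast
  have l0: "l z = 0" for z
  proof -
    have "filterlim (\<lambda>k. norm (\<psi> (\<zeta> k))) at_top sequentially"
    proof (rule filterlim_at_top_mono)
      show "filterlim (\<lambda>k. real k) at_top sequentially" by (rule filterlim_real_sequentially)
      show "\<forall>\<^sub>F k in sequentially. real k \<le> norm (\<psi> (\<zeta> k))"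
        using \<zeta>(1) by (intro always_eventually allI) (smt (verit) of_nat_Suc)
    qed
    then have "(\<lambda>k. of_real c * scaled_kernel \<alpha> m (\<psi> (\<zeta> k)) (\<psi> z)) \<longlonglongrightarrow> 0"
      by (rule scaled_kernel_tendsto_0[OF assms(1)])
    then have "(\<lambda>k. u z * (of_real c * scaled_kernel \<alpha> m (\<psi> (\<zeta> k)) (\<psi> z))) \<longlonglongrightarrow> 0"
      by (rule tendsto_mult_right_zero)
    then have "(\<lambda>k. h k z) \<longlonglongrightarrow> 0" by (simp add: h_def g_def wcomp_def)
    then have 1: "(\<lambda>n. h (r n) z) \<longlonglongrightarrow> 0"
      using LIMSEQ_subseq_LIMSEQ[OF _ r(1)] by (force simp: o_def)
    have "(\<lambda>n. h (r n) z - l z) \<longlonglongrightarrow> 0"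
    proof (rule Lim_null_comparison)
      let ?E = "exp (\<alpha> / 2 * (norm z)\<^sup>2)"
      show "\<forall>\<^sub>F n in sequentially. norm (h (r n) z - l z) \<le> ?E * (C * fs_dist m \<alpha> (h (r n)) l)"
      proof (intro always_eventually allI)
        fix n
        have "norm (h (r n) z - l z) \<le> ?E * wabs \<alpha> (\<lambda>z. h (r n) z - l z) z"
          by (rule norm_le_wabs[OF assms(1) order_refl])
        also have "\<dots> \<le> ?E * (C * fs_dist m \<alpha> (h (r n)) l)"
          by (intro mult_left_mono order_trans[OF wabs_le_full_weight C[OF dh dl]]) auto
        finally show "norm (h (r n) z - l z) \<le> ?E * (C * fs_dist m \<alpha> (h (r n)) l)" .
      qed
      show "(\<lambda>n. ?E * (C * fs_dist m \<alpha> (h (r n)) l)) \<longlonglongrightarrow> 0"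
        by (intro tendsto_mult_right_zero dist0)
    qed
    then have "(\<lambda>n. h (r n) z) \<longlonglongrightarrow> l z" by (simp add: LIM_zero_iff)
    with 1 show ?thesis using LIMSEQ_unique by blast
  qed
  have "c * \<epsilon> \<le> fs_dist m \<alpha> (h (r n)) l" for n
  proof -
    let ?z = "\<zeta> (r n)"
    have "c * \<epsilon> \<le> c * berezin m \<alpha> u \<psi> ?z"
      using \<zeta>(2) \<open>c > 0\<close> by (intro mult_left_mono) auto
    also have "\<dots> = norm ?z ^ m * wabs \<alpha> (h (r n)) ?z"
      unfolding h_def g_def using \<open>c > 0\<close> by (simp only: berezin_eq_scaled_kernel less_imp_le)
    also have "\<dots> \<le> fs_dist m \<alpha> (h (r n)) l"
      using weight_le_fs_dist[OF dh dl, of ?z n] by (simp add: l0)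
    finally show ?thesis .
  qed
  then have "c * \<epsilon> \<le> 0"
    using LIMSEQ_le_const[OF dist0] by blast
  with \<open>c > 0\<close> \<open>\<epsilon> > 0\<close> show False by (simp add: mult_le_0_iff)
qed

text \<open>
  A totally bounded image of the unit ball is metrically bounded, so the operator norm is finite.
  Boundedness then follows through the criterion for \<open>berezin\<close>, which covers functions of infinite
  or zero weighted norm as well.
\<close>

lemma bounded_op_if_mtotally_bounded:
  fixes u :: "complex ^ 'n \<Rightarrow> complex"
  assumes "\<alpha> > 0" "p > 0" "entire u" "entire_map \<psi>"
    and tb: "Metric_space.mtotally_bounded (fock_sobolev \<infinity> m \<alpha>) (fs_dist m \<alpha>)
      (wcomp u \<psi> ` unit_ball p m \<alpha>)"
  shows "bounded_op p m \<alpha> (wcomp u \<psi>)"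
proof -
  interpret Metric_space "fock_sobolev \<infinity> m \<alpha> :: (complex ^ 'n \<Rightarrow> complex) set" "fs_dist m \<alpha>"
    by (rule Metric_space_fock_sobolev[OF assms(1)])
  obtain a X where aX: "wcomp u \<psi> ` unit_ball p m \<alpha> \<subseteq> mcball a X"
    using mtotally_bounded_imp_mbounded[OF tb] unfolding mbounded_def by blast
  have "op_norm p m \<alpha> (wcomp u \<psi>) \<le> fs_norm \<infinity> m \<alpha> a + ennreal X"
    unfolding op_norm_def
  proof (rule SUP_least)
    fix f :: "complex ^ 'n \<Rightarrow> complex" assume "f \<in> unit_ball p m \<alpha>"
    let ?h = "wcomp u \<psi> f"
    have "?h \<in> mcball a X" using aX \<open>f \<in> unit_ball p m \<alpha>\<close> by blast
    then have mem: "a \<in> fock_sobolev \<infinity> m \<alpha>" "?h \<in> fock_sobolev \<infinity> m \<alpha>"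
      and dist: "fs_dist m \<alpha> a ?h \<le> X" unfolding in_mcball by blast+
    have da: "decay \<alpha> m a" and dh: "decay \<alpha> m ?h"
      using mem fock_sobolev_infinity_iff_decay[OF assms(1)] by blast+
    show "fs_norm \<infinity> m \<alpha> ?h \<le> fs_norm \<infinity> m \<alpha> a + ennreal X"
      unfolding fs_norm_infinity[of m \<alpha> ?h]
    proof (rule SUP_least)
      fix z
      have "norm (?h z) \<le> norm (a z) + norm (a z - ?h z)"
        by (metis norm_minus_commute norm_triangle_sub)
      then have "wabs \<alpha> ?h z \<le> wabs \<alpha> a z + wabs \<alpha> (\<lambda>z. a z - ?h z) z"
        unfolding wabs_def distrib_right[symmetric] by (intro mult_right_mono) auto
      then have "norm z ^ m * wabs \<alpha> ?h z \<le> norm z ^ m * (wabs \<alpha> a z + wabs \<alpha> (\<lambda>z. a z - ?h z) z)"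
        by (intro mult_left_mono) auto
      also have "\<dots> \<le> norm z ^ m * wabs \<alpha> a z + X"
        using weight_le_fs_dist[OF da dh, of z] dist by (simp add: distrib_left)
      finally have "ennreal (norm z ^ m * wabs \<alpha> ?h z) \<le> ennreal (norm z ^ m * wabs \<alpha> a z + X)"
        by (rule ennreal_leI)
      also have "\<dots> = ennreal (norm z ^ m * wabs \<alpha> a z) + ennreal X"
        using order_trans[OF nonneg dist] by (intro ennreal_plus) auto
      also have "\<dots> \<le> fs_norm \<infinity> m \<alpha> a + ennreal X"
        unfolding fs_norm_infinity by (intro add_right_mono SUP_upper) simp
      finally show "ennreal (norm z ^ m * wabs \<alpha> ?h z) \<le> fs_norm \<infinity> m \<alpha> a + ennreal X" .
    qed
  qed
  moreover have "fs_norm \<infinity> m \<alpha> a < \<infinity>"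
  proof -
    obtain c where "\<And>w :: complex ^ 'n. (\<lambda>z. of_real c * scaled_kernel \<alpha> m w z) \<in> unit_ball p m \<alpha>"
      using scaled_kernel_in_unit_ball[OF assms(1,2), of m, where 'n = 'n] by blast
    then have "wcomp u \<psi> (\<lambda>z. of_real c * scaled_kernel \<alpha> m 0 z) \<in> mcball a X" using aX by blast
    then have "a \<in> fock_sobolev \<infinity> m \<alpha>" unfolding in_mcball by blast
    then show ?thesis
      using fock_sobolev_infinity_iff_decay[OF assms(1)] decay_imp_fs_norm_finite by blast
  qed
  ultimately have "op_norm p m \<alpha> (wcomp u \<psi>) < \<infinity>"
    by (simp add: le_less_trans)
  then show ?thesis
    using op_norm_finite_imp_berezin_bounded[OF assms(1,2)] bounded_op_iff[OF assms(1-4)] by blast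
qed

text \<open>
  The target space is complete, so its subset \<open>wcomp u \<psi> ` unit_ball p m \<alpha>\<close> has compact closure if and
  only if it is totally bounded.
\<close>

lemma compact_op_iff:
  fixes u :: "complex ^ 'n \<Rightarrow> complex"
  assumes "\<alpha> > 0" "p > 0" "entire u" "entire_map \<psi>"
  shows "compact_op p m \<alpha> (wcomp u \<psi>) \<longleftrightarrow>
    bounded_op p m \<alpha> (wcomp u \<psi>) \<and>
    (\<forall>\<epsilon>>0. \<exists>N>0. \<forall>z. norm (\<psi> z) > N \<longrightarrow> \<bar>berezin m \<alpha> u \<psi> z\<bar> < \<epsilon>)"
proof -
  interpret Metric_space "fock_sobolev \<infinity> m \<alpha> :: (complex ^ 'n \<Rightarrow> complex) set" "fs_dist m \<alpha>"
    by (rule Metric_space_fock_sobolev[OF assms(1)])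
  have compact: "compact_op p m \<alpha> (wcomp u \<psi>) \<longleftrightarrow>
      wcomp u \<psi> ` fock_sobolev p m \<alpha> \<subseteq> fock_sobolev \<infinity> m \<alpha> \<and>
      mtotally_bounded (wcomp u \<psi> ` unit_ball p m \<alpha>)"
    unfolding compact_op_def fs_topology_def
      mtotally_bounded_eq_compact_closure_of[OF mcomplete_fock_sobolev[OF assms(1)]]
    by (auto simp: unit_ball_def)
  show ?thesis
  proof
    assume "compact_op p m \<alpha> (wcomp u \<psi>)"
    then have tb: "mtotally_bounded (wcomp u \<psi> ` unit_ball p m \<alpha>)" using compact by blast
    show "bounded_op p m \<alpha> (wcomp u \<psi>) \<and>
        (\<forall>\<epsilon>>0. \<exists>N>0. \<forall>z. norm (\<psi> z) > N \<longrightarrow> \<bar>berezin m \<alpha> u \<psi> z\<bar> < \<epsilon>)"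
      using bounded_op_if_mtotally_bounded[OF assms tb]
        berezin_vanishes_if_mtotally_bounded[OF assms(1,2) tb] by simp
  next
    assume R: "bounded_op p m \<alpha> (wcomp u \<psi>) \<and>
        (\<forall>\<epsilon>>0. \<exists>N>0. \<forall>z. norm (\<psi> z) > N \<longrightarrow> \<bar>berezin m \<alpha> u \<psi> z\<bar> < \<epsilon>)"
    then obtain B where B: "\<And>z. berezin m \<alpha> u \<psi> z \<le> B"
      using bounded_op_iff[OF assms] by blast
    have "mtotally_bounded (wcomp u \<psi> ` unit_ball p m \<alpha>)"
      by (rule mtotally_bounded_wcomp_unit_ball[OF assms B]) (use R in simp)
    moreover have "wcomp u \<psi> ` fock_sobolev p m \<alpha> \<subseteq> fock_sobolev \<infinity> m \<alpha>"
      using R by (simp add: bounded_op_def)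
    ultimately show "compact_op p m \<alpha> (wcomp u \<psi>)" using compact by blast
  qed
qed

theorem theorem3p5:
  fixes m :: nat and \<alpha> :: real and p :: ennreal
  assumes "\<alpha> > 0" and "p > 0"
  shows
    "(\<forall>(u :: complex ^ 'n \<Rightarrow> complex) \<psi>. entire u \<longrightarrow> entire_map \<psi> \<longrightarrow>
        (bounded_op p m \<alpha> (wcomp u \<psi>) \<longleftrightarrow> berezin m \<alpha> u \<psi> \<in> Linf)) \<and>
     (\<exists>C>0. \<forall>(u :: complex ^ 'n \<Rightarrow> complex) \<psi>. entire u \<longrightarrow> entire_map \<psi> \<longrightarrow>
        bounded_op p m \<alpha> (wcomp u \<psi>) \<longrightarrow>
          op_norm p m \<alpha> (wcomp u \<psi>) \<le> ennreal C * Linf_norm (berezin m \<alpha> u \<psi>) \<and>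
          Linf_norm (berezin m \<alpha> u \<psi>) \<le> ennreal C * op_norm p m \<alpha> (wcomp u \<psi>)) \<and>
     (\<forall>(u :: complex ^ 'n \<Rightarrow> complex) \<psi>. entire u \<longrightarrow> entire_map \<psi> \<longrightarrow>
        (compact_op p m \<alpha> (wcomp u \<psi>) \<longleftrightarrow>
           bounded_op p m \<alpha> (wcomp u \<psi>) \<and>
           (\<forall>\<epsilon>>0. \<exists>N>0. \<forall>z. norm (\<psi> z) > N \<longrightarrow> \<bar>berezin m \<alpha> u \<psi> z\<bar> < \<epsilon>)))"
proof (intro conjI allI impI)
  fix u :: "complex ^ 'n \<Rightarrow> complex" and \<psi> :: "complex ^ 'n \<Rightarrow> complex ^ 'n"
  assume "entire u" "entire_map \<psi>"
  note hyps = assms this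
  show "bounded_op p m \<alpha> (wcomp u \<psi>) \<longleftrightarrow> berezin m \<alpha> u \<psi> \<in> Linf"
    unfolding bounded_op_iff[OF hyps]
      Linf_iff_bounded[OF berezin_continuous_on[OF hyps(3,4)] berezin_nonneg] ..
  show "compact_op p m \<alpha> (wcomp u \<psi>) \<longleftrightarrow> bounded_op p m \<alpha> (wcomp u \<psi>) \<and>
      (\<forall>\<epsilon>>0. \<exists>N>0. \<forall>z. norm (\<psi> z) > N \<longrightarrow> \<bar>berezin m \<alpha> u \<psi> z\<bar> < \<epsilon>)"
    by (rule compact_op_iff[OF hyps])
qed (rule op_norm_equiv_Linf_norm[OF assms])

end
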